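(* Let $k$ be a positive integer. There exists an acute triangle $T$ that admits a reptiling in which one of the vertices of $T$ is adjacent to (i.e. is a point of) exactly $k$ tiles if and only if $k = 1$ or $k = 2$.
   Context: An $r$-reptiling of a triangle $T$ ($r \ge 2$) is a subdivision of $T$ into $r$ triangles (tiles) with pairwise disjoint interiors, each similar to $T$ and all mutually congruent. A reptiling of $T$ is a an $r$-reptiling for some $r\ge 2$. A triangle is acute if all its angles are less than $\pi/2$. *)

theory Defs
  imports "HOL-Analysis.Analysis"
begin

type_synonym point = "real^2"

text \<open>Interior angle at \<open>B\<close> of the triangle with vertices \<open>A\<close>, \<open>B\<close>, \<open>C\<close>.
  Only meaningful for \<open>A \<noteq> B\<close> and \<open>C \<noteq> B\<close>.\<close>

definition angle :: "point \<Rightarrow> point \<Rightarrow> point \<Rightarrow> real" where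
  "angle A B C = arccos (((A - B) \<bullet> (C - B)) / (norm (A - B) * norm (C - B)))"

definition acute :: "point \<Rightarrow> point \<Rightarrow> point \<Rightarrow> bool" where
  "acute A B C \<longleftrightarrow>
     angle B A C < pi / 2 \<and> angle A B C < pi / 2 \<and> angle A C B < pi / 2"

text \<open>Triangles are closed solid regions, and non-degenerate.\<close>

definition is_triangle :: "point set \<Rightarrow> bool" where
  "is_triangle S \<longleftrightarrow> (\<exists>A B C. \<not> collinear {A, B, C} \<and> S = convex hull {A, B, C})"

text \<open>Similarities and congruences of the plane; orientation-reversing ones are included.\<close>

definition similar :: "point set \<Rightarrow> point set \<Rightarrow> bool" where
  "similar S S' \<longleftrightarrow>
     (\<exists>c f. c > 0 \<and> (\<forall>x y. dist (f x) (f y) = c * dist x y) \<and> f ` S = S')"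

definition congruent_sets :: "point set \<Rightarrow> point set \<Rightarrow> bool" where
  "congruent_sets S S' \<longleftrightarrow> (\<exists>f. (\<forall>x y. dist (f x) (f y) = dist x y) \<and> f ` S = S')"

text \<open>Tilings need not be edge-to-edge. Tiles have non-empty interior, so disjointness of
  interiors makes it harmless to collect them in a set rather than in an indexed family.
  Finiteness of \<open>P\<close> follows from \<open>card P = r \<ge> 2\<close>.\<close>

definition r_reptiling :: "nat \<Rightarrow> point set \<Rightarrow> point set set \<Rightarrow> bool" where
  "r_reptiling r T P \<longleftrightarrow>
     r \<ge> 2 \<and> card P = r \<and> \<Union>P = T \<and>
     (\<forall>t\<in>P. is_triangle t) \<and>
     (\<forall>s\<in>P. \<forall>t\<in>P. s \<noteq> t \<longrightarrow> interior s \<inter> interior t = {}) \<and>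
     (\<forall>t\<in>P. similar t T) \<and>
     (\<forall>s\<in>P. \<forall>t\<in>P. congruent_sets s t)"

definition reptiling :: "point set \<Rightarrow> point set set \<Rightarrow> bool" where
  "reptiling T P \<longleftrightarrow> (\<exists>r\<ge>2. r_reptiling r T P)"

end

theory Submission
  imports Defs "HOL-Analysis.Analysis" "HOL-Computational_Algebra.Polynomial_Factorial"
begin

text \<open>
  \<^bold>\<open>At most two tiles.\<close> Suppose \<open>k \<ge> 3\<close> tiles meet at a vertex of \<open>T\<close>. Any two angles of an acute
  triangle add up to more than a right angle, so these tiles all contribute the same angle \<open>\<alpha>\<close>, and the
  angles of \<open>T\<close> are \<open>\<alpha>\<close>, \<open>\<gamma> = k\<alpha>\<close> and \<open>\<beta> = \<pi> - (k + 1)\<alpha>\<close>. At a tile vertex that is not a vertex of \<open>T\<close>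
  the angles add up to \<open>p\<alpha> + q\<beta> + r\<gamma> = \<pi>\<close> or \<open>2\<pi>\<close>, and \<open>p\<close>, \<open>q\<close>, \<open>r\<close> have equal sums over all vertices.
  Generically \<open>p \<ge> r\<close> everywhere, with strict inequality at the split vertex: a contradiction. For the
  finitely many nongeneric angles per \<open>k\<close> another linear functional of \<open>(p, q, r)\<close> works, except for
  \<open>k = 3\<close> with \<open>\<alpha> = 2\<pi>/13\<close> or \<open>\<alpha> = 2\<pi>/15\<close>. In these two cases a side of \<open>T\<close> issuing from the split
  vertex carries a tile side of the wrong kind, whereas arithmetic in the field of \<open>2 cos \<alpha>\<close> only
  allows sides of the right kind there.

  \<^bold>\<open>Two tiles occur.\<close> In the triangle with sides \<open>4, 5, 6\<close> one has \<open>\<gamma> = 2\<alpha>\<close>. The bisector of \<open>\<gamma>\<close> cuts off a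
  similar triangle and leaves an isosceles one with angles \<open>\<alpha>, \<alpha>, \<pi> - 2\<alpha>\<close>. The latter is dissected around
  an interior point \<open>P\<close>, where angles \<open>\<gamma>, \<gamma>, \<gamma>, \<beta>, \<beta>\<close> meet, into triangles similar to \<open>T\<close> and
  parallelograms with an angle \<open>\<alpha>\<close>, all with rational sides, hence all tiled by one small tile.
\<close>

section \<open>The angle of a set at a point\<close>

text \<open>Acuteness enters as \<open>2k < \<pi>/\<alpha> < 2k + 2\<close>, which is
  \<open>\<gamma> < \<pi>/2\<close> and \<open>\<beta> < \<pi>/2\<close> rewritten. Counting alone
  cannot succeed for \<open>k = 3\<close> at the two exceptional angles, because there the counts
  can balance. The corners of \<open>T\<close> contribute \<open>(p, q, r) = (4, 1, 0)\<close> in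
  total; for \<open>2\<pi>/13\<close> the vertex types \<open>(1, 0, 4)\<close> and
  \<open>(0, 4, 1)\<close>, for \<open>2\<pi>/15\<close> the types \<open>(1, 4, 0)\<close> and
  \<open>(0, 0, 5)\<close> complete this to \<open>(5, 5, 5)\<close>. The arithmetic then rests on
  the number of tiles being the square of the similarity ratio \<open>lam\<close>. Along the side of
  length \<open>a\<close> opposite \<open>\<alpha>\<close>, tile sides give
  \<open>lam a = x a + y b + z c\<close>, and \<open>y + z \<ge> 1\<close> because a tile with angle
  \<open>\<alpha>\<close> at the split vertex cannot have its side opposite \<open>\<alpha>\<close>
  issue from there. By the sine rule \<open>b/a\<close> and \<open>c/a\<close> are polynomials in
  \<open>t = 2 cos \<alpha>\<close>, so a polynomial in \<open>t\<close> has an integer square;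
  comparison with the minimal polynomial of \<open>t\<close> gives \<open>y = z = 0\<close>. The
  dissection for \<open>k = 2\<close> is built on the vertex relation
  \<open>3\<gamma> + 2\<beta> = 2\<pi>\<close>, which holds when
  \<open>\<gamma> = 2\<alpha>\<close>.\<close>

definition cross2 :: "point \<Rightarrow> point \<Rightarrow> real" where
  "cross2 u v = u$1 * v$2 - u$2 * v$1"

definition dir :: "real \<Rightarrow> point" where
  "dir \<phi> = vector [cos \<phi>, sin \<phi>]"

lemma dir_nth [simp]: "dir \<phi> $ 1 = cos \<phi>" "dir \<phi> $ 2 = sin \<phi>"
  by (simp_all add: dir_def)

lemma point_eq_iff: "(x::point) = y \<longleftrightarrow> x$1 = y$1 \<and> x$2 = y$2"
  by (simp add: vec_eq_iff forall_2)

lemma inner_point: "(x::point) \<bullet> y = x$1 * y$1 + x$2 * y$2"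
  by (simp add: inner_vec_def sum_2)

lemma cross2_add_scaleR: "cross2 d (v + r *\<^sub>R w - p) = cross2 d (v - p) + r * cross2 d w"
  by (simp add: cross2_def algebra_simps)

lemma cross2_swap: "cross2 u v = - cross2 v u"
  by (simp add: cross2_def)

lemma collinear_iff_cross2: "collinear {A, B, C} \<longleftrightarrow> cross2 (B - A) (C - A) = 0"
proof -
  have "collinear {A, B, C} \<longleftrightarrow> collinear {B, A, C}" by (metis insert_commute)
  also have "\<dots> \<longleftrightarrow> collinear {0, B - A, C - A}"
    by (rule collinear_3) (simp add: NO_MATCH_def)
  also have "\<dots> \<longleftrightarrow> cross2 (B - A) (C - A) = 0"
  proof -
    define u v where "u = B - A" "v = C - A"
    have "collinear {0, u, v} \<longleftrightarrow> cross2 u v = 0"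
    proof
      assume "collinear {0, u, v}"
      then show "cross2 u v = 0" by (auto simp: collinear_lemma cross2_def)
    next
      assume c: "cross2 u v = 0"
      show "collinear {0, u, v}"
      proof (cases "u = 0")
        case False
        then have "u$1 \<noteq> 0 \<or> u$2 \<noteq> 0" by (simp add: point_eq_iff)
        then show ?thesis
        proof
          assume n: "u$1 \<noteq> 0"
          have "v = (v$1 / u$1) *\<^sub>R u" using n c by (simp add: point_eq_iff cross2_def field_simps)
          then show ?thesis unfolding collinear_lemma by blast
        next
          assume n: "u$2 \<noteq> 0"
          have "v = (v$2 / u$2) *\<^sub>R u" using n c by (simp add: point_eq_iff cross2_def field_simps)
          then show ?thesis unfolding collinear_lemma by blast
        qed
      qed (simp add: collinear_lemma)
    qed
    then show ?thesis by (simp add: u_v_def)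
  qed
  finally show ?thesis .
qed

text \<open>The three cross products, divided by that of the whole triangle, are the barycentric
  coordinates of \<open>x\<close>.\<close>

lemma in_triangle_iff:
  assumes "cross2 (B - A) (C - A) > 0"
  shows "x \<in> convex hull {A, B, C} \<longleftrightarrow>
           cross2 (B - A) (x - A) \<ge> 0 \<and> cross2 (C - B) (x - B) \<ge> 0 \<and> cross2 (A - C) (x - C) \<ge> 0"
    (is "_ \<longleftrightarrow> ?R")
proof
  assume "x \<in> convex hull {A, B, C}"
  then obtain u v w where uvw: "0 \<le> u" "0 \<le> v" "0 \<le> w" "u + v + w = 1"
    and x: "x = u *\<^sub>R A + v *\<^sub>R B + w *\<^sub>R C"
    by (auto simp: convex_hull_3)
  have u: "u = 1 - v - w" using uvw by simp
  have "cross2 (B - A) (x - A) = w * cross2 (B - A) (C - A)" "cross2 (C - B) (x - B) = u * cross2 (B - A) (C - A)"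
    "cross2 (A - C) (x - C) = v * cross2 (B - A) (C - A)"
    unfolding x u by (simp_all add: cross2_def algebra_simps)
  then show ?R using assms uvw by simp
next
  assume R: ?R
  define D where "D = cross2 (B - A) (C - A)"
  define w where "w = cross2 (B - A) (x - A) / D"
  define u where "u = cross2 (C - B) (x - B) / D"
  define v where "v = cross2 (A - C) (x - C) / D"
  have D: "D > 0" using assms D_def by simp
  have "cross2 (B - A) (x - A) + cross2 (C - B) (x - B) + cross2 (A - C) (x - C) = D"
    by (simp add: D_def cross2_def algebra_simps)
  then have s: "u + v + w = 1" using D by (simp add: u_def v_def w_def field_simps)
  have "D *\<^sub>R x = cross2 (C - B) (x - B) *\<^sub>R A + cross2 (A - C) (x - C) *\<^sub>R B + cross2 (B - A) (x - A) *\<^sub>R C"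
    by (simp add: point_eq_iff D_def cross2_def algebra_simps)
  moreover have "cross2 (C - B) (x - B) = D * u" "cross2 (A - C) (x - C) = D * v" "cross2 (B - A) (x - A) = D * w"
    using D by (simp_all add: u_def v_def w_def)
  ultimately have "D *\<^sub>R x = D *\<^sub>R (u *\<^sub>R A + v *\<^sub>R B + w *\<^sub>R C)"
    by (simp add: algebra_simps)
  then have "x = u *\<^sub>R A + v *\<^sub>R B + w *\<^sub>R C" using D by (metis less_irrefl scaleR_left_imp_eq)
  moreover have "u \<ge> 0" "v \<ge> 0" "w \<ge> 0" using R D by (simp_all add: u_def v_def w_def)
  ultimately show "x \<in> convex hull {A, B, C}" using s by (auto simp: convex_hull_3)
qed

text \<open>Reduces later statements to counterclockwise triangles: in the other case two vertices
  are exchanged.\<close>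

lemma triangle_orient:
  assumes "\<not> collinear {A, B, C}"
  obtains "cross2 (B - A) (C - A) > 0" | "cross2 (C - A) (B - A) > 0"
  using assms cross2_swap[of "C - A" "B - A"] by (fastforce simp: collinear_iff_cross2)

text \<open>\<open>dirs S v\<close> is \<open>2\<pi>\<close>-periodic, and measuring it on one period makes \<open>ang\<close> additive on tilings: tiles
  count with their angle at a vertex, \<open>\<pi>\<close> at other boundary points and \<open>2\<pi>\<close> at interior points.\<close>

definition dirs :: "point set \<Rightarrow> point \<Rightarrow> real set" where
  "dirs S v = {\<phi>. \<forall>\<^sub>F r in at_right 0. v + r *\<^sub>R dir \<phi> \<in> S}"

definition ang :: "point set \<Rightarrow> point \<Rightarrow> real" where
  "ang S v = measure lebesgue (dirs S v \<inter> {0..<2*pi})"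

text \<open>An affine function has constant sign for small positive \<open>r\<close>. The second
  claim is a strong negation: failure of eventual nonnegativity means eventual negativity.\<close>

lemma eventually_affine_nonneg:
  fixes l m :: real
  shows "(\<forall>\<^sub>F r in at_right 0. l + r * m \<ge> 0) \<longleftrightarrow> l > 0 \<or> (l = 0 \<and> m \<ge> 0)" (is "?L \<longleftrightarrow> ?R")
    and "\<not> (l > 0 \<or> (l = 0 \<and> m \<ge> 0)) \<Longrightarrow> \<forall>\<^sub>F r in at_right 0. \<not> l + r * m \<ge> 0"
proof -
  have lim: "((\<lambda>r. l + r * m) \<longlongrightarrow> l) (at_right 0)"
    by (auto intro!: tendsto_eq_intros)
  have pos: "\<forall>\<^sub>F r in at_right (0::real). r > 0" by (rule eventually_at_right_less)
  show 2: "\<forall>\<^sub>F r in at_right 0. \<not> l + r * m \<ge> 0" if "\<not> ?R"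
  proof (cases "l = 0")
    case True
    show ?thesis using pos by eventually_elim (use that True in \<open>auto simp: not_le intro: mult_pos_neg\<close>)
  next
    case False
    then have "l < 0" using that by auto
    from order_tendstoD(2)[OF lim this] show ?thesis by eventually_elim auto
  qed
  show "?L \<longleftrightarrow> ?R"
  proof
    assume L: ?L
    show ?R
    proof (rule ccontr)
      assume "\<not> ?R"
      from 2[OF this] L have "\<forall>\<^sub>F r in at_right (0::real). False" by eventually_elim auto
      then show False by simp
    qed
  next
    assume ?R
    then show ?L
    proof (elim disjE conjE)
      assume "l > 0"
      from order_tendstoD(1)[OF lim this] show ?thesis by eventually_elim auto
    next
      assume "l = 0" "0 \<le> m"
      show ?thesis using pos by eventually_elim (use \<open>l = 0\<close> \<open>0 \<le> m\<close> in auto)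
    qed
  qed
qed

text \<open>Lexicographic positivity of \<open>(l, m)\<close>: the point is strictly inside the
  half-plane, or on its boundary with a direction that does not leave it.\<close>

definition admissible :: "real \<Rightarrow> real \<Rightarrow> bool" where
  "admissible l m \<longleftrightarrow> l > 0 \<or> (l = 0 \<and> m \<ge> 0)"

lemma dirs_triangle_iff:
  assumes "cross2 (B - A) (C - A) > 0"
  shows "\<phi> \<in> dirs (convex hull {A, B, C}) v \<longleftrightarrow>
    admissible (cross2 (B - A) (v - A)) (cross2 (B - A) (dir \<phi>)) \<and>
    admissible (cross2 (C - B) (v - B)) (cross2 (C - B) (dir \<phi>)) \<and>
    admissible (cross2 (A - C) (v - C)) (cross2 (A - C) (dir \<phi>))"
  unfolding dirs_def mem_Collect_eq in_triangle_iff[OF assms] eventually_conj_iff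
    cross2_add_scaleR eventually_affine_nonneg(1) admissible_def ..

text \<open>A ray may run in and out of a general set arbitrarily close to \<open>v\<close>. For a
  triangle, one violated half-plane condition already keeps the ray out near
  \<open>v\<close>.\<close>

lemma dirs_triangle_dichotomy:
  assumes "\<not> collinear {A, B, C}" "\<phi> \<notin> dirs (convex hull {A, B, C}) v"
  shows "\<forall>\<^sub>F r in at_right 0. v + r *\<^sub>R dir \<phi> \<notin> convex hull {A, B, C}"
proof -
  have *: "\<forall>\<^sub>F r in at_right 0. v + r *\<^sub>R dir \<phi> \<notin> convex hull {A, B, C}"
    if o: "cross2 (B - A) (C - A) > 0" and n: "\<phi> \<notin> dirs (convex hull {A, B, C}) v" for B C
  proof -
    note E = eventually_affine_nonneg(2)
    from n consider "\<not> admissible (cross2 (B - A) (v - A)) (cross2 (B - A) (dir \<phi>))"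
      | "\<not> admissible (cross2 (C - B) (v - B)) (cross2 (C - B) (dir \<phi>))"
      | "\<not> admissible (cross2 (A - C) (v - C)) (cross2 (A - C) (dir \<phi>))"
      unfolding dirs_triangle_iff[OF o] by blast
    then have "\<forall>\<^sub>F r in at_right 0. \<not> (cross2 (B - A) (v - A) + r * cross2 (B - A) (dir \<phi>) \<ge> 0 \<and> cross2 (C - B) (v - B) + r * cross2 (C - B) (dir \<phi>) \<ge> 0 \<and> cross2 (A - C) (v - C) + r * cross2 (A - C) (dir \<phi>) \<ge> 0)"
    proof cases
      case 1 from E[OF this[unfolded admissible_def]] show ?thesis by eventually_elim blast
    next
      case 2 from E[OF this[unfolded admissible_def]] show ?thesis by eventually_elim blast
    next
      case 3 from E[OF this[unfolded admissible_def]] show ?thesis by eventually_elim blast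
    qed
    then show ?thesis unfolding in_triangle_iff[OF o] cross2_add_scaleR .
  qed
  from assms(1) show ?thesis
  proof (cases rule: triangle_orient)
    case 1 then show ?thesis using * assms(2) by blast
  next
    case 2 then show ?thesis using *[of C B] assms(2) by (simp add: insert_commute)
  qed
qed

lemma polar:
  assumes "(u::point) \<noteq> 0"
  obtains \<phi> where "0 \<le> \<phi>" "\<phi> < 2 * pi" "u = norm u *\<^sub>R dir \<phi>"
proof -
  have n: "norm u > 0" using assms by simp
  have sq: "(norm u)\<^sup>2 = (u$1)\<^sup>2 + (u$2)\<^sup>2"
    by (simp only: power2_norm_eq_inner inner_point) (simp add: power2_eq_square)
  have "(u$1 / norm u)\<^sup>2 + (u$2 / norm u)\<^sup>2 = ((u$1)\<^sup>2 + (u$2)\<^sup>2) / (norm u)\<^sup>2"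
    by (simp add: power_divide add_divide_distrib)
  also have "\<dots> = 1" using n by (simp flip: sq)
  finally obtain \<phi> where "0 \<le> \<phi>" "\<phi> < 2 * pi" "u$1 / norm u = cos \<phi>" "u$2 / norm u = sin \<phi>"
    using sincos_total_2pi by (metis)
  moreover from this n have "u$1 = norm u * cos \<phi>" "u$2 = norm u * sin \<phi>"
    by (metis nonzero_mult_div_cancel_left times_divide_eq_right less_irrefl)+
  ultimately show ?thesis by (intro that[of \<phi>]) (simp_all only: point_eq_iff vector_scaleR_component dir_nth real_scaleR_def)
qed

lemma cross2_dir: "cross2 (\<rho> *\<^sub>R dir a) (dir b) = \<rho> * sin (b - a)"
  by (simp add: cross2_def sin_diff algebra_simps)

lemma cross2_dir_dir: "cross2 (\<rho> *\<^sub>R dir a) (\<sigma> *\<^sub>R dir b) = \<rho> * \<sigma> * sin (b - a)"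
  by (simp add: cross2_def sin_diff algebra_simps)

lemma dirs_periodic: "\<phi> + 2 * pi \<in> dirs S v \<longleftrightarrow> \<phi> \<in> dirs S v"
  by (simp add: dirs_def dir_def)

lemma borel_dirs_triangle:
  assumes "\<not> collinear {A, B, C}"
  shows "dirs (convex hull {A, B, C}) v \<in> sets borel"
proof -
  have m: "{\<phi>. admissible l (cross2 d (dir \<phi>))} \<in> sets borel" for l d
    unfolding admissible_def cross2_def dir_nth by measurable
  have *: "dirs (convex hull {A, B, C}) v \<in> sets borel" if o: "cross2 (B - A) (C - A) > 0" for B C
  proof -
    have "dirs (convex hull {A, B, C}) v = {\<phi>. admissible (cross2 (B - A) (v - A)) (cross2 (B - A) (dir \<phi>))} \<inter>
       {\<phi>. admissible (cross2 (C - B) (v - B)) (cross2 (C - B) (dir \<phi>))} \<inter> {\<phi>. admissible (cross2 (A - C) (v - C)) (cross2 (A - C) (dir \<phi>))}"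
      using dirs_triangle_iff[OF o] by blast
    then show ?thesis using m by auto
  qed
  from assms show ?thesis
  proof (cases rule: triangle_orient)
    case 2
    then show ?thesis using *[of C B] by (simp add: insert_commute)
  qed (rule *)
qed

lemma lmeasurable_Int_window:
  assumes "S \<in> sets borel"
  shows "S \<inter> {a..<b::real} \<in> lmeasurable"
proof -
  have "S \<inter> {a..<b} \<in> sets lebesgue" using assms by auto
  moreover have "bounded (S \<inter> {a..<b})" by (rule bounded_subset[of "{a..b}"]) auto
  ultimately show ?thesis by (simp add: bounded_set_imp_lmeasurable)
qed

text \<open>The part of the shifted window beyond \<open>2 * pi\<close> is a translate of the part
  it omits. Shifting lets a sector begin at the left end of the window, so that it does not wrap
  around.\<close>

lemma measure_periodic_window:
  assumes S: "S \<in> sets borel" and per: "\<And>x. x + 2 * pi \<in> S \<longleftrightarrow> x \<in> S"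
    and a: "0 \<le> a" "a < 2 * pi"
  shows "measure lebesgue (S \<inter> {0..<2*pi}) = measure lebesgue (S \<inter> {a..<a+2*pi})"
proof -
  have m: "measure lebesgue (S \<inter> {p..<r}) = measure lebesgue (S \<inter> {p..<q}) + measure lebesgue (S \<inter> {q..<r})"
    if "p \<le> q" "q \<le> r" for p q r
  proof -
    have "S \<inter> {p..<r} = (S \<inter> {p..<q}) \<union> (S \<inter> {q..<r})" using that by auto
    moreover have "(S \<inter> {p..<q}) \<inter> (S \<inter> {q..<r}) = {}" by auto
    ultimately show ?thesis
      by (simp add: measure_Un3 lmeasurable_Int_window[OF S])
  qed
  have "S \<inter> {2*pi..<a+2*pi} = (+) (2*pi) ` (S \<inter> {0..<a})"
  proof (intro set_eqI iffI)
    fix x assume "x \<in> S \<inter> {2*pi..<a+2*pi}"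
    then have "x - 2*pi \<in> S \<inter> {0..<a}" using per[of "x - 2*pi"] by auto
    then show "x \<in> (+) (2*pi) ` (S \<inter> {0..<a})" by (rule rev_image_eqI) simp
  next
    fix x assume "x \<in> (+) (2*pi) ` (S \<inter> {0..<a})"
    then show "x \<in> S \<inter> {2*pi..<a+2*pi}" using per by (auto simp: add.commute)
  qed
  then have "measure lebesgue (S \<inter> {2*pi..<a+2*pi}) = measure lebesgue (S \<inter> {0..<a})"
    by (simp only: measure_translation)
  then show ?thesis using m[of 0 a "2*pi"] m[of a "2*pi" "a + 2*pi"] a by simp
qed

lemma ang_window:
  assumes "\<not> collinear {A, B, C}" "0 \<le> a" "a < 2 * pi"
  shows "ang (convex hull {A, B, C}) v = measure lebesgue (dirs (convex hull {A, B, C}) v \<inter> {a..<a+2*pi})"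
  unfolding ang_def
  by (rule measure_periodic_window) (use assms borel_dirs_triangle dirs_periodic in auto)

lemma sin_nonneg_window:
  assumes "a \<le> \<phi>" "\<phi> < a + 2 * pi"
  shows "sin (\<phi> - a) \<ge> 0 \<longleftrightarrow> \<phi> \<le> a + pi"
proof
  assume "\<phi> \<le> a + pi" then show "sin (\<phi> - a) \<ge> 0" using assms by (intro sin_ge_zero) auto
next
  assume s: "sin (\<phi> - a) \<ge> 0"
  show "\<phi> \<le> a + pi"
  proof (rule ccontr)
    assume "\<not> ?thesis"
    then have "sin (\<phi> - a) < 0" using assms by (intro sin_lt_zero) auto
    then show False using s by simp
  qed
qed

lemma angle_commute: "angle A B C = angle C B A"
  by (simp add: angle_def inner_commute mult.commute)

text \<open>In the window starting at the direction of \<open>B - A\<close>, the sector is the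
  interval up to the direction of \<open>C - A\<close>; the opposite side is no constraint near
  \<open>A\<close>, which lies strictly on its inner side.\<close>

lemma ang_triangle_vertex:
  assumes "\<not> collinear {A, B, C}"
  shows "ang (convex hull {A, B, C}) A = angle B A C"
proof -
  have *: "ang (convex hull {A, B, C}) A = angle B A C" if o: "cross2 (B - A) (C - A) > 0" for B C
  proof -
    have nz: "B - A \<noteq> 0" "C - A \<noteq> 0" using o by (auto simp: cross2_def)
    obtain a where a: "0 \<le> a" "a < 2 * pi" "B - A = norm (B - A) *\<^sub>R dir a" using polar[OF nz(1)] .
    obtain b where b: "0 \<le> b" "b < 2 * pi" "C - A = norm (C - A) *\<^sub>R dir b" using polar[OF nz(2)] .
    \<comment> \<open>The direction of \<open>C - A\<close>, lifted to the window
      \<open>[a, a + 2 * pi)\<close>.\<close>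
    define c where "c = (if b \<ge> a then b else b + 2 * pi)"
    have c: "a \<le> c" "c < a + 2 * pi" and dc: "dir c = dir b"
      using a b by (auto simp: c_def dir_def)
    have C: "C - A = norm (C - A) *\<^sub>R dir c" using b dc by simp
    have "cross2 (B - A) (C - A) = norm (B - A) * norm (C - A) * sin (c - a)"
      by (subst a, subst C) (rule cross2_dir_dir)
    moreover have "norm (B - A) * norm (C - A) > 0" using nz by simp
    ultimately have s: "sin (c - a) > 0"
      using o zero_less_mult_pos[of "norm (B - A) * norm (C - A)" "sin (c - a)"] by argo
    then have "c \<le> a + pi" using sin_nonneg_window[OF c] by simp
    moreover have "c \<noteq> a + pi" "c \<noteq> a" using s by auto
    ultimately have ca: "a < c" "c < a + pi" using c by auto
    have e0: "cross2 (B - A) (A - A) = 0" "cross2 (C - B) (A - B) = cross2 (B - A) (C - A)" "cross2 (A - C) (A - C) = 0"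
      by (simp_all add: cross2_def algebra_simps)
    have d1: "cross2 (B - A) (dir \<phi>) = norm (B - A) * sin (\<phi> - a)" for \<phi>
      by (subst a) (rule cross2_dir)
    have "cross2 (A - C) (dir \<phi>) = - cross2 (C - A) (dir \<phi>)" for \<phi> by (simp add: cross2_def algebra_simps)
    then have d2: "cross2 (A - C) (dir \<phi>) = norm (C - A) * - sin (\<phi> - c)" for \<phi>
      by (subst (asm) C) (simp add: cross2_dir)
    have "dirs (convex hull {A, B, C}) A \<inter> {a..<a+2*pi} = {a..c}"
    proof (intro set_eqI)
      fix \<phi>
      have "\<phi> \<in> dirs (convex hull {A, B, C}) A \<longleftrightarrow> sin (\<phi> - a) \<ge> 0 \<and> sin (\<phi> - c) \<le> 0"
        unfolding dirs_triangle_iff[OF o] e0 admissible_def d1 d2 using o nz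
        by (auto simp: zero_le_mult_iff mult_le_0_iff)
      moreover have "sin (\<phi> - a) \<ge> 0 \<and> sin (\<phi> - c) \<le> 0 \<longleftrightarrow> \<phi> \<le> c" if w: "a \<le> \<phi>" "\<phi> < a + 2 * pi"
      proof
        assume as: "sin (\<phi> - a) \<ge> 0 \<and> sin (\<phi> - c) \<le> 0"
        then have "\<phi> \<le> a + pi" using sin_nonneg_window w by blast
        then show "\<phi> \<le> c" using as ca sin_gt_zero[of "\<phi> - c"] by (cases "\<phi> \<le> c") auto
      next
        assume "\<phi> \<le> c"
        then show "sin (\<phi> - a) \<ge> 0 \<and> sin (\<phi> - c) \<le> 0"
          using w ca sin_ge_zero[of "\<phi> - a"] sin_ge_zero[of "c - \<phi>"] sin_minus[of "c - \<phi>"] by simp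
      qed
      ultimately show "\<phi> \<in> dirs (convex hull {A, B, C}) A \<inter> {a..<a+2*pi} \<longleftrightarrow> \<phi> \<in> {a..c}"
        using ca by auto
    qed
    moreover have "\<not> collinear {A, B, C}" using o by (simp add: collinear_iff_cross2)
    ultimately have "ang (convex hull {A, B, C}) A = c - a"
      using a ca by (simp add: ang_window[where a = a])
    moreover have "angle B A C = c - a"
    proof -
      have "(B - A) \<bullet> (C - A) = norm (B - A) * norm (C - A) * cos (c - a)"
        by (subst a, subst C) (simp add: inner_point cos_diff algebra_simps)
      then have "angle B A C = arccos (cos (c - a))" using nz by (simp add: angle_def)
      then show ?thesis using ca by (simp add: arccos_cos)
    qed
    ultimately show ?thesis by simp
  qed
  from assms show ?thesis
  proof (cases rule: triangle_orient)
    case 2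
    then show ?thesis using *[of C B] by (simp add: insert_commute angle_commute)
  qed (rule *)
qed

text \<open>Two side vectors are independent, so a point of \<open>AB\<close> other than
  \<open>A\<close> and \<open>B\<close> is strictly inside the other two half-planes. One half-plane
  remains, that is, half of all directions.\<close>

lemma ang_triangle_edge:
  assumes "\<not> collinear {A, B, C}" "v \<in> convex hull {A, B, C}" "cross2 (B - A) (v - A) = 0" "v \<noteq> A" "v \<noteq> B"
  shows "ang (convex hull {A, B, C}) v = pi"
proof -
  have *: "ang (convex hull {A, B, C}) v = pi"
    if o: "cross2 (B - A) (C - A) > 0" and v: "v \<in> convex hull {A, B, C}" "cross2 (B - A) (v - A) = 0" "v \<noteq> A" "v \<noteq> B"
    for A B
  proof -
    have nz: "B - A \<noteq> 0" using o by (auto simp: cross2_def)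
    obtain a where a: "0 \<le> a" "a < 2 * pi" "B - A = norm (B - A) *\<^sub>R dir a" using polar[OF nz] .
    have d1: "cross2 (B - A) (dir \<phi>) = norm (B - A) * sin (\<phi> - a)" for \<phi>
      by (subst a) (rule cross2_dir)
    have z: "x = 0" if "cross2 (B - A) x = 0" "cross2 (C - B) x = 0" for x
    proof -
      have "cross2 (B - A) (C - A) *\<^sub>R x = cross2 (B - A) x *\<^sub>R (C - B) - cross2 (C - B) x *\<^sub>R (B - A)"
        by (simp add: point_eq_iff cross2_def algebra_simps)
      then show ?thesis using that o by simp
    qed
    have z': "x = 0" if "cross2 (B - A) x = 0" "cross2 (A - C) x = 0" for x
    proof -
      have "cross2 (B - A) (C - A) *\<^sub>R x = cross2 (A - C) x *\<^sub>R (B - A) - cross2 (B - A) x *\<^sub>R (A - C)"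
        by (simp add: point_eq_iff cross2_def algebra_simps)
      then show ?thesis using that o by simp
    qed
    have "cross2 (C - B) (v - B) \<noteq> 0"
    proof
      assume "cross2 (C - B) (v - B) = 0"
      moreover have "cross2 (B - A) (v - B) = cross2 (B - A) (v - A)" by (simp add: cross2_def algebra_simps)
      ultimately show False using z[of "v - B"] v by simp
    qed
    moreover have "cross2 (A - C) (v - C) \<noteq> 0"
    proof
      assume "cross2 (A - C) (v - C) = 0"
      moreover have "cross2 (A - C) (v - A) = cross2 (A - C) (v - C)" by (simp add: cross2_def algebra_simps)
      ultimately show False using z'[of "v - A"] v by simp
    qed
    ultimately have p: "cross2 (C - B) (v - B) > 0" "cross2 (A - C) (v - C) > 0"
      using v(1) in_triangle_iff[OF o] by (auto simp: less_le)
    have "dirs (convex hull {A, B, C}) v \<inter> {a..<a+2*pi} = {a..a+pi}"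
    proof (intro set_eqI)
      fix \<phi>
      have "\<phi> \<in> dirs (convex hull {A, B, C}) v \<longleftrightarrow> sin (\<phi> - a) \<ge> 0"
        unfolding dirs_triangle_iff[OF o] admissible_def d1 using p v nz by (auto simp: zero_le_mult_iff)
      then show "\<phi> \<in> dirs (convex hull {A, B, C}) v \<inter> {a..<a+2*pi} \<longleftrightarrow> \<phi> \<in> {a..a+pi}"
        using sin_nonneg_window[of a \<phi>] pi_gt_zero by (smt (verit) IntD1 IntD2 IntI atLeastAtMost_iff atLeastLessThan_iff)
    qed
    moreover have "\<not> collinear {A, B, C}" using o by (simp add: collinear_iff_cross2)
    ultimately show ?thesis
      using a by (simp add: ang_window[where a = a])
  qed
  from assms(1) show ?thesis
  proof (cases rule: triangle_orient)
    case 1 then show ?thesis by (rule *) (use assms in auto)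
  next
    case 2
    have e: "cross2 (A - B) (C - B) = cross2 (C - A) (B - A)" "cross2 (A - B) (v - B) = - cross2 (B - A) (v - A)"
      by (simp_all add: cross2_def algebra_simps)
    have "convex hull {B, A, C} = convex hull {A, B, C}" by (simp add: insert_commute)
    then show ?thesis using *[of A B, unfolded e] assms 2 by auto
  qed
qed

lemma ang_triangle_other:
  assumes "\<not> collinear {A, B, C}" "v \<in> convex hull {A, B, C}" "v \<notin> {A, B, C}"
  shows "ang (convex hull {A, B, C}) v \<in> {pi, 2 * pi}"
proof -
  have *: "ang (convex hull {A, B, C}) v \<in> {pi, 2 * pi}"
    if o: "cross2 (B - A) (C - A) > 0" and v: "v \<in> convex hull {A, B, C}" "v \<notin> {A, B, C}"
    for B C
  proof -
    have nc: "\<not> collinear {A, B, C}" "\<not> collinear {B, C, A}" "\<not> collinear {C, A, B}"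
      using o by (auto simp: collinear_iff_cross2 cross2_def algebra_simps)
    have h: "convex hull {B, C, A} = convex hull {A, B, C}" "convex hull {C, A, B} = convex hull {A, B, C}"
      by (simp_all add: insert_commute)
    consider "cross2 (B - A) (v - A) = 0" | "cross2 (C - B) (v - B) = 0" | "cross2 (A - C) (v - C) = 0"
      | "cross2 (B - A) (v - A) > 0" "cross2 (C - B) (v - B) > 0" "cross2 (A - C) (v - C) > 0"
      using v(1)[unfolded in_triangle_iff[OF o]] by (auto simp: less_le)
    then show ?thesis
    proof cases
      case 1 then show ?thesis using ang_triangle_edge[OF nc(1)] v by auto
    next
      case 2 then show ?thesis using ang_triangle_edge[OF nc(2)] v by (auto simp: h)
    next
      case 3 then show ?thesis using ang_triangle_edge[OF nc(3)] v by (auto simp: h)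
    next
      case 4
      then have "dirs (convex hull {A, B, C}) v = UNIV"
        by (auto simp: dirs_triangle_iff[OF o] admissible_def)
      then show ?thesis by (simp add: ang_def)
    qed
  qed
  from assms(1) show ?thesis
  proof (cases rule: triangle_orient)
    case 1 then show ?thesis by (rule *) (use assms in auto)
  next
    case 2
    have "convex hull {A, C, B} = convex hull {A, B, C}" "{A, C, B} = {A, B, C}" by (simp_all add: insert_commute)
    then show ?thesis using *[OF 2] assms by auto
  qed
qed

lemma ang_triangle_outside:
  assumes "\<not> collinear {A, B, C}" "v \<notin> convex hull {A, B, C}"
  shows "ang (convex hull {A, B, C}) v = 0"
proof -
  have *: "ang (convex hull {A, B, C}) v = 0"
    if o: "cross2 (B - A) (C - A) > 0" and v: "v \<notin> convex hull {A, B, C}" for B C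
  proof -
    have "dirs (convex hull {A, B, C}) v = {}"
      using v by (auto simp: dirs_triangle_iff[OF o] in_triangle_iff[OF o] admissible_def)
    then show ?thesis by (simp add: ang_def)
  qed
  from assms(1) show ?thesis
  proof (cases rule: triangle_orient)
    case 1 then show ?thesis by (rule *) (use assms in auto)
  next
    case 2
    have "convex hull {A, C, B} = convex hull {A, B, C}" "{A, C, B} = {A, B, C}" by (simp_all add: insert_commute)
    then show ?thesis using *[OF 2] assms by auto
  qed
qed

section \<open>Angle sums in tilings and similar triangles\<close>

text \<open>Convex sets with disjoint interiors meet inside a line, and a ray that stays in a line
  has one of two directions modulo \<open>2 * pi\<close>.\<close>

lemma dirs_Int_negligible:
  assumes "convex s" "convex t" "interior s \<inter> interior t = {}"
  shows "negligible (dirs s v \<inter> dirs t v)"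
proof -
  have "interior (s \<inter> t) = {}" using assms by simp
  then obtain a b where a: "a \<noteq> 0" "s \<inter> t \<subseteq> {x. a \<bullet> x = b}"
    using empty_interior_subset_hyperplane[of "s \<inter> t"] assms convex_Int by blast
  obtain \<psi> where \<psi>: "a = norm a *\<^sub>R dir \<psi>" using polar[OF a(1)] by metis
  have "dirs s v \<inter> dirs t v \<subseteq> range (\<lambda>i::int. \<psi> + (of_int i * pi + pi / 2))"
  proof
    fix \<phi> assume "\<phi> \<in> dirs s v \<inter> dirs t v"
    then have "\<forall>\<^sub>F r in at_right 0. v + r *\<^sub>R dir \<phi> \<in> s \<inter> t"
      by (auto simp: dirs_def eventually_conj_iff)
    then have "\<forall>\<^sub>F r in at_right 0. a \<bullet> v + r * (a \<bullet> dir \<phi>) = b"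
      by eventually_elim (use a in \<open>auto simp: inner_add_right\<close>)
    then obtain e where e: "e > 0" "\<And>r. 0 < r \<Longrightarrow> r < e \<Longrightarrow> a \<bullet> v + r * (a \<bullet> dir \<phi>) = b"
      by (auto simp: eventually_at_right_field)
    \<comment> \<open>Equal values at two radii in \<open>(0, e)\<close> force the slope
      \<open>a \<bullet> dir \<phi>\<close> to vanish.\<close>
    have "a \<bullet> v + (e/2) * (a \<bullet> dir \<phi>) = b" "a \<bullet> v + (e/3) * (a \<bullet> dir \<phi>) = b"
      using e(1) e(2)[of "e/2"] e(2)[of "e/3"] by auto
    then have "e * (a \<bullet> dir \<phi>) = 0" unfolding times_divide_eq_left by linarith
    then have "a \<bullet> dir \<phi> = 0" using e(1) by simp
    moreover have "a \<bullet> dir \<phi> = norm a * cos (\<phi> - \<psi>)"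
      by (subst \<psi>) (simp add: inner_point cos_diff algebra_simps)
    ultimately have "cos (\<phi> - \<psi>) = 0" using a by simp
    then obtain i :: int where "\<phi> - \<psi> = of_int i * pi + pi / 2"
      unfolding cos_zero_iff_int2 by blast
    then show "\<phi> \<in> range (\<lambda>i::int. \<psi> + (of_int i * pi + pi / 2))"
      by (intro range_eqI[of _ _ i]) simp
  qed
  moreover have "countable (range (\<lambda>i::int. \<psi> + (of_int i * pi + pi / 2)))" by simp
  then have "negligible (range (\<lambda>i::int. \<psi> + (of_int i * pi + pi / 2)))"
    by (simp add: negligible_iff_null_sets null_sets_completionI countable_imp_null_set_lborel)
  ultimately show ?thesis by (meson negligible_subset)
qed

lemma is_triangle_convex: "is_triangle t \<Longrightarrow> convex t"
  by (auto simp: is_triangle_def)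

text \<open>By the dichotomy, a ray that is eventually in no single tile eventually avoids each
  tile, and by finiteness all of them at once.\<close>

lemma dirs_Union:
  assumes fin: "finite P" and tri: "\<And>t. t \<in> P \<Longrightarrow> is_triangle t"
  shows "dirs (\<Union>P) v = (\<Union>t\<in>P. dirs t v)"
proof
  show "dirs (\<Union>P) v \<subseteq> (\<Union>t\<in>P. dirs t v)"
  proof
    fix \<phi> assume \<phi>: "\<phi> \<in> dirs (\<Union>P) v"
    show "\<phi> \<in> (\<Union>t\<in>P. dirs t v)"
    proof (rule ccontr)
      assume n: "\<phi> \<notin> (\<Union>t\<in>P. dirs t v)"
      have "\<forall>t\<in>P. \<forall>\<^sub>F r in at_right 0. v + r *\<^sub>R dir \<phi> \<notin> t"
      proof
        fix t assume t: "t \<in> P"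
        obtain A B C where "\<not> collinear {A, B, C}" "t = convex hull {A, B, C}"
          using tri[OF t] by (auto simp: is_triangle_def)
        then show "\<forall>\<^sub>F r in at_right 0. v + r *\<^sub>R dir \<phi> \<notin> t"
          using dirs_triangle_dichotomy n t by auto
      qed
      then have "\<forall>\<^sub>F r in at_right 0. \<forall>t\<in>P. v + r *\<^sub>R dir \<phi> \<notin> t"
        using fin by (simp add: eventually_ball_finite)
      moreover have "\<forall>\<^sub>F r in at_right 0. v + r *\<^sub>R dir \<phi> \<in> \<Union>P" using \<phi> by (simp add: dirs_def)
      ultimately have "\<forall>\<^sub>F r in at_right (0::real). False" by eventually_elim auto
      then show False by simp
    qed
  qed
  show "(\<Union>t\<in>P. dirs t v) \<subseteq> dirs (\<Union>P) v"
    by (auto simp: dirs_def elim!: eventually_mono)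
qed

lemma ang_sum:
  assumes fin: "finite P" and tri: "\<And>t. t \<in> P \<Longrightarrow> is_triangle t"
    and dis: "\<And>s t. s \<in> P \<Longrightarrow> t \<in> P \<Longrightarrow> s \<noteq> t \<Longrightarrow> interior s \<inter> interior t = {}"
  shows "ang (\<Union>P) v = (\<Sum>t\<in>P. ang t v)"
proof -
  have "ang (\<Union>P) v = measure lebesgue (\<Union>t\<in>P. dirs t v \<inter> {0..<2*pi})"
    by (simp add: ang_def dirs_Union[OF fin tri])
  also have "\<dots> = (\<Sum>t\<in>P. measure lebesgue (dirs t v \<inter> {0..<2*pi}))"
  proof (rule measure_negligible_finite_Union_image[OF fin])
    fix t assume "t \<in> P"
    then obtain A B C where "\<not> collinear {A, B, C}" "t = convex hull {A, B, C}"
      using tri unfolding is_triangle_def by blast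
    then show "dirs t v \<inter> {0..<2*pi} \<in> lmeasurable"
      using borel_dirs_triangle lmeasurable_Int_window by blast
  next
    show "pairwise (\<lambda>s t. negligible ((dirs s v \<inter> {0..<2*pi}) \<inter> (dirs t v \<inter> {0..<2*pi}))) P"
    proof (rule pairwiseI)
      fix s t assume "s \<in> P" "t \<in> P" "s \<noteq> t"
      then have "negligible (dirs s v \<inter> dirs t v)"
        by (intro dirs_Int_negligible is_triangle_convex tri dis)
      then show "negligible ((dirs s v \<inter> {0..<2*pi}) \<inter> (dirs t v \<inter> {0..<2*pi}))"
        by (rule negligible_subset) auto
    qed
  qed
  finally show ?thesis by (simp add: ang_def)
qed

lemma measure_triangle:
  "measure lebesgue (convex hull {A, B, C :: point}) = \<bar>cross2 (B - A) (C - A)\<bar> / 2"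
proof -
  have "measure lebesgue (convex hull {A, B, C}) = measure lborel (convex hull {A, B, C})"
    by (simp add: borel_compact finite_imp_compact_convex_hull measure_completion)
  then show ?thesis by (simp add: content_triangle cross2_def algebra_simps)
qed

lemma measure_Union_tiles:
  assumes "finite P" "\<And>t. t \<in> P \<Longrightarrow> is_triangle t"
    and "\<And>s t. s \<in> P \<Longrightarrow> t \<in> P \<Longrightarrow> s \<noteq> t \<Longrightarrow> interior s \<inter> interior t = {}"
  shows "measure lebesgue (\<Union>P) = (\<Sum>t\<in>P. measure lebesgue t)"
proof (rule measure_negligible_finite_Union[OF assms(1)])
  fix t assume "t \<in> P"
  then obtain A B C where "t = convex hull {A, B, C}" using assms(2) unfolding is_triangle_def by blast
  then show "t \<in> lmeasurable"
    by (simp add: lmeasurable_compact finite_imp_compact_convex_hull)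
next
  show "pairwise (\<lambda>s t. negligible (s \<inter> t)) P"
    using assms(2,3) is_triangle_convex
    by (intro pairwiseI) (simp add: negligible_convex_interior convex_Int)
qed

section \<open>Similarities, and triangles determined by their side lengths\<close>

definition similarity :: "real \<Rightarrow> (point \<Rightarrow> point) \<Rightarrow> bool" where
  "similarity c f \<longleftrightarrow> c > 0 \<and> (\<forall>x y. dist (f x) (f y) = c * dist x y)"

lemma similarity_decompose:
  assumes "similarity c f"
  obtains g where "orthogonal_transformation g" "f = (\<lambda>x. f 0 + c *\<^sub>R g x)"
proof -
  have c: "c > 0" and d: "dist (f x) (f y) = c * dist x y" for x y
    using assms by (auto simp: similarity_def)
  define g where "g = (\<lambda>x. (1 / c) *\<^sub>R (f x - f 0))"
  have "dist (g x) (g y) = dist x y" for x y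
  proof -
    have "g x - g y = (1 / c) *\<^sub>R (f x - f y)" by (simp add: g_def algebra_simps)
    then show ?thesis using d[of x y] c by (simp add: dist_norm)
  qed
  then have "orthogonal_transformation g"
    by (simp add: orthogonal_transformation_isometry g_def)
  moreover have "f = (\<lambda>x. f 0 + c *\<^sub>R g x)" using c by (auto simp: g_def)
  ultimately show ?thesis using that by blast
qed

lemma similarity_inj_surj:
  assumes "similarity c f" shows "inj f" "surj f"
proof -
  show "inj f"
  proof (rule injI)
    fix x y assume "f x = f y"
    then have "c * dist x y = 0" using assms by (metis dist_self similarity_def)
    then show "x = y" using assms by (simp add: similarity_def)
  qed
  obtain g where g: "orthogonal_transformation g" "f = (\<lambda>x. f 0 + c *\<^sub>R g x)"
    using similarity_decompose[OF assms] .
  show "surj f"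
  proof (rule surjI)
    fix y
    have "g (inv g ((1 / c) *\<^sub>R (y - f 0))) = (1 / c) *\<^sub>R (y - f 0)"
      using g(1) by (simp add: orthogonal_transformation_surj surj_f_inv_f)
    then show "f (inv g ((1 / c) *\<^sub>R (y - f 0))) = y"
      using assms by (subst g(2)) (simp add: similarity_def)
  qed
qed

lemma similarity_hull:
  assumes "similarity c f"
  shows "f ` (convex hull S) = convex hull (f ` S)"
proof -
  obtain g where g: "orthogonal_transformation g" "f = (\<lambda>x. f 0 + c *\<^sub>R g x)"
    using similarity_decompose[OF assms] .
  have "linear (\<lambda>x. c *\<^sub>R g x)"
    using g(1) by (intro linear_compose_scale_right orthogonal_transformation_linear)
  then have "(\<lambda>x. c *\<^sub>R g x) ` (convex hull S) = convex hull ((\<lambda>x. c *\<^sub>R g x) ` S)"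
    by (rule convex_hull_linear_image)
  then have "(+) (f 0) ` ((\<lambda>x. c *\<^sub>R g x) ` (convex hull S)) = convex hull ((+) (f 0) ` ((\<lambda>x. c *\<^sub>R g x) ` S))"
    by (simp only: convex_hull_translation)
  moreover have "f ` X = (+) (f 0) ` ((\<lambda>x. c *\<^sub>R g x) ` X)" for X
    by (subst g(2)) (simp add: image_image)
  ultimately show ?thesis by metis
qed

lemma similarity_dist: "similarity c f \<Longrightarrow> dist (f x) (f y) = c * dist x y"
  by (simp add: similarity_def)

text \<open>Twice the dot product and the squared cross product of two sides are polynomials in the
  side lengths, so a triangle is controlled by its side lengths alone.\<close>

lemma inner_dist: "2 * ((B - A) \<bullet> (C - A)) = (dist A B)\<^sup>2 + (dist A C)\<^sup>2 - (dist B (C::point))\<^sup>2"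
  by (simp add: dist_norm power2_norm_eq_inner inner_point algebra_simps)

lemma dist2: "(dist A (B::point))\<^sup>2 = (A$1 - B$1)\<^sup>2 + (A$2 - B$2)\<^sup>2"
  by (simp only: dist_norm power2_norm_eq_inner inner_point) (simp add: power2_eq_square)

lemma cross2_dist: "4 * (cross2 (B - A) (C - A))\<^sup>2 =
    4 * (dist A B)\<^sup>2 * (dist A C)\<^sup>2 - ((dist A B)\<^sup>2 + (dist A C)\<^sup>2 - (dist B C)\<^sup>2)\<^sup>2"
  unfolding dist2 cross2_def vector_minus_component by (simp add: algebra_simps power2_eq_square)

lemma angle_dist: "angle B A C =
    arccos (((dist A B)\<^sup>2 + (dist A C)\<^sup>2 - (dist B C)\<^sup>2) / (2 * dist A B * dist A C))"
  unfolding inner_dist[symmetric] angle_def by (simp add: dist_norm norm_minus_commute)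

text \<open>The squared cross product and the angles are expressions in the side lengths,
  homogeneous of degree 4 and 0, so proportional sides suffice.\<close>

lemma scaled_triangle:
  assumes "c > 0" "dist A' B' = c * dist A B" "dist A' C' = c * dist A C" "dist B' C' = c * dist B C"
  shows "\<bar>cross2 (B' - A') (C' - A')\<bar> = c\<^sup>2 * \<bar>cross2 (B - A) (C - A)\<bar>"
    and "collinear {A', B', C'} \<longleftrightarrow> collinear {A, B, C}"
    and "angle B' A' C' = angle B A C" "angle A' B' C' = angle A B C" "angle A' C' B' = angle A C B"
proof -
  have "4 * (cross2 (B' - A') (C' - A'))\<^sup>2 = (c\<^sup>2)\<^sup>2 * (4 * (cross2 (B - A) (C - A))\<^sup>2)"
    unfolding cross2_dist assms by (simp add: power2_eq_square algebra_simps)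
  then have "(cross2 (B' - A') (C' - A'))\<^sup>2 = (c\<^sup>2 * cross2 (B - A) (C - A))\<^sup>2"
    by (simp add: power_mult_distrib)
  then have "\<bar>cross2 (B' - A') (C' - A')\<bar> = \<bar>c\<^sup>2 * cross2 (B - A) (C - A)\<bar>"
    by (simp only: power2_eq_iff) (auto simp: abs_mult)
  then show 1: "\<bar>cross2 (B' - A') (C' - A')\<bar> = c\<^sup>2 * \<bar>cross2 (B - A) (C - A)\<bar>"
    by (simp add: abs_mult)
  show "collinear {A', B', C'} \<longleftrightarrow> collinear {A, B, C}"
    unfolding collinear_iff_cross2 using 1 assms(1) by auto
  have *: "((c*x)\<^sup>2 + (c*y)\<^sup>2 - (c*z)\<^sup>2) / (2 * (c*x) * (c*y)) = (x\<^sup>2 + y\<^sup>2 - z\<^sup>2) / (2 * x * y)" for x y z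
  proof -
    have "((c*x)\<^sup>2 + (c*y)\<^sup>2 - (c*z)\<^sup>2) / (2 * (c*x) * (c*y)) = (c\<^sup>2 * (x\<^sup>2 + y\<^sup>2 - z\<^sup>2)) / (c\<^sup>2 * (2 * x * y))"
      by (simp add: power2_eq_square algebra_simps)
    then show ?thesis using assms(1) by simp
  qed
  show "angle B' A' C' = angle B A C" unfolding angle_dist assms * ..
  have d: "dist B' A' = c * dist B A" "dist C' A' = c * dist C A" "dist C' B' = c * dist C B"
    using assms(2-4) by (simp_all only: dist_commute)
  show "angle A' B' C' = angle A B C" unfolding angle_dist assms d * ..
  show "angle A' C' B' = angle A C B" unfolding angle_dist assms d * ..
qed

text \<open>Turns the map in \<open>similar\<close> into a labelling: the preimages of the corners
  are the matching corners of the tile.\<close>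

lemma similarity_preimage_triangle:
  assumes f: "similarity c f" and t: "f ` t = convex hull {A, B, C}"
  obtains A' B' C' where "t = convex hull {A', B', C'}"
    "dist A B = c * dist A' B'" "dist A C = c * dist A' C'" "dist B C = c * dist B' C'"
proof -
  obtain A' B' C' where v: "f A' = A" "f B' = B" "f C' = C"
    using similarity_inj_surj(2)[OF f] by (metis surjD)
  have "f ` (convex hull {A', B', C'}) = f ` t"
    unfolding t similarity_hull[OF f] by (simp add: v)
  then have "t = convex hull {A', B', C'}"
    using similarity_inj_surj(1)[OF f] by (simp add: inj_image_eq_iff)
  then show ?thesis using that similarity_dist[OF f] v by metis
qed

text \<open>With \<open>D\<close> twice the area, each sine is \<open>D\<close> over the product of
  the adjacent sides, which contains the sine rule. The angle sum comes from comparing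
  \<open>cos (\<alpha> + \<beta>)\<close> with \<open>cos (pi - \<gamma>)\<close>.\<close>

lemma triangle_trig:
  assumes "\<not> collinear {A, B, C}"
  defines "\<alpha> \<equiv> angle B A C" and "\<beta> \<equiv> angle A B C" and "\<gamma> \<equiv> angle A C B"
  shows "\<alpha> + \<beta> + \<gamma> = pi" "\<alpha> > 0" "\<beta> > 0" "\<gamma> > 0"
    "dist A C * sin \<alpha> = dist B C * sin \<beta>" "dist A B * sin \<alpha> = dist B C * sin \<gamma>"
proof -
  define a b c m D where "a = dist B C" and "b = dist A C" and "c = dist A B"
    and "m = (B - A) \<bullet> (C - A)" and "D = \<bar>cross2 (B - A) (C - A)\<bar>"
  have D: "D > 0" using assms(1) by (simp add: D_def collinear_iff_cross2)
  have "A \<noteq> B" "A \<noteq> C" "B \<noteq> C" using assms(1) by (auto simp: insert_commute)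
  then have abc: "a > 0" "b > 0" "c > 0" by (auto simp: a_def b_def c_def)
  have m: "2 * m = c\<^sup>2 + b\<^sup>2 - a\<^sup>2" unfolding m_def inner_dist a_def b_def c_def ..
  have D2: "D\<^sup>2 = b\<^sup>2 * c\<^sup>2 - m\<^sup>2"
    using cross2_dist[of B A C] unfolding a_def[symmetric] b_def[symmetric] c_def[symmetric] m[symmetric]
    by (simp add: D_def power_mult_distrib algebra_simps)
  have A: "\<alpha> = arccos (m / (b * c))"
    unfolding \<alpha>_def angle_dist a_def[symmetric] b_def[symmetric] c_def[symmetric] m[symmetric] by (simp add: mult.commute)
  have B: "\<beta> = arccos ((c\<^sup>2 - m) / (a * c))"
  proof -
    have e: "dist B A ^ 2 + dist B C ^ 2 - dist A C ^ 2 = 2 * (c\<^sup>2 - m)"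
      using m by (simp add: a_def b_def c_def dist_commute)
    show ?thesis unfolding \<beta>_def angle_dist e
      by (simp only: a_def c_def dist_commute[of B A] mult.assoc mult.commute[of "dist B C"])
        (simp del: right_diff_distrib_numeral)
  qed
  have C: "\<gamma> = arccos ((b\<^sup>2 - m) / (a * b))"
  proof -
    have e: "dist C A ^ 2 + dist C B ^ 2 - dist A B ^ 2 = 2 * (b\<^sup>2 - m)"
      using m by (simp add: a_def b_def c_def dist_commute)
    show ?thesis unfolding \<gamma>_def angle_dist e
      by (simp only: a_def b_def dist_commute[of C] mult.assoc mult.commute[of "dist B C"])
        (simp del: right_diff_distrib_numeral)
  qed
  have trig: "cos (arccos (p / q)) = p / q \<and> sin (arccos (p / q)) = D / q \<and> 0 \<le> arccos (p / q) \<and> arccos (p / q) \<le> pi"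
    if q: "q > 0" and pq: "q\<^sup>2 = p\<^sup>2 + D\<^sup>2" for p q
  proof -
    have sq: "(p / q)\<^sup>2 + (D / q)\<^sup>2 = 1"
    proof -
      have "(p / q)\<^sup>2 + (D / q)\<^sup>2 = (p\<^sup>2 + D\<^sup>2) / q\<^sup>2"
        by (simp add: power_divide add_divide_distrib)
      then show ?thesis using q by (simp flip: pq)
    qed
    then have "(p / q)\<^sup>2 \<le> 1" by (metis le_add_same_cancel1 zero_le_power2)
    then have l: "\<bar>p / q\<bar> \<le> 1" by (simp add: abs_square_le_1)
    then have l': "-1 \<le> p / q" "p / q \<le> 1" by linarith+
    then have "sin (arccos (p / q)) = sqrt (1 - (p / q)\<^sup>2)" by (intro sin_arccos)
    also have "1 - (p / q)\<^sup>2 = (D / q)\<^sup>2" using sq by simp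
    finally show ?thesis using l' D q by (simp add: arccos_lbound arccos_ubound)
  qed
  have a2: "a\<^sup>2 = c\<^sup>2 + b\<^sup>2 - 2 * m" using m by simp
  have sq: "(b * c)\<^sup>2 = m\<^sup>2 + D\<^sup>2" "(a * c)\<^sup>2 = (c\<^sup>2 - m)\<^sup>2 + D\<^sup>2" "(a * b)\<^sup>2 = (b\<^sup>2 - m)\<^sup>2 + D\<^sup>2"
    unfolding power_mult_distrib a2 D2 by (simp_all add: power2_diff algebra_simps)
  note tA = trig[of "b * c" m, OF _ sq(1)] and tB = trig[of "a * c" "c\<^sup>2 - m", OF _ sq(2)]
    and tC = trig[of "a * b" "b\<^sup>2 - m", OF _ sq(3)]
  have cA: "cos \<alpha> = m / (b * c)" and sA: "sin \<alpha> = D / (b * c)"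
    and cB: "cos \<beta> = (c\<^sup>2 - m) / (a * c)" and sB: "sin \<beta> = D / (a * c)"
    and cC: "cos \<gamma> = (b\<^sup>2 - m) / (a * b)" and sC: "sin \<gamma> = D / (a * b)"
    and rng: "0 \<le> \<alpha>" "\<alpha> \<le> pi" "0 \<le> \<beta>" "\<beta> \<le> pi" "0 \<le> \<gamma>" "\<gamma> \<le> pi"
    unfolding A B C using tA tB tC abc by simp_all
  have s: "sin \<alpha> > 0" "sin \<beta> > 0" "sin \<gamma> > 0" using D abc by (auto simp: sA sB sC)
  then show p: "\<alpha> > 0" "\<beta> > 0" "\<gamma> > 0" using rng by (auto simp: less_le)
  show "dist A C * sin \<alpha> = dist B C * sin \<beta>" "dist A B * sin \<alpha> = dist B C * sin \<gamma>"
    using abc by (simp_all add: sA sB sC flip: a_def b_def c_def)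
  have "cos (\<alpha> + \<beta>) = (m * (c\<^sup>2 - m) - D\<^sup>2) / (a * b * c\<^sup>2)"
    using abc by (simp add: cos_add cA cB sA sB field_simps power2_eq_square)
  also have "m * (c\<^sup>2 - m) - D\<^sup>2 = (m - b\<^sup>2) * c\<^sup>2" unfolding D2 by (simp add: algebra_simps power2_eq_square)
  also have "(m - b\<^sup>2) * c\<^sup>2 / (a * b * c\<^sup>2) = - cos \<gamma>"
    using abc by (simp add: cC minus_divide_left)
  finally have c: "cos (\<alpha> + \<beta>) = cos (pi - \<gamma>)" by simp
  have "sin (\<alpha> + \<beta>) = (D * (c\<^sup>2 - m) + m * D) / (a * b * c\<^sup>2)"
    using abc by (simp add: sin_add cA cB sA sB field_simps power2_eq_square)
  also have "D * (c\<^sup>2 - m) + m * D = D * c\<^sup>2" by (simp add: algebra_simps)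
  \<comment> \<open>This excludes \<open>\<alpha> + \<beta> \<ge> pi\<close>, so both arguments lie
    where the cosine is injective.\<close>
  finally have "sin (\<alpha> + \<beta>) > 0" using abc D by simp
  moreover have "sin (\<alpha> + \<beta>) \<le> 0" if "\<alpha> + \<beta> \<ge> pi"
    using sin_ge_zero[of "\<alpha> + \<beta> - pi"] that rng sin_minus_pi[of "\<alpha> + \<beta>"] by simp
  ultimately have "\<alpha> + \<beta> < pi" by linarith
  then have "0 \<le> \<alpha> + \<beta>" "\<alpha> + \<beta> \<le> pi" "0 \<le> pi - \<gamma>" "pi - \<gamma> \<le> pi" using rng by linarith+
  then have "\<alpha> + \<beta> = pi - \<gamma>" by (rule cos_inj_pi[OF _ _ _ _ c])
  then show "\<alpha> + \<beta> + \<gamma> = pi" by simp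
qed

section \<open>Arithmetic of the vertex equations\<close>

text \<open>The relation \<open>p\<alpha> + q\<beta> + r\<gamma> = n\<pi>\<close> reads \<open>M\<alpha> = (n - q)\<pi>\<close> with
  \<open>M = p + k r - q (k + 1)\<close>, and \<open>2k < \<pi>/\<alpha> < 2k + 2\<close> leaves few values of \<open>M\<close>.\<close>

locale angle_data =
  fixes \<alpha> \<beta> \<gamma> :: real and k :: nat
  assumes k3: "k \<ge> 3" and \<gamma>: "\<gamma> = k * \<alpha>" and sum: "\<alpha> + \<beta> + \<gamma> = pi"
    and acute: "\<beta> < pi / 2" "\<gamma> < pi / 2"
begin

lemma \<beta>: "\<beta> = pi - (k + 1) * \<alpha>"
  using sum \<gamma> by (simp add: algebra_simps)

lemma bounds: "\<alpha> > 0" "2 * k * \<alpha> < pi" "pi < (2 * k + 2) * \<alpha>"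
proof -
  show "2 * k * \<alpha> < pi" "pi < (2 * k + 2) * \<alpha>" using acute \<gamma> \<beta> by (simp_all add: algebra_simps)
  then have "0 < 2 * \<alpha>" by (simp add: algebra_simps)
  then show "\<alpha> > 0" by simp
qed

text \<open>Cases on \<open>d = n - q\<close>. For \<open>d = 0\<close> only the relations implied
  by the angle sum and \<open>\<gamma> = k\<alpha>\<close> arise. \<open>d = 1\<close> or
  \<open>-1\<close> means \<open>\<beta> = \<gamma>\<close>. \<open>d = 2\<close> or
  \<open>-2\<close> makes \<open>2\<pi>\<close> a multiple of \<open>\<alpha>\<close> by
  \<open>4k + 1\<close>, \<open>4k + 2\<close> or \<open>4k + 3\<close>, the middle one being
  \<open>\<beta> = \<gamma>\<close> again. \<open>d = -3\<close> occurs only with five angles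
  \<open>\<beta>\<close> and no \<open>\<gamma>\<close>; \<open>d \<le> -4\<close> never.\<close>

lemma classify:
  fixes p q r n :: nat
  assumes n: "n = 1 \<or> n = 2" and eq: "p * \<alpha> + q * \<beta> + r * \<gamma> = n * pi"
  defines "m \<equiv> p + k * r"
  shows "(q = n \<and> m = n * (k + 1)) \<or> (2 * k + 1) * \<alpha> = pi \<or>
    n = 2 \<and> (4 * k + 1) * \<alpha> = 2 * pi \<and> (q = 0 \<and> m = 4 * k + 1 \<or> q = 4 \<and> m = 3) \<or>
    n = 2 \<and> (4 * k + 3) * \<alpha> = 2 * pi \<and> (q = 0 \<and> m = 4 * k + 3 \<or> q = 4 \<and> m = 1) \<or>
    n = 2 \<and> q = 5 \<and> r = 0 \<and> (4 * k + 1) * \<alpha> \<noteq> 2 * pi \<and> (4 * k + 3) * \<alpha> \<noteq> 2 * pi"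
proof -
  define M where "M = int m - int q * int (k + 1)"
  define d where "d = int n - int q"
  have M: "M * \<alpha> = d * pi"
    using eq unfolding \<beta> \<gamma> by (simp add: M_def m_def d_def algebra_simps)
  \<comment> \<open>The bounds on \<open>\<pi>/\<alpha>\<close>, multiplied by \<open>e\<close> and
    read as strict inequalities between integers.\<close>
  have lo: "2 * int k * e < N" and hi: "N < (2 * int k + 2) * e" if e: "e > 0" and N: "N * \<alpha> = e * pi" for e N :: int
  proof -
    have e': "real_of_int e > 0" using e by simp
    have "real_of_int (2 * int k * e) * \<alpha> < N * \<alpha>"
      unfolding N using mult_strict_left_mono[OF bounds(2) e'] by (simp add: algebra_simps)
    then have "real_of_int (2 * int k * e) < of_int N" using bounds(1) by (simp only: mult_less_cancel_right_pos)
    then show "2 * int k * e < N" by (simp only: of_int_less_iff)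
    have "N * \<alpha> < real_of_int ((2 * int k + 2) * e) * \<alpha>"
      unfolding N using mult_strict_left_mono[OF bounds(3) e'] by (simp add: algebra_simps)
    then have "real_of_int N < of_int ((2 * int k + 2) * e)" using bounds(1) by (simp only: mult_less_cancel_right_pos)
    then show "N < (2 * int k + 2) * e" by (simp only: of_int_less_iff)
  qed
  have neg: "of_int (- M) * \<alpha> = of_int (- d) * pi" using M by simp
  have b: "(2 * k + 1) * \<alpha> = pi" if "N * \<alpha> = pi" "N = 2 * int k + 1" for N :: int
    using that by (simp add: algebra_simps)
  have two: "(N = 4 * int k + 1 \<and> (4 * k + 1) * \<alpha> = 2 * pi) \<or> (2 * k + 1) * \<alpha> = pi \<or>
      (N = 4 * int k + 3 \<and> (4 * k + 3) * \<alpha> = 2 * pi)" if N: "N * \<alpha> = 2 * pi" for N :: int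
  proof -
    have "4 * int k < N" "N < 4 * int k + 4" using lo[of 2 N] hi[of 2 N] N by simp_all
    then consider "N = 4 * int k + 1" | "N = 4 * int k + 2" | "N = 4 * int k + 3" by linarith
    then show ?thesis using N by cases (auto simp: algebra_simps)
  qed
  have m0: "int m \<ge> 0" by simp
  consider "d = 0" | "d = 1" | "d = 2" | "d = -1" | "d = -2" | "d = -3" | "d \<le> -4"
    using n d_def by linarith
  then show ?thesis
  proof cases
    case 1
    then have "M = 0" using M bounds(1) by simp
    then have "int m = int (n * (k + 1))" using 1 by (simp add: M_def d_def algebra_simps)
    then have "m = n * (k + 1)" by (simp only: of_nat_eq_iff)
    then show ?thesis using 1 by (simp add: d_def)
  next
    case 2
    then have 1: "M * \<alpha> = pi" using M by simp
    then have "M = 2 * int k + 1" using lo[of 1 M] hi[of 1 M] by simp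
    with 1 have "(2 * k + 1) * \<alpha> = pi" by (rule b)
    then show ?thesis by blast
  next
    case 3
    then have q: "q = 0" "n = 2" using n by (auto simp: d_def)
    from two[of M] M 3 q show ?thesis by (auto simp: M_def)
  next
    case 4
    then have 1: "of_int (- M) * \<alpha> = pi" using neg by simp
    then have "- M = 2 * int k + 1" using lo[of 1 "-M"] hi[of 1 "-M"] by simp
    with 1 have "(2 * k + 1) * \<alpha> = pi" by (rule b)
    then show ?thesis by blast
  next
    case 5
    have 2: "of_int (- M) * \<alpha> = 2 * pi" using neg 5 by simp
    from n show ?thesis
    proof
      assume "n = 1"
      then have "q = 3" using 5 by (simp add: d_def)
      then have "- M \<le> 3 * int k + 3" using m0 by (simp add: M_def)
      moreover have "4 * int k < - M" using lo[of 2 "-M"] 2 by simp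
      ultimately show ?thesis using k3 by linarith
    next
      assume n: "n = 2"
      then have "q = 4" using 5 by (simp add: d_def)
      then show ?thesis using two[OF 2] n by (auto simp: M_def)
    qed
  next
    case 6
    have 2: "of_int (- M) * \<alpha> = 3 * pi" using neg 6 by simp
    have l: "6 * int k < - M" using lo[of 3 "-M"] 2 by simp
    from n show ?thesis
    proof
      assume "n = 1"
      then have "q = 4" using 6 by (simp add: d_def)
      then have "- M \<le> 4 * int k + 4" using m0 by (simp add: M_def)
      then show ?thesis using l k3 by linarith
    next
      assume n: "n = 2"
      then have q: "q = 5" using 6 by (simp add: d_def)
      then have "int m < 5 - int k" using l by (simp add: M_def)
      then have "m < 2" using k3 by linarith
      then have "k * r < 2" by (simp add: m_def)
      then have "r = 0" using k3 by (cases r) auto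
      \<comment> \<open>Parity: here \<open>-M\<alpha> = 3\<pi>\<close>, so an odd multiple of
        \<open>\<alpha>\<close> equal to \<open>2\<pi>\<close> would make the even number
        \<open>-2M\<close> three times an odd one.\<close>
      moreover have "(2 * j + 1) * \<alpha> \<noteq> 2 * pi" for j :: nat
      proof
        assume "(2 * j + 1) * \<alpha> = 2 * pi"
        then have "of_int (- M * 2) * \<alpha> = of_int (3 * (2 * int j + 1)) * \<alpha>" using 2 by (simp add: algebra_simps)
        then have "- M * 2 = 3 * (2 * int j + 1)" using bounds(1) by (simp only: mult_cancel_right of_int_eq_iff) simp
        then show False by presburger
      qed
      from this[of "2 * k"] this[of "2 * k + 1"]
      have "(4 * k + 1) * \<alpha> \<noteq> 2 * pi" "(4 * k + 3) * \<alpha> \<noteq> 2 * pi" by (simp_all add: algebra_simps)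
      ultimately show ?thesis using n q by blast
    qed
  next
    case 7
    define D where "D = - d"
    have D: "D \<ge> 4" using 7 D_def by simp
    have "2 * int k * D < - M" using lo[of D "-M"] neg D by (simp add: D_def)
    moreover have "- M \<le> int q * (int k + 1)" using m0 by (simp add: M_def algebra_simps)
    moreover have "int q * (int k + 1) \<le> (2 + D) * (int k + 1)"
      using n by (intro mult_right_mono) (auto simp: D_def d_def)
    ultimately have "2 * int k * D < (2 + D) * (int k + 1)" by linarith
    \<comment> \<open>As \<open>D \<ge> 4\<close>, this would give \<open>4(k - 1) < 2k + 2\<close>,
      that is \<open>k < 3\<close>.\<close>
    then have "D * (int k - 1) < 2 * int k + 2" by (simp add: algebra_simps)
    moreover have "4 * (int k - 1) \<le> D * (int k - 1)" using D k3 by (intro mult_right_mono) auto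
    ultimately have "4 * (int k - 1) < 2 * int k + 2" by (rule le_less_trans[rotated])
    then have "int k < 3" by presburger
    then show ?thesis using k3 by simp
  qed
qed

text \<open>For \<open>k \<ge> 3\<close> the angle \<open>\<alpha>\<close> is strictly the smallest:
  \<open>\<gamma> \<ge> 3\<alpha>\<close>, and \<open>2k\<alpha> < \<pi>\<close> gives
  \<open>\<beta> > (k - 1)\<alpha>\<close>.\<close>

lemma corner_\<alpha>:
  fixes p q r :: nat
  assumes eq: "p * \<alpha> + q * \<beta> + r * \<gamma> = \<alpha>"
  shows "p = 1" "q = 0" "r = 0"
proof -
  have pos: "0 \<le> p * \<alpha>" "0 \<le> q * \<beta>" "0 \<le> r * \<gamma>" and \<beta>0: "\<beta> > \<alpha>" and \<gamma>0: "\<gamma> > \<alpha>"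
  proof -
    have "real k * \<alpha> \<ge> 3 * \<alpha>" using k3 bounds(1) by (intro mult_right_mono) auto
    moreover have "\<beta> = pi - real k * \<alpha> - \<alpha>" "2 * (real k * \<alpha>) < pi" using sum \<gamma> bounds(2) by simp_all
    ultimately show "\<beta> > \<alpha>" "\<gamma> > \<alpha>" using \<gamma> bounds(1) by linarith+
    then show "0 \<le> p * \<alpha>" "0 \<le> q * \<beta>" "0 \<le> r * \<gamma>" using bounds(1) by auto
  qed
  have "x < 1" if "real x * y \<le> \<alpha>" "y > \<alpha>" for x :: nat and y :: real
  proof (rule ccontr)
    assume "\<not> ?thesis"
    then have "1 * y \<le> real x * y" using that bounds(1) by (intro mult_right_mono) auto
    then show False using that by simp
  qed
  from this[of q \<beta>] this[of r \<gamma>] show "q = 0" "r = 0" using eq pos \<beta>0 \<gamma>0 by auto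
  then show "p = 1" using eq bounds(1) by simp
qed

text \<open>A corner \<open>\<beta>\<close> filled without any \<open>\<beta>\<close> has
  \<open>(p + kr + k + 1)\<alpha> = \<pi>\<close>. The factor is strictly between \<open>2k\<close>
  and \<open>2k + 2\<close>, hence \<open>2k + 1\<close>, and the triangle is isosceles with
  \<open>\<beta> = \<gamma>\<close>.\<close>

lemma corner_\<beta>:
  fixes p q r :: nat
  assumes eq: "p * \<alpha> + q * \<beta> + r * \<gamma> = \<beta>"
  shows "(p = 0 \<and> q = 1 \<and> r = 0) \<or> (q = 0 \<and> p + k * r = k \<and> (2 * k + 1) * \<alpha> = pi)"
proof -
  have \<gamma>0: "\<gamma> > 0" using \<gamma> k3 bounds(1) by simp
  have "real k * \<alpha> \<ge> 3 * \<alpha>" using k3 bounds(1) by (intro mult_right_mono) auto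
  moreover have "\<beta> = pi - real k * \<alpha> - \<alpha>" "2 * (real k * \<alpha>) < pi" using sum \<gamma> bounds(2) by simp_all
  ultimately have \<beta>0: "\<beta> > 0" using bounds(1) by linarith
  consider "q = 0" | "q = 1" | "q \<ge> 2" by linarith
  then show ?thesis
  proof cases
    case 1
    have m: "(p + k * r + k + 1) * \<alpha> = pi" using eq 1 unfolding \<beta> \<gamma> by (simp add: algebra_simps)
    then have "real (2 * k) * \<alpha> < real (p + k * r + k + 1) * \<alpha>" "real (p + k * r + k + 1) * \<alpha> < real (2 * k + 2) * \<alpha>"
      using bounds by simp_all
    then have "2 * k < p + k * r + k + 1" "p + k * r + k + 1 < 2 * k + 2"
      using bounds(1) by (simp_all only: mult_less_cancel_right_pos of_nat_less_iff)
    then have e: "p + k * r = k" by linarith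
    then have "(2 * k + 1) * \<alpha> = pi" using m by (simp add: algebra_simps)
    then show ?thesis using 1 e by blast
  next
    case 2
    then have "p * \<alpha> + r * \<gamma> = 0" using eq by simp
    moreover have "0 \<le> p * \<alpha>" "0 \<le> r * \<gamma>" using bounds(1) \<gamma>0 by auto
    ultimately have "p * \<alpha> = 0" "r * \<gamma> = 0" by linarith+
    then show ?thesis using 2 bounds(1) \<gamma>0 by auto
  next
    case 3
    have "2 * \<beta> \<le> q * \<beta>" using 3 \<beta>0 by (intro mult_right_mono) auto
    moreover have "0 \<le> p * \<alpha>" "0 \<le> r * \<gamma>" using bounds(1) \<gamma>0 by auto
    ultimately show ?thesis using eq \<beta>0 by linarith
  qed
qed

text \<open>Summing such a functional over all vertices of a tiling with \<open>k\<close> tiles of angle \<open>\<alpha>\<close> at the third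
  corner gives a positive value, although it should be \<open>(u + v + w)\<close> times the number of tiles.\<close>

definition weight :: "real \<Rightarrow> real \<Rightarrow> real \<Rightarrow> bool" where
  "weight u v w \<longleftrightarrow> u + v + w = 0 \<and>
    (\<forall>p q r n. n = 1 \<or> n = 2 \<longrightarrow> real p * \<alpha> + real q * \<beta> + real r * \<gamma> = real n * pi \<longrightarrow> u * real p + v * real q + w * real r \<ge> 0) \<and>
    (\<forall>p q r p' q' r'. real p * \<alpha> + real q * \<beta> + real r * \<gamma> = \<alpha> \<longrightarrow> real p' * \<alpha> + real q' * \<beta> + real r' * \<gamma> = \<beta> \<longrightarrow>
       u * real (p + p' + k) + v * real (q + q') + w * real (r + r') > 0)"

lemma weightI:
  assumes "u + v + w = 0"
    and "\<And>p q r n. n = 1 \<or> n = 2 \<Longrightarrow> real p * \<alpha> + real q * \<beta> + real r * \<gamma> = real n * pi \<Longrightarrow> u * real p + v * real q + w * real r \<ge> 0"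
    and "\<And>p q r p' q' r'. real p * \<alpha> + real q * \<beta> + real r * \<gamma> = \<alpha> \<Longrightarrow> real p' * \<alpha> + real q' * \<beta> + real r' * \<gamma> = \<beta> \<Longrightarrow>
       u * real (p + p' + k) + v * real (q + q') + w * real (r + r') > 0"
  shows "weight u v w"
  unfolding weight_def using assms by auto

lemma r_bound: "r \<le> j" if "p + k * r = m" "m < k * (j + 1)" for p r j m :: nat
proof -
  have "k * r < k * (j + 1)" using that by linarith
  then have "r < j + 1" by (simp only: mult_less_cancel1)
  then show ?thesis by simp
qed

text \<open>The coefficients come from the vertex types on which the functional vanishes, normalised
  by \<open>u = 1\<close> and \<open>u + v + w = 0\<close>. If \<open>\<beta> = \<gamma>\<close>,
  symmetry gives \<open>(1, -1/2, -1/2)\<close>. If \<open>(4k + 3)\<alpha> = 2\<pi>\<close>, the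
  tight types are \<open>(1, 4, 0)\<close> and \<open>(3, 0, 4)\<close>; if
  \<open>(4k + 1)\<alpha> = 2\<pi>\<close>, they are \<open>(3, 4, 0)\<close> and
  \<open>(1, 0, 4)\<close>. Otherwise \<open>p - r\<close> works. For \<open>k = 3\<close> the
  latter two special cases also admit \<open>(0, 0, 5)\<close> and \<open>(0, 4, 1)\<close>,
  respectively, where these functionals are negative.\<close>

lemma weight_exists:
  assumes "\<not> (k = 3 \<and> (13 * \<alpha> = 2 * pi \<or> 15 * \<alpha> = 2 * pi))"
  shows "\<exists>u v w. weight u v w"
proof (cases "(2 * k + 1) * \<alpha> = pi")
  case True
  have b: "\<beta> = k * \<alpha>" using True by (simp add: \<beta> algebra_simps)
  have 1: "1 * real p + (-1/2) * real q + (-1/2) * real r \<ge> 0" if n: "n = 1 \<or> n = 2" and e: "p * \<alpha> + q * \<beta> + r * \<gamma> = n * pi" for p q r n :: nat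
  proof -
    have "(p + k * (q + r)) * \<alpha> = n * pi" using e unfolding b \<gamma> by (simp add: algebra_simps)
    moreover have "(n * (2 * k + 1)) * \<alpha> = n * pi" using True by (simp only: of_nat_mult mult.assoc)
    ultimately have "(p + k * (q + r)) * \<alpha> = (n * (2 * k + 1)) * \<alpha>" by simp
    then have "real (p + k * (q + r)) = real (n * (2 * k + 1))" using bounds(1) by (simp only: mult_cancel_right) simp
    then have m: "p + k * (q + r) = n * (2 * k + 1)" by (simp only: of_nat_eq_iff)
    have "q + r \<le> 2 * n" by (rule r_bound[OF m]) (use n k3 in auto)
    then consider "n = 1" "q + r = 0" | "n = 1" "q + r = 1" | "n = 1" "q + r = 2" | "n = 2" "q + r = 0" | "n = 2" "q + r = 1"
       | "n = 2" "q + r = 2" | "n = 2" "q + r = 3" | "n = 2" "q + r = 4" using n by linarith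
    then have "2 * p \<ge> q + r" by cases (use m k3 in auto)
    then have "real (q + r) \<le> real (2 * p)" by (simp only: of_nat_le_iff)
    then show ?thesis by simp
  qed
  have 2: "1 * real (p + p' + k) + (-1/2) * real (q + q') + (-1/2) * real (r + r') > 0"
    if e: "p * \<alpha> + q * \<beta> + r * \<gamma> = \<alpha>" "p' * \<alpha> + q' * \<beta> + r' * \<gamma> = \<beta>" for p q r p' q' r' :: nat
  proof -
    have "r' \<le> 1" if "p' + k * r' = k" by (rule r_bound[OF that]) (use k3 in auto)
    then have "2 * (p + p' + k) > q + q' + r + r'"
      using corner_\<alpha>[OF e(1)] corner_\<beta>[OF e(2)] k3 by auto
    then have "real (q + q' + r + r') < real (2 * (p + p' + k))" by (simp only: of_nat_less_iff)
    then show ?thesis by (simp add: field_simps)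
  qed
  have "weight 1 (-1/2) (-1/2)" by (rule weightI[OF _ 1 2]) simp
  then show ?thesis by blast
next
  case False
  note nb = this
  \<comment> \<open>Outside the isosceles case the corners with angles \<open>\<alpha>\<close> and
    \<open>\<beta>\<close> are not divided, so the three corners contribute
    \<open>(k + 1, 1, 0)\<close>.\<close>
  have corner: "u * real (p + p' + k) + v * real (q + q') + w * real (r + r') > 0"
    if "u * (1 + k) + v > 0" and e: "p * \<alpha> + q * \<beta> + r * \<gamma> = \<alpha>" "p' * \<alpha> + q' * \<beta> + r' * \<gamma> = \<beta>"
    for u v w :: real and p q r p' q' r' :: nat
    using corner_\<alpha>[OF e(1)] corner_\<beta>[OF e(2)] that(1) nb by auto
  have r1: "(p = k + 1 \<and> r = 0) \<or> (p = 1 \<and> r = 1)" if m: "p + k * r = 1 * (k + 1)" for p r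
  proof -
    have "r \<le> 1" by (rule r_bound[OF m]) (use k3 in auto)
    then consider "r = 0" | "r = 1" by linarith
    then show ?thesis by cases (use m in auto)
  qed
  have r2: "(p = 2 * k + 2 \<and> r = 0) \<or> (p = k + 2 \<and> r = 1) \<or> (p = 2 \<and> r = 2)" if m: "p + k * r = 2 * (k + 1)" for p r
  proof -
    have "r \<le> 2" by (rule r_bound[OF m]) (use k3 in auto)
    then consider "r = 0" | "r = 1" | "r = 2" by linarith
    then show ?thesis by cases (use m in auto)
  qed
  \<comment> \<open>\<open>j < k\<close> excludes \<open>r = 5\<close>; with \<open>j = 3\<close>
    this is where \<open>k = 3\<close> would fail.\<close>
  have r4: "(p = 4 * k + j \<and> r = 0) \<or> (p = 3 * k + j \<and> r = 1) \<or> (p = 2 * k + j \<and> r = 2) \<or> (p = k + j \<and> r = 3) \<or> (p = j \<and> r = 4)"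
    if m: "p + k * r = 4 * k + j" and j: "j < k" for p r j
  proof -
    have "r \<le> 4" by (rule r_bound[OF m]) (use j in auto)
    then consider "r = 0" | "r = 1" | "r = 2" | "r = 3" | "r = 4" by linarith
    then show ?thesis by cases (use m in auto)
  qed
  have r0: "r = 0" if "p + k * r = j" "j < k" for p r j using r_bound[OF that(1), of 0] that(2) by simp
  consider (II) "(4 * k + 3) * \<alpha> = 2 * pi" | (III) "(4 * k + 1) * \<alpha> = 2 * pi" "(4 * k + 3) * \<alpha> \<noteq> 2 * pi"
    | (V) "(4 * k + 1) * \<alpha> \<noteq> 2 * pi" "(4 * k + 3) * \<alpha> \<noteq> 2 * pi" by blast
  then show ?thesis
  proof cases
    case II
    then have k4: "k \<ge> 4" using assms k3 by (cases "k = 3") auto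
    have ne: "(4 * k + 1) * \<alpha> \<noteq> 2 * pi" using II bounds(1) by (auto simp: algebra_simps)
    have *: "1 * real p + (-1/4) * real q + (-3/4) * real r \<ge> 0" if n: "n = 1 \<or> n = 2" and e: "p * \<alpha> + q * \<beta> + r * \<gamma> = n * pi" for p q r n :: nat
      using classify[OF n e] nb ne II n r1[of p r] r2[of p r] r4[of p r 3] r0[of p r 1] k4 by auto
    have "weight 1 (-1/4) (-3/4)" by (rule weightI[OF _ * corner]) (use k3 in auto)
    then show ?thesis by blast
  next
    case III
    then have k4: "k \<ge> 4" using assms k3 by (cases "k = 3") auto
    have *: "1 * real p + (-3/4) * real q + (-1/4) * real r \<ge> 0" if n: "n = 1 \<or> n = 2" and e: "p * \<alpha> + q * \<beta> + r * \<gamma> = n * pi" for p q r n :: nat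
      using classify[OF n e] nb III n r1[of p r] r2[of p r] r4[of p r 1] r0[of p r 3] k4 by auto
    have "weight 1 (-3/4) (-1/4)" by (rule weightI[OF _ * corner]) (use k3 in auto)
    then show ?thesis by blast
  next
    case V
    have *: "1 * real p + 0 * real q + (-1) * real r \<ge> 0" if n: "n = 1 \<or> n = 2" and e: "p * \<alpha> + q * \<beta> + r * \<gamma> = n * pi" for p q r n :: nat
      using classify[OF n e] nb V n r1[of p r] r2[of p r] by auto
    have "weight 1 0 (-1)" by (rule weightI[OF _ * corner]) (use k3 in auto)
    then show ?thesis by blast
  qed
qed

end

section \<open>Counting angles in a reptiling\<close>

text \<open>The tile \<open>t\<close> has its vertices labelled so that \<open>va t\<close>, \<open>vb t\<close>, \<open>vc t\<close> correspond to
  \<open>A\<close>, \<open>B\<close>, \<open>C\<close> under a similarity of ratio \<open>lam\<close>.\<close>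

locale labelled_tiling =
  fixes A B C :: point and P :: "point set set" and lam :: real
    and va vb vc :: "point set \<Rightarrow> point"
  assumes nc: "\<not> collinear {A, B, C}" and ac: "acute A B C"
    and fin: "finite P" and cover: "\<Union>P = convex hull {A, B, C}"
    and disj: "\<And>s t. s \<in> P \<Longrightarrow> t \<in> P \<Longrightarrow> s \<noteq> t \<Longrightarrow> interior s \<inter> interior t = {}"
    and lam: "lam > 0" "lam\<^sup>2 = card P"
    and hull: "\<And>t. t \<in> P \<Longrightarrow> t = convex hull {va t, vb t, vc t}"
    and dists: "\<And>t. t \<in> P \<Longrightarrow> dist A B = lam * dist (va t) (vb t)"
      "\<And>t. t \<in> P \<Longrightarrow> dist A C = lam * dist (va t) (vc t)"
      "\<And>t. t \<in> P \<Longrightarrow> dist B C = lam * dist (vb t) (vc t)"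
begin

abbreviation "\<alpha> \<equiv> angle B A C"
abbreviation "\<beta> \<equiv> angle A B C"
abbreviation "\<gamma> \<equiv> angle A C B"

lemma angles: "\<alpha> + \<beta> + \<gamma> = pi" "\<alpha> > 0" "\<beta> > 0" "\<gamma> > 0" "\<alpha> < pi / 2" "\<beta> < pi / 2" "\<gamma> < pi / 2"
  using triangle_trig[OF nc] ac by (auto simp: acute_def)

lemma tile_noncollinear: "t \<in> P \<Longrightarrow> \<not> collinear {va t, vb t, vc t}"
  and tile_angles: "t \<in> P \<Longrightarrow> angle (vb t) (va t) (vc t) = \<alpha>" "t \<in> P \<Longrightarrow> angle (va t) (vb t) (vc t) = \<beta>"
    "t \<in> P \<Longrightarrow> angle (va t) (vc t) (vb t) = \<gamma>"
  using scaled_triangle[OF lam(1) dists] nc by simp_all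

lemma tile_distinct:
  assumes "t \<in> P" shows "va t \<noteq> vb t" "va t \<noteq> vc t" "vb t \<noteq> vc t"
  using tile_noncollinear[OF assms] by (auto simp: insert_commute)

lemma tile_is_triangle: "t \<in> P \<Longrightarrow> is_triangle t"
  using hull tile_noncollinear unfolding is_triangle_def by blast

lemma ang_vertices:
  assumes "\<not> collinear {X, Y, Z}"
  shows "ang (convex hull {X, Y, Z}) X = angle Y X Z" "ang (convex hull {X, Y, Z}) Y = angle X Y Z"
    "ang (convex hull {X, Y, Z}) Z = angle X Z Y"
proof -
  have p: "{Y, X, Z} = {X, Y, Z}" "{Z, X, Y} = {X, Y, Z}" by auto
  show "ang (convex hull {X, Y, Z}) X = angle Y X Z" by (rule ang_triangle_vertex[OF assms])
  show "ang (convex hull {X, Y, Z}) Y = angle X Y Z" by (rule ang_triangle_vertex[of Y X Z, unfolded p, OF assms])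
  show "ang (convex hull {X, Y, Z}) Z = angle X Z Y" by (rule ang_triangle_vertex[of Z X Y, unfolded p, OF assms])
qed

lemma ang_T: "ang (\<Union>P) A = \<alpha>" "ang (\<Union>P) B = \<beta>" "ang (\<Union>P) C = \<gamma>"
  unfolding cover using ang_vertices[OF nc] by auto

lemma ang_T_other: "v \<in> \<Union>P \<Longrightarrow> v \<notin> {A, B, C} \<Longrightarrow> ang (\<Union>P) v \<in> {pi, 2 * pi}"
  unfolding cover by (rule ang_triangle_other[OF nc])

text \<open>\<open>j\<close> absorbs the contribution \<open>pi\<close> or \<open>2 * pi\<close> at
  points of the tile that are not vertices, so one formula covers every position of
  \<open>v\<close>.\<close>

lemma ang_tile:
  assumes "t \<in> P"
  obtains j :: nat where
    "ang t v = \<alpha> * of_bool (va t = v) + \<beta> * of_bool (vb t = v) + \<gamma> * of_bool (vc t = v) + real j * pi"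
    "v \<in> t \<Longrightarrow> v \<notin> {va t, vb t, vc t} \<Longrightarrow> j \<ge> 1"
proof -
  note h = hull[OF assms] and n = tile_noncollinear[OF assms] and d = tile_distinct[OF assms] and a = tile_angles[OF assms]
  note av = ang_vertices[OF n, folded h, unfolded a]
  consider "v = va t" | "v = vb t" | "v = vc t" | "v \<notin> t" | "v \<in> t" "v \<notin> {va t, vb t, vc t}" by blast
  then show thesis
  proof cases
    case 1 then show ?thesis using d av that[of 0] by auto
  next
    case 2 then show ?thesis using d av that[of 0] by auto
  next
    case 3 then show ?thesis using d av that[of 0] by auto
  next
    case 4
    moreover from 4 have "v \<notin> {va t, vb t, vc t}" using hull_inc[of v "{va t, vb t, vc t}" convex] h by auto
    moreover have "ang t v = 0" using ang_triangle_outside[OF n, folded h] 4 by simp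
    ultimately show ?thesis using that[of 0] by auto
  next
    case 5
    then have "ang t v \<in> {pi, 2 * pi}" using ang_triangle_other[OF n, folded h] by simp
    then show ?thesis
    proof
      assume "ang t v = pi" then show ?thesis using 5 that[of 1] by auto
    next
      assume "ang t v \<in> {2 * pi}" then show ?thesis using 5 that[of 2] by auto
    qed
  qed
qed

definition cnt_a where "cnt_a v = card {t \<in> P. va t = v}"
definition cnt_b where "cnt_b v = card {t \<in> P. vb t = v}"
definition cnt_c where "cnt_c v = card {t \<in> P. vc t = v}"

text \<open>\<open>j\<close> counts straight angles. The condition \<open>j \<ge> 1\<close> is kept
  in order to show later that a corner of the large triangle is only met by vertices of
  tiles.\<close>

lemma vertex_equation:
  "\<exists>j :: nat. cnt_a v * \<alpha> + cnt_b v * \<beta> + cnt_c v * \<gamma> + real j * pi = ang (\<Union>P) v \<and>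
    ((\<exists>t\<in>P. v \<in> t \<and> v \<notin> {va t, vb t, vc t}) \<longrightarrow> j \<ge> 1)"
proof -
  have "\<forall>t. \<exists>j::nat. t \<in> P \<longrightarrow>
      ang t v = \<alpha> * of_bool (va t = v) + \<beta> * of_bool (vb t = v) + \<gamma> * of_bool (vc t = v) + real j * pi \<and>
      (v \<in> t \<longrightarrow> v \<notin> {va t, vb t, vc t} \<longrightarrow> j \<ge> 1)"
    using ang_tile by metis
  then obtain j :: "point set \<Rightarrow> nat" where j: "\<And>t. t \<in> P \<Longrightarrow>
      ang t v = \<alpha> * of_bool (va t = v) + \<beta> * of_bool (vb t = v) + \<gamma> * of_bool (vc t = v) + real (j t) * pi"
      "\<And>t. t \<in> P \<Longrightarrow> v \<in> t \<Longrightarrow> v \<notin> {va t, vb t, vc t} \<Longrightarrow> j t \<ge> 1"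
    by metis
  have cnt: "(\<Sum>t\<in>P. of_bool (f t = v)) = real (card {t \<in> P. f t = v})" for f :: "point set \<Rightarrow> point"
    using fin by (simp add: of_bool_def sum.If_cases Int_def)
  have "ang (\<Union>P) v = (\<Sum>t\<in>P. ang t v)"
    by (rule ang_sum[OF fin tile_is_triangle disj])
  also have "\<dots> = (\<Sum>t\<in>P. \<alpha> * of_bool (va t = v) + \<beta> * of_bool (vb t = v) + \<gamma> * of_bool (vc t = v) + real (j t) * pi)"
    using j(1) by (rule sum.cong[OF refl])
  also have "\<dots> = cnt_a v * \<alpha> + cnt_b v * \<beta> + cnt_c v * \<gamma> + real (sum j P) * pi"
    by (simp add: sum.distrib cnt cnt_a_def cnt_b_def cnt_c_def mult.commute flip: sum_distrib_left)
  finally have e: "cnt_a v * \<alpha> + cnt_b v * \<beta> + cnt_c v * \<gamma> + real (sum j P) * pi = ang (\<Union>P) v" ..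
  show ?thesis
  proof (intro exI conjI impI, rule e)
    assume "\<exists>t\<in>P. v \<in> t \<and> v \<notin> {va t, vb t, vc t}"
    then obtain t where "t \<in> P" "j t \<ge> 1" using j(2) by blast
    then show "sum j P \<ge> 1" using member_le_sum[of t P j] fin by auto
  qed
qed

lemma nonneg: "0 \<le> cnt_a v * \<alpha> + cnt_b v * \<beta> + cnt_c v * \<gamma>"
  using angles by (intro add_nonneg_nonneg mult_nonneg_nonneg) auto

lemma positive:
  assumes "cnt_a v + cnt_b v + cnt_c v > 0" shows "0 < cnt_a v * \<alpha> + cnt_b v * \<beta> + cnt_c v * \<gamma>"
proof -
  have "0 \<le> cnt_a v * \<alpha>" "0 \<le> cnt_b v * \<beta>" "0 \<le> cnt_c v * \<gamma>" using angles by auto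
  moreover have "0 < cnt_a v * \<alpha> \<or> 0 < cnt_b v * \<beta> \<or> 0 < cnt_c v * \<gamma>" using assms angles by auto
  ultimately show ?thesis by linarith
qed

text \<open>The angles of the large triangle are below \<open>pi\<close>, which leaves no room for a
  straight angle at a corner.\<close>

lemma corner_equation:
  assumes "v \<in> {A, B, C}"
  shows "cnt_a v * \<alpha> + cnt_b v * \<beta> + cnt_c v * \<gamma> = ang (\<Union>P) v"
    and "t \<in> P \<Longrightarrow> v \<in> t \<Longrightarrow> v \<in> {va t, vb t, vc t}"
proof -
  have l: "ang (\<Union>P) v < pi" using assms ang_T angles by auto
  obtain j :: nat where j: "cnt_a v * \<alpha> + cnt_b v * \<beta> + cnt_c v * \<gamma> + real j * pi = ang (\<Union>P) v"
    "(\<exists>t\<in>P. v \<in> t \<and> v \<notin> {va t, vb t, vc t}) \<Longrightarrow> j \<ge> 1" using vertex_equation[of v] by blast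
  have "j = 0"
  proof (rule ccontr)
    assume "j \<noteq> 0"
    then have "1 * pi \<le> real j * pi" by (intro mult_right_mono) auto
    then show False using nonneg[of v] j(1) l by linarith
  qed
  then show "cnt_a v * \<alpha> + cnt_b v * \<beta> + cnt_c v * \<gamma> = ang (\<Union>P) v" using j(1) by simp
  show "v \<in> {va t, vb t, vc t}" if "t \<in> P" "v \<in> t" using j(2) \<open>j = 0\<close> that by auto
qed

text \<open>\<open>n\<close> is what remains of \<open>pi\<close> or \<open>2 * pi\<close> after
  removing the straight angles; a tile vertex at \<open>v\<close> keeps it positive.\<close>

lemma inner_equation:
  assumes "v \<notin> {A, B, C}" "cnt_a v + cnt_b v + cnt_c v > 0"
  obtains n :: nat where "n = 1 \<or> n = 2" "cnt_a v * \<alpha> + cnt_b v * \<beta> + cnt_c v * \<gamma> = n * pi"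
proof -
  obtain j :: nat where j: "cnt_a v * \<alpha> + cnt_b v * \<beta> + cnt_c v * \<gamma> + real j * pi = ang (\<Union>P) v"
    using vertex_equation by metis
  have "ang (\<Union>P) v \<in> {pi, 2 * pi}"
  proof (rule ang_T_other[OF _ assms(1)])
    have "{t \<in> P. va t = v} \<noteq> {} \<or> {t \<in> P. vb t = v} \<noteq> {} \<or> {t \<in> P. vc t = v} \<noteq> {}"
      using assms(2) unfolding cnt_a_def cnt_b_def cnt_c_def by (metis add_cancel_left_left card.empty less_irrefl)
    then obtain t where "t \<in> P" "v \<in> {va t, vb t, vc t}" by auto
    then show "v \<in> \<Union>P" using hull[of t] hull_inc[of v "{va t, vb t, vc t}" convex] by auto
  qed
  then obtain m :: nat where m: "m = 1 \<or> m = 2" "ang (\<Union>P) v = m * pi" by force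
  have "real j * pi < m * pi" using j m(2) positive[OF assms(2)] by linarith
  then have "j < m" by simp
  then have "m - j = 1 \<or> m - j = 2" using m by auto
  moreover have "cnt_a v * \<alpha> + cnt_b v * \<beta> + cnt_c v * \<gamma> = real (m - j) * pi"
    using j m \<open>j < m\<close> by (simp add: of_nat_diff algebra_simps)
  ultimately show ?thesis using that by blast
qed

definition "V = va ` P \<union> vb ` P \<union> vc ` P \<union> {A, B, C}"

lemma totals: "(\<Sum>v\<in>V. cnt_a v) = card P" "(\<Sum>v\<in>V. cnt_b v) = card P" "(\<Sum>v\<in>V. cnt_c v) = card P"
proof -
  have fV: "finite V" using fin by (simp add: V_def)
  have *: "(\<Sum>v\<in>V. card {t \<in> P. f t = v}) = card P" if "f ` P \<subseteq> V" for f
    using sum.group[OF fin fV that, of "\<lambda>_. 1 :: nat"] by simp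
  show "(\<Sum>v\<in>V. cnt_a v) = card P" "(\<Sum>v\<in>V. cnt_b v) = card P" "(\<Sum>v\<in>V. cnt_c v) = card P"
    unfolding cnt_a_def cnt_b_def cnt_c_def by (rule *; force simp: V_def)+
qed

lemma card_at_corner:
  assumes "v \<in> {A, B, C}"
  shows "card {t \<in> P. v \<in> t} = cnt_a v + cnt_b v + cnt_c v"
proof -
  have "{t \<in> P. v \<in> t} = {t \<in> P. va t = v} \<union> {t \<in> P. vb t = v} \<union> {t \<in> P. vc t = v}"
  proof (intro set_eqI iffI)
    fix t assume "t \<in> {t \<in> P. v \<in> t}"
    then show "t \<in> {t \<in> P. va t = v} \<union> {t \<in> P. vb t = v} \<union> {t \<in> P. vc t = v}"
      using corner_equation(2)[OF assms, of t] by auto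
  next
    fix t assume t: "t \<in> {t \<in> P. va t = v} \<union> {t \<in> P. vb t = v} \<union> {t \<in> P. vc t = v}"
    then have "v \<in> convex hull {va t, vb t, vc t}" by (intro hull_inc) auto
    moreover have "t \<in> P" using t by auto
    ultimately show "t \<in> {t \<in> P. v \<in> t}" using hull[of t] by simp
  qed
  moreover have "{t \<in> P. va t = v} \<inter> {t \<in> P. vb t = v} = {}"
    "({t \<in> P. va t = v} \<union> {t \<in> P. vb t = v}) \<inter> {t \<in> P. vc t = v} = {}"
    by (auto dest: tile_distinct sym)
  ultimately show ?thesis unfolding cnt_a_def cnt_b_def cnt_c_def using fin
    by (simp add: card_Un_disjoint)
qed

lemma no_weight:
  assumes k3: "k \<ge> 3" and C: "cnt_a C = k" "cnt_b C = 0" "cnt_c C = 0"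
  shows "k = 3 \<and> (13 * \<alpha> = 2 * pi \<or> 15 * \<alpha> = 2 * pi)"
proof (rule ccontr)
  assume no: "\<not> ?thesis"
  have \<gamma>: "\<gamma> = k * \<alpha>" using corner_equation(1)[of C] C ang_T by simp
  interpret angle_data \<alpha> \<beta> \<gamma> k
    using k3 \<gamma> angles by unfold_locales auto
  obtain u v w where "weight u v w" using weight_exists no by blast
  then have s: "u + v + w = 0"
    and inner: "\<And>p q r n. n = 1 \<or> n = 2 \<Longrightarrow> real p * \<alpha> + real q * \<beta> + real r * \<gamma> = real n * pi \<Longrightarrow> u * real p + v * real q + w * real r \<ge> 0"
    and corner: "\<And>p q r p' q' r'. real p * \<alpha> + real q * \<beta> + real r * \<gamma> = \<alpha> \<Longrightarrow> real p' * \<alpha> + real q' * \<beta> + real r' * \<gamma> = \<beta> \<Longrightarrow>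
       u * real (p + p' + k) + v * real (q + q') + w * real (r + r') > 0"
    unfolding weight_def by blast+
  define W where "W x = u * real (cnt_a x) + v * real (cnt_b x) + w * real (cnt_c x)" for x
  have fV: "finite V" using fin by (simp add: V_def)
  have "(\<Sum>x\<in>V. W x) = u * real (\<Sum>x\<in>V. cnt_a x) + v * real (\<Sum>x\<in>V. cnt_b x) + w * real (\<Sum>x\<in>V. cnt_c x)"
    by (simp add: W_def sum.distrib sum_distrib_left)
  also have "\<dots> = (u + v + w) * real (card P)" by (simp only: totals) (simp add: algebra_simps)
  finally have "(\<Sum>x\<in>V. W x) = 0" using s by simp
  moreover have "(\<Sum>x\<in>V. W x) = (\<Sum>x\<in>V - {A, B, C}. W x) + (\<Sum>x\<in>{A, B, C}. W x)"
    by (rule sum.subset_diff) (use fV in \<open>auto simp: V_def\<close>)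
  moreover have "(\<Sum>x\<in>V - {A, B, C}. W x) \<ge> 0"
  proof (rule sum_nonneg)
    fix x assume x: "x \<in> V - {A, B, C}"
    show "W x \<ge> 0"
    proof (cases "cnt_a x + cnt_b x + cnt_c x > 0")
      case True
      then obtain n :: nat where "n = 1 \<or> n = 2" "cnt_a x * \<alpha> + cnt_b x * \<beta> + cnt_c x * \<gamma> = n * pi"
        using inner_equation[of x] x by auto
      then show ?thesis unfolding W_def by (rule inner)
    next
      case False then show ?thesis by (simp add: W_def)
    qed
  qed
  moreover have "(\<Sum>x\<in>{A, B, C}. W x) > 0"
  proof -
    have "A \<noteq> B" "A \<noteq> C" "B \<noteq> C" using nc by (auto simp: insert_commute)
    then have "(\<Sum>x\<in>{A, B, C}. W x) = W A + W B + W C" by simp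
    moreover have "u * real (cnt_a A + cnt_a B + k) + v * real (cnt_b A + cnt_b B) + w * real (cnt_c A + cnt_c B) > 0"
      using corner_equation(1)[of A] corner_equation(1)[of B] ang_T by (intro corner) auto
    ultimately show ?thesis using C by (simp add: W_def algebra_simps)
  qed
  ultimately show False by linarith
qed

end

section \<open>Tile sides along a side of the triangle\<close>

lemma on_line_iff:
  assumes "(B::point) \<noteq> C"
  shows "cross2 (B - C) (x - C) = 0 \<longleftrightarrow> (\<exists>s. x = C + s *\<^sub>R (B - C))"
proof
  assume c: "cross2 (B - C) (x - C) = 0"
  define u w where "u = B - C" and "w = x - C"
  have u: "u$1 * u$1 + u$2 * u$2 \<noteq> 0" using assms by (auto simp: u_def point_eq_iff add_nonneg_eq_0_iff)
  define s where "s = (w$1 * u$1 + w$2 * u$2) / (u$1 * u$1 + u$2 * u$2)"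
  have "u$1 * w$2 = u$2 * w$1" using c by (simp add: cross2_def u_def w_def)
  then have "w$1 * (u$1 * u$1 + u$2 * u$2) = (w$1 * u$1 + w$2 * u$2) * u$1"
    "w$2 * (u$1 * u$1 + u$2 * u$2) = (w$1 * u$1 + w$2 * u$2) * u$2" by algebra+
  then have "w = s *\<^sub>R u" using u unfolding point_eq_iff by (simp add: s_def eq_divide_eq)
  then show "\<exists>s. x = C + s *\<^sub>R (B - C)" by (intro exI[of _ s]) (simp add: u_def w_def algebra_simps)
qed (auto simp: cross2_def)

lemma cross2_hull_point:
  assumes "p = u *\<^sub>R X + v *\<^sub>R Y + w *\<^sub>R Z" "u + v + w = 1"
  shows "cross2 d (p - C) = u * cross2 d (X - C) + v * cross2 d (Y - C) + w * cross2 d (Z - C)"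
proof -
  have u: "u = 1 - v - w" using assms(2) by simp
  show ?thesis unfolding assms(1) u by (simp add: cross2_def algebra_simps)
qed

lemma trace_two:
  assumes BC: "(B::point) \<noteq> C" and Z: "cross2 (B - C) (Z - C) \<noteq> 0"
    and X: "X = C + x *\<^sub>R (B - C)" and Y: "Y = C + y *\<^sub>R (B - C)"
  shows "{s. C + s *\<^sub>R (B - C) \<in> convex hull {X, Y, Z}} = closed_segment x y"
proof (intro set_eqI iffI)
  have 0: "cross2 (B - C) (C + s *\<^sub>R (B - C) - C) = 0" for s by (simp add: cross2_def)
  fix s assume "s \<in> {s. C + s *\<^sub>R (B - C) \<in> convex hull {X, Y, Z}}"
  then obtain u v w where uvw: "0 \<le> u" "0 \<le> v" "0 \<le> w" "u + v + w = 1"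
    and p: "C + s *\<^sub>R (B - C) = u *\<^sub>R X + v *\<^sub>R Y + w *\<^sub>R Z"
    by (auto simp: convex_hull_3)
  have "w * cross2 (B - C) (Z - C) = 0"
    using cross2_hull_point[OF p uvw(4), of "B - C" C] unfolding X Y 0 by simp
  then have w: "w = 0" using Z by simp
  then have u: "u = 1 - v" using uvw by simp
  have "s *\<^sub>R (B - C) = (u * x + v * y) *\<^sub>R (B - C)"
    using p unfolding X Y w u by (simp add: algebra_simps)
  then have "s = (1 - v) * x + v * y" using BC u by simp
  then show "s \<in> closed_segment x y" unfolding closed_segment_def using uvw u by auto
next
  fix s assume "s \<in> closed_segment x y"
  then obtain v where v: "0 \<le> v" "v \<le> 1" "s = (1 - v) * x + v * y" by (auto simp: closed_segment_def)
  have "C + s *\<^sub>R (B - C) = (1 - v) *\<^sub>R X + v *\<^sub>R Y + 0 *\<^sub>R Z"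
    unfolding X Y v(3) by (simp add: algebra_simps)
  then have "\<exists>u v w. C + s *\<^sub>R (B - C) = u *\<^sub>R X + v *\<^sub>R Y + w *\<^sub>R Z \<and> 0 \<le> u \<and> 0 \<le> v \<and> 0 \<le> w \<and> u + v + w = 1"
    using v(1,2) by (intro exI[of _ "1 - v"] exI[of _ v] exI[of _ 0]) simp
  then show "s \<in> {s. C + s *\<^sub>R (B - C) \<in> convex hull {X, Y, Z}}"
    unfolding convex_hull_3 by blast
qed

lemma trace_one:
  assumes h: "D * cross2 (B - C) (X - C) \<ge> 0" "D * cross2 (B - C) (Y - C) > 0" "D * cross2 (B - C) (Z - C) > 0"
    and s: "C + s *\<^sub>R (B - C) \<in> convex hull {X, Y, Z}"
  shows "C + s *\<^sub>R (B - C) = X"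
proof -
  obtain u v w where uvw: "0 \<le> u" "0 \<le> v" "0 \<le> w" "u + v + w = 1"
    and p: "C + s *\<^sub>R (B - C) = u *\<^sub>R X + v *\<^sub>R Y + w *\<^sub>R Z"
    using s by (auto simp: convex_hull_3)
  have "cross2 (B - C) (C + s *\<^sub>R (B - C) - C) = 0" by (simp add: cross2_def)
  then have "D * (u * cross2 (B - C) (X - C) + v * cross2 (B - C) (Y - C) + w * cross2 (B - C) (Z - C)) = 0"
    using cross2_hull_point[OF p uvw(4), of "B - C" C] by simp
  then have "u * (D * cross2 (B - C) (X - C)) + v * (D * cross2 (B - C) (Y - C)) + w * (D * cross2 (B - C) (Z - C)) = 0"
    by (simp add: algebra_simps)
  moreover have "0 \<le> u * (D * cross2 (B - C) (X - C))" "0 \<le> v * (D * cross2 (B - C) (Y - C))" "0 \<le> w * (D * cross2 (B - C) (Z - C))"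
    using uvw h by simp_all
  ultimately have "v * (D * cross2 (B - C) (Y - C)) = 0" "w * (D * cross2 (B - C) (Z - C)) = 0" by linarith+
  then have "v = 0" "w = 0" using h by auto
  then show ?thesis using p uvw by simp
qed

text \<open>The triangle lies on one side of the line \<open>BC\<close>, so the line meets it in a
  full side, in a single vertex or not at all. In the last claim a point other than \<open>C\<close>
  rules out the single vertex, and the side on the line must issue from
  \<open>X = C\<close>.\<close>

lemma edge_trace:
  fixes X Y Z B C :: point and D :: real
  defines "h \<equiv> \<lambda>x. D * cross2 (B - C) (x - C)"
    and "I \<equiv> {s. C + s *\<^sub>R (B - C) \<in> convex hull {X, Y, Z}}"
  assumes BC: "B \<noteq> C" and D: "D \<noteq> 0" and nc: "\<not> collinear {X, Y, Z}" and h: "h X \<ge> 0" "h Y \<ge> 0" "h Z \<ge> 0"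
  shows "I \<in> lmeasurable" "measure lebesgue I * dist B C \<in> {0, dist X Y, dist X Z, dist Y Z}"
    and "X = C \<Longrightarrow> s \<in> I \<Longrightarrow> s \<noteq> 0 \<Longrightarrow> measure lebesgue I * dist B C \<in> {dist X Y, dist X Z}"
proof -
  define J where "J X Y Z = {s. C + s *\<^sub>R (B - C) \<in> convex hull {X, Y, Z}}" for X Y Z
  have two: "J X Y Z \<in> lmeasurable \<and> measure lebesgue (J X Y Z) * dist B C = dist X Y"
    if z: "h X = 0" "h Y = 0" "h Z \<noteq> 0" for X Y Z
  proof -
    obtain x y where xy: "X = C + x *\<^sub>R (B - C)" "Y = C + y *\<^sub>R (B - C)"
      using z(1,2) on_line_iff[OF BC] D unfolding h_def by (metis mult_eq_0_iff)
    have J: "J X Y Z = closed_segment x y"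
      unfolding J_def by (rule trace_two[OF BC _ xy]) (use z in \<open>auto simp: h_def\<close>)
    have "measure lebesgue (J X Y Z) = \<bar>x - y\<bar>" unfolding J closed_segment_eq_real_ivl by auto
    moreover have "X - Y = (x - y) *\<^sub>R (B - C)" unfolding xy by (simp add: algebra_simps)
    then have "dist X Y = \<bar>x - y\<bar> * dist B C" by (simp add: dist_norm)
    ultimately show ?thesis by (simp add: J lmeasurable_compact compact_segment)
  qed
  have one: "J X Y Z \<subseteq> {s. C + s *\<^sub>R (B - C) = X} \<and> J X Y Z \<in> lmeasurable \<and> measure lebesgue (J X Y Z) = 0"
    if "h X \<ge> 0" "h Y > 0" "h Z > 0" for X Y Z
  proof -
    have s: "J X Y Z \<subseteq> {s. C + s *\<^sub>R (B - C) = X}"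
      using trace_one[of D B C X Y Z] that unfolding J_def h_def by blast
    moreover have "finite {s. C + s *\<^sub>R (B - C) = X}"
    proof (rule finite_subset)
      show "{s. C + s *\<^sub>R (B - C) = X} \<subseteq> {((X - C) \<bullet> (B - C)) / ((B - C) \<bullet> (B - C))}" using BC by auto
    qed simp
    ultimately have "negligible (J X Y Z)" by (meson negligible_finite finite_subset)
    then show ?thesis using s by (simp add: negligible_imp_measurable negligible_imp_measure0)
  qed
  have nz: "h X \<noteq> 0 \<or> h Y \<noteq> 0 \<or> h Z \<noteq> 0"
  proof (rule ccontr)
    assume "\<not> ?thesis"
    then obtain x y z where xyz: "X = C + x *\<^sub>R (B - C)" "Y = C + y *\<^sub>R (B - C)" "Z = C + z *\<^sub>R (B - C)"
      using on_line_iff[OF BC] D unfolding h_def by (metis mult_eq_0_iff)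
    have "cross2 (Y - X) (Z - X) = 0" unfolding xyz by (simp add: cross2_def algebra_simps)
    then show False using nc by (simp add: collinear_iff_cross2)
  qed
  have p: "J X Z Y = I" "J Y Z X = I" "J Y X Z = I" "J Z X Y = I" "J X Y Z = I"
    unfolding J_def I_def by (simp_all add: insert_commute)
  have hC: "h C = 0" by (simp add: h_def cross2_def)
  consider "h X = 0" "h Y = 0" "h Z \<noteq> 0" | "h X = 0" "h Z = 0" "h Y \<noteq> 0" | "h Y = 0" "h Z = 0" "h X \<noteq> 0"
    | "h Y > 0" "h Z > 0" | "h X > 0" "h Z > 0" | "h X > 0" "h Y > 0"
    using h nz by linarith
  then have "I \<in> lmeasurable \<and> measure lebesgue I * dist B C \<in> {0, dist X Y, dist X Z, dist Y Z} \<and>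
    (X = C \<longrightarrow> s \<in> I \<longrightarrow> s \<noteq> 0 \<longrightarrow> measure lebesgue I * dist B C \<in> {dist X Y, dist X Z})"
  proof cases
    case 1 then show ?thesis using two[of X Y Z] by (simp add: p)
  next
    case 2 then show ?thesis using two[of X Z Y] by (simp add: p)
  next
    case 3 then show ?thesis using two[of Y Z X] hC by (auto simp: p)
  next
    case 4 then show ?thesis using one[of X Y Z] h BC by (auto simp: p)
  next
    case 5 then show ?thesis using one[of Y X Z] h hC by (auto simp: p)
  next
    case 6 then show ?thesis using one[of Z X Y] h hC by (auto simp: p)
  qed
  then show "I \<in> lmeasurable" "measure lebesgue I * dist B C \<in> {0, dist X Y, dist X Z, dist Y Z}"
    "X = C \<Longrightarrow> s \<in> I \<Longrightarrow> s \<noteq> 0 \<Longrightarrow> measure lebesgue I * dist B C \<in> {dist X Y, dist X Z}" by blast+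
qed

lemma dirs_imp_mem:
  assumes "\<not> collinear {A, B, C}" "\<phi> \<in> dirs (convex hull {A, B, C}) v"
  shows "v \<in> convex hull {A, B, C}"
proof -
  have *: "v \<in> convex hull {A, B, C}" if o: "cross2 (B - A) (C - A) > 0" "\<phi> \<in> dirs (convex hull {A, B, C}) v" for B C
    using that(2) unfolding dirs_triangle_iff[OF o(1)] in_triangle_iff[OF o(1)] admissible_def by linarith
  from assms(1) show ?thesis
  proof (cases rule: triangle_orient)
    case 1 then show ?thesis by (rule *) (rule assms)
  next
    case 2
    have "convex hull {A, C, B} = convex hull {A, B, C}" by (simp add: insert_commute)
    then show ?thesis using *[OF 2] assms(2) by simp
  qed
qed

context labelled_tiling begin

lemma BC: "B \<noteq> C"
  using nc by auto

text \<open>Its sign tells on which side of \<open>BC\<close> the triangle lies; multiplying heights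
  by it makes them nonnegative for either orientation.\<close>

definition D where "D = cross2 (B - C) (A - C)"

lemma D: "D \<noteq> 0"
  using nc unfolding D_def collinear_iff_cross2 by (auto simp: cross2_def algebra_simps)

lemma height_nonneg:
  assumes "x \<in> \<Union>P" shows "D * cross2 (B - C) (x - C) \<ge> 0"
proof -
  obtain u v w where uvw: "0 \<le> u" "0 \<le> v" "0 \<le> w" "u + v + w = 1"
    and p: "x = u *\<^sub>R A + v *\<^sub>R B + w *\<^sub>R C"
    using assms unfolding cover by (auto simp: convex_hull_3)
  have "cross2 (B - C) (B - C) = 0" "cross2 (B - C) (C - C) = 0" by (simp_all add: cross2_def)
  then have "cross2 (B - C) (x - C) = u * D" using cross2_hull_point[OF p uvw(4)] by (simp add: D_def)
  then have "D * cross2 (B - C) (x - C) = u * D\<^sup>2" by (simp add: power2_eq_square)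
  then show ?thesis using uvw by simp
qed

definition trace where "trace t = {s. C + s *\<^sub>R (B - C) \<in> t}"

lemma trace_T: "trace (\<Union>P) = {0..1}"
proof -
  have "trace (\<Union>P) = {s. C + s *\<^sub>R (B - C) \<in> convex hull {C, B, A}}"
    unfolding trace_def cover by (simp add: insert_commute)
  also have "\<dots> = closed_segment 0 1"
    by (rule trace_two[OF BC]) (use D D_def in auto)
  finally show ?thesis by (simp add: closed_segment_eq_real_ivl)
qed

lemma trace_tile:
  assumes "t \<in> P"
  shows "trace t \<in> lmeasurable"
    "measure lebesgue (trace t) * dist B C \<in> {0, dist (va t) (vb t), dist (va t) (vc t), dist (vb t) (vc t)}"
    "va t = C \<Longrightarrow> s \<in> trace t \<Longrightarrow> s \<noteq> 0 \<Longrightarrow>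
      measure lebesgue (trace t) * dist B C \<in> {dist (va t) (vb t), dist (va t) (vc t)}"
proof -
  have "va t \<in> \<Union>P" "vb t \<in> \<Union>P" "vc t \<in> \<Union>P"
    using hull[OF assms] hull_inc[of _ "{va t, vb t, vc t}" convex] assms by auto
  note h = this[THEN height_nonneg]
  have e: "trace t = {s. C + s *\<^sub>R (B - C) \<in> convex hull {va t, vb t, vc t}}"
    unfolding trace_def using hull[OF assms] by simp
  note E = edge_trace[OF BC D tile_noncollinear[OF assms] h, folded e]
  show "trace t \<in> lmeasurable" by (rule E(1))
  show "measure lebesgue (trace t) * dist B C \<in> {0, dist (va t) (vb t), dist (va t) (vc t), dist (vb t) (vc t)}"
    by (rule E(2))
  show "va t = C \<Longrightarrow> s \<in> trace t \<Longrightarrow> s \<noteq> 0 \<Longrightarrow>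
      measure lebesgue (trace t) * dist B C \<in> {dist (va t) (vb t), dist (va t) (vc t)}"
    by (rule E(3))
qed

text \<open>Apart from finitely many vertices, a point of \<open>BC\<close> in two tiles would
  collect an angle of at least \<open>2 * pi\<close>, whereas the large triangle has only
  \<open>pi\<close> there.\<close>

lemma trace_overlap:
  assumes "s \<in> P" "t \<in> P" "s \<noteq> t"
  shows "negligible (trace s \<inter> trace t)"
proof -
  have "trace s \<inter> trace t \<subseteq> (\<lambda>x. C + x *\<^sub>R (B - C)) -` V"
  proof
    fix x assume x: "x \<in> trace s \<inter> trace t"
    define v where "v = C + x *\<^sub>R (B - C)"
    have vs: "v \<in> s" "v \<in> t" using x by (auto simp: trace_def v_def)
    have "v \<in> V"
    proof (rule ccontr)
      assume nV: "v \<notin> V"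
      have big: "ang t v \<ge> pi" if "t \<in> P" "v \<in> t" for t
      proof -
        have "v \<notin> {va t, vb t, vc t}" using nV that by (auto simp: V_def)
        then have "ang t v \<in> {pi, 2 * pi}"
          using ang_triangle_other[OF tile_noncollinear[OF that(1)], folded hull[OF that(1)]] that by simp
        then show ?thesis by auto
      qed
      have pos: "ang u v \<ge> 0" for u by (simp add: ang_def)
      have "2 * pi \<le> ang s v + ang t v" using big[OF assms(1) vs(1)] big[OF assms(2) vs(2)] by simp
      also have "\<dots> = (\<Sum>u\<in>{s, t}. ang u v)" using assms by simp
      also have "\<dots> \<le> (\<Sum>u\<in>P. ang u v)" by (rule sum_mono2) (use fin assms pos in auto)
      also have "\<dots> = ang (\<Union>P) v" by (rule ang_sum[OF fin tile_is_triangle disj, symmetric])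
      also have "\<dots> = pi"
      proof -
        have p: "convex hull {C, B, A} = \<Union>P" unfolding cover by (simp add: insert_commute)
        have "ang (convex hull {C, B, A}) v = pi"
        proof (rule ang_triangle_edge)
          show "\<not> collinear {C, B, A}" using nc by (simp add: insert_commute)
          show "v \<in> convex hull {C, B, A}" unfolding p using vs assms by auto
          show "cross2 (B - C) (v - C) = 0" by (simp add: v_def cross2_def)
          show "v \<noteq> C" "v \<noteq> B" using nV by (auto simp: V_def)
        qed
        then show ?thesis by (simp add: p)
      qed
      finally show False by simp
    qed
    then show "x \<in> (\<lambda>x. C + x *\<^sub>R (B - C)) -` V" by (simp add: v_def)
  qed
  moreover have "finite ((\<lambda>x. C + x *\<^sub>R (B - C)) -` V)"
  proof (rule finite_vimageI)
    show "finite V" using fin by (simp add: V_def)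
    show "inj (\<lambda>x. C + x *\<^sub>R (B - C))" using BC by (auto simp: inj_def)
  qed
  ultimately show ?thesis by (meson negligible_finite finite_subset)
qed

lemma side_sum: "dist B C = (\<Sum>t\<in>P. measure lebesgue (trace t) * dist B C)"
proof -
  have "measure lebesgue (\<Union>(trace ` P)) = (\<Sum>t\<in>P. measure lebesgue (trace t))"
    by (rule measure_negligible_finite_Union_image[OF fin trace_tile(1)])
      (use trace_overlap in \<open>auto simp: pairwise_def\<close>)
  moreover have "\<Union>(trace ` P) = {0..1}" using trace_T by (auto simp: trace_def)
  ultimately have "(\<Sum>t\<in>P. measure lebesgue (trace t)) = 1" by simp
  then show ?thesis by (simp flip: sum_distrib_right)
qed

text \<open>The direction from \<open>C\<close> to \<open>B\<close> is in \<open>dirs\<close> of the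
  union, hence of some tile. That tile contains an initial piece of the side, not merely
  \<open>C\<close>.\<close>

lemma tile_on_side:
  obtains t s where "t \<in> P" "C \<in> t" "s \<in> trace t" "s \<noteq> 0"
proof -
  have "B - C \<noteq> 0" using BC by simp
  then obtain \<phi> where \<phi>: "B - C = norm (B - C) *\<^sub>R dir \<phi>" using polar by metis
  have n: "norm (B - C) > 0" using BC by simp
  have e: "C + r *\<^sub>R dir \<phi> = C + (r / norm (B - C)) *\<^sub>R (B - C)" for r
    by (subst (2) \<phi>) (use n in simp)
  have "\<phi> \<in> dirs (\<Union>P) C"
  proof -
    have "\<forall>\<^sub>F r in at_right 0. r < norm (B - C)" using n eventually_at_right_field by blast
    moreover have "\<forall>\<^sub>F r in at_right (0::real). r > 0" by (rule eventually_at_right_less)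
    ultimately have "\<forall>\<^sub>F r in at_right 0. C + r *\<^sub>R dir \<phi> \<in> \<Union>P"
    proof eventually_elim
      case (elim r)
      then have "r / norm (B - C) \<in> trace (\<Union>P)" unfolding trace_T using n by simp
      then show ?case unfolding e trace_def by simp
    qed
    then show ?thesis by (simp add: dirs_def)
  qed
  then obtain t where t: "t \<in> P" "\<phi> \<in> dirs t C" using dirs_Union[OF fin tile_is_triangle] by blast
  have "C \<in> t" using dirs_imp_mem[OF tile_noncollinear[OF t(1)], folded hull[OF t(1)]] t(2) by blast
  moreover have "\<forall>\<^sub>F r in at_right 0. C + r *\<^sub>R dir \<phi> \<in> t \<and> r > 0"
    using t(2) eventually_at_right_less[of "0::real"] by (simp add: dirs_def eventually_conj_iff)
  then obtain r where "C + r *\<^sub>R dir \<phi> \<in> t" "r > 0"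
    using eventually_happens'[OF trivial_limit_at_right_real] by blast
  then have "r / norm (B - C) \<in> trace t" "r / norm (B - C) \<noteq> 0" using n unfolding e trace_def by auto
  ultimately show thesis using that t by blast
qed

text \<open>Scaled by \<open>lam\<close>, the part of \<open>BC\<close> in a tile has length 0 or
  that of a side of the large triangle. The tile lying along \<open>BC\<close> at \<open>C\<close>
  has its vertex \<open>va\<close> there, so it contributes one of the two sides adjacent to
  \<open>\<alpha>\<close>.\<close>

lemma side_decomposition:
  assumes "cnt_b C = 0" "cnt_c C = 0"
  obtains x y z :: nat where "y + z \<ge> 1"
    "lam * dist B C = x * dist B C + y * dist A C + z * dist A B"
proof -
  define f where "f t = lam * (measure lebesgue (trace t) * dist B C)" for t
  have E: "f t \<in> {0, dist B C, dist A C, dist A B}" if "t \<in> P" for t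
    using trace_tile(2)[OF that] dists[OF that] unfolding f_def by fastforce
  obtain t0 s0 where t0: "t0 \<in> P" "C \<in> t0" "s0 \<in> trace t0" "s0 \<noteq> 0" using tile_on_side .
  have "vb t0 \<noteq> C" "vc t0 \<noteq> C" using assms t0(1) fin by (auto simp: cnt_b_def cnt_c_def)
  then have "va t0 = C" using corner_equation(2)[of C t0] t0 by auto
  then have f0: "f t0 \<in> {dist A C, dist A B}"
    using trace_tile(3)[OF t0(1) _ t0(3,4)] dists[OF t0(1)] unfolding f_def by auto
  \<comment> \<open>Coinciding lengths are attributed to \<open>y\<close> first, then to
    \<open>z\<close>, and only then to \<open>x\<close>; thus the tile at \<open>C\<close> counts in
    \<open>y + z\<close> even if \<open>dist B C\<close> equals another side.\<close>
  define x where "x t = (if f t \<in> {dist A C, dist A B, 0} then 0 else 1 :: nat)" for t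
  define y where "y t = (if f t = dist A C then 1 else 0 :: nat)" for t
  define z where "z t = (if f t = dist A B \<and> f t \<noteq> dist A C then 1 else 0 :: nat)" for t
  have pos: "dist A C \<noteq> 0" "dist A B \<noteq> 0" using nc by (auto simp: insert_commute)
  have fe: "f t = x t * dist B C + y t * dist A C + z t * dist A B" if "t \<in> P" for t
    using E[OF that] pos by (auto simp: x_def y_def z_def)
  have "lam * dist B C = (\<Sum>t\<in>P. f t)"
    unfolding f_def by (subst side_sum) (simp only: sum_distrib_left)
  also have "\<dots> = (\<Sum>t\<in>P. x t * dist B C + y t * dist A C + z t * dist A B)"
    using fe by (rule sum.cong[OF refl])
  also have "\<dots> = real (sum x P) * dist B C + real (sum y P) * dist A C + real (sum z P) * dist A B"
    by (simp add: sum.distrib sum_distrib_right)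
  finally have "lam * dist B C = real (sum x P) * dist B C + real (sum y P) * dist A C + real (sum z P) * dist A B" .
  moreover have "sum y P + sum z P \<ge> 1"
  proof -
    have "1 \<le> y t0 + z t0" using f0 by (auto simp: y_def z_def)
    also have "\<dots> \<le> (\<Sum>t\<in>P. y t + z t)" using fin t0(1) by (intro member_le_sum) auto
    finally show ?thesis by (simp add: sum.distrib)
  qed
  ultimately show thesis using that by blast
qed

end

section \<open>The two exceptional angles\<close>

definition ipoly :: "int poly \<Rightarrow> real \<Rightarrow> real" where
  "ipoly p t = poly (map_poly real_of_int p) t"

lemma ipoly_0 [simp]: "ipoly 0 t = 0"
  by (simp add: ipoly_def)

lemma ipoly_pCons [simp]: "ipoly (pCons a p) t = real_of_int a + t * ipoly p t"
  by (simp add: ipoly_def map_poly_pCons)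

lemma ipoly_add: "ipoly (p + q) t = ipoly p t + ipoly q t"
proof (induction p arbitrary: q)
  case (pCons a p)
  obtain b r where "q = pCons b r" by (rule pCons_cases)
  then show ?case using pCons(2)[of r] by (simp add: algebra_simps)
qed simp

lemma ipoly_smult: "ipoly (smult c p) t = c * ipoly p t"
  by (induction p) (auto simp: algebra_simps)

lemma ipoly_mult: "ipoly (p * q) t = ipoly p t * ipoly q t"
  by (induction p) (simp_all add: ipoly_add ipoly_smult algebra_simps)

text \<open>Let \<open>h\<close> be a nonzero integer polynomial of least degree with root
  \<open>t\<close>. Pseudo-division shows that \<open>h\<close> divides a constant multiple of
  \<open>f\<close>. As \<open>f\<close> is prime, it divides \<open>h\<close> or the cofactor, and
  the latter would make \<open>h\<close> constant.\<close>

lemma irreducible_root_degree: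
  assumes irr: "irreducible f" and f: "ipoly f t = 0" and g: "g \<noteq> 0" "ipoly g t = 0"
  shows "degree f \<le> degree g"
proof -
  define Q where "Q n \<longleftrightarrow> (\<exists>g. g \<noteq> 0 \<and> ipoly g t = 0 \<and> degree g = n)" for n
  have "Q (degree g)" using g by (auto simp: Q_def)
  then have Q: "Q (LEAST n. Q n)" and le: "(LEAST n. Q n) \<le> degree g"
    by (rule LeastI, rule Least_le)
  obtain h where h: "h \<noteq> 0" "ipoly h t = 0" "degree h = (LEAST n. Q n)" using Q by (auto simp: Q_def)
  have min: "degree h \<le> degree p" if "p \<noteq> 0" "ipoly p t = 0" for p
    unfolding h(3) by (rule Least_le) (use that in \<open>auto simp: Q_def\<close>)
  have "degree f \<le> degree h"
  proof (rule ccontr)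
    assume n: "\<not> ?thesis"
    define r where "r = pseudo_mod f h"
    obtain a q where aq: "a \<noteq> 0" "smult a f = h * q + r"
      using pseudo_mod(1)[OF h(1), of f] by (auto simp: r_def)
    have "ipoly r t = 0"
      using arg_cong[OF aq(2), of "\<lambda>p. ipoly p t"] f h by (simp add: ipoly_add ipoly_smult ipoly_mult)
    then have "r = 0" using pseudo_mod(2)[OF h(1), of f] min[of r] by (fastforce simp: r_def)
    then have e: "smult a f = h * q" using aq by simp
    have "prime_elem f" using irr by (simp add: prime_elem_iff_irreducible)
    moreover have "f dvd h * q" by (metis e dvd_refl dvd_smult)
    ultimately have "f dvd h \<or> f dvd q" by (simp add: prime_elem_dvd_mult_iff)
    then show False
    proof
      assume "f dvd h" then show False using n h(1) dvd_imp_degree_le by blast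
    next
      assume "f dvd q"
      then obtain s where "q = f * s" by (rule dvdE)
      then have "f * [:a:] = f * (h * s)" using e by (simp add: ac_simps)
      moreover have "f \<noteq> 0" using irr by auto
      ultimately have a: "[:a:] = h * s" by (simp only: mult_cancel_left) simp
      then have "s \<noteq> 0" using aq(1) by auto
      then have "degree h + degree s = 0" using arg_cong[OF a, of degree] h(1) by (simp add: degree_mult_eq)
      then obtain c where "h = [:c:]" by (metis add_is_0 degree_eq_zeroE)
      then show False using h by simp
    qed
  qed
  then show ?thesis using le h(3) by simp
qed

lemma degree_le_SucE:
  assumes "degree p \<le> Suc n"
  obtains a q where "p = pCons a q" "degree q \<le> n"
proof -
  obtain a q where p: "p = pCons a q" by (rule pCons_cases)
  then have "degree q \<le> n" using assms by (cases "q = 0") auto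
  then show ?thesis using that p by blast
qed

text \<open>The leading coefficients of the factors of a monic polynomial are units, so constant
  factors are units as well; by symmetry the factor of smaller degree may come first.\<close>

lemma monic_irreducibleI:
  fixes f :: "int poly"
  assumes monic: "lead_coeff f = 1" and deg: "degree f > 0"
    and no: "\<And>g h. f = g * h \<Longrightarrow> 0 < degree g \<Longrightarrow> degree g \<le> degree h \<Longrightarrow> degree g + degree h = degree f \<Longrightarrow> False"
  shows "irreducible f"
proof (rule irreducibleI)
  show "f \<noteq> 0" using deg by auto
  show "\<not> f dvd 1" using deg by (auto simp: is_unit_poly_iff)
  fix g h assume gh: "f = g * h"
  then have nz: "g \<noteq> 0" "h \<noteq> 0" using deg by auto
  then have d: "degree g + degree h = degree f" by (simp add: gh degree_mult_eq)
  have l: "lead_coeff g * lead_coeff h = 1" using monic by (simp add: gh lead_coeff_mult)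
  have unit: "p dvd 1" if u: "degree p = 0" "lead_coeff p * c = 1" for p :: "int poly" and c
  proof -
    obtain x where "p = [:x:]" using u(1) by (metis degree_eq_zeroE)
    moreover have "x dvd 1" using u(2) calculation by (metis coeff_pCons_0 degree_pCons_0 dvd_triv_left)
    ultimately show ?thesis by (simp add: is_unit_const_poly_iff)
  qed
  show "g dvd 1 \<or> h dvd 1"
  proof (cases "degree g = 0 \<or> degree h = 0")
    case True then show ?thesis using unit[of g "lead_coeff h"] unit[of h "lead_coeff g"] l by (auto simp: mult.commute)
  next
    case False
    then show ?thesis using no[of g h] no[of h g] gh d by (metis add.commute gr0I linear mult.commute)
  qed
qed

text \<open>The minimal polynomials of \<open>2 cos (2\<pi>/13)\<close> and \<open>2 cos (2\<pi>/15)\<close>; both are irreducible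
  already modulo \<open>2\<close>.\<close>

definition minpoly13 :: "int poly" where "minpoly13 = [:-1, 3, 6, -4, -5, 1, 1:]"
definition minpoly15 :: "int poly" where "minpoly15 = [:1, 4, -4, -1, 1:]"

lemma irreducible_minpoly15: "irreducible minpoly15"
proof (rule monic_irreducibleI)
  show "lead_coeff minpoly15 = 1" "degree minpoly15 > 0" by (simp_all add: minpoly15_def)
  fix g h assume gh: "minpoly15 = g * h" and d: "0 < degree g" "degree g \<le> degree h" "degree g + degree h = degree minpoly15"
  have "degree minpoly15 = 4" by (simp add: minpoly15_def)
  then consider "degree g \<le> Suc 0" "degree h \<le> Suc (Suc (Suc 0))" | "degree g \<le> Suc (Suc 0)" "degree h \<le> Suc (Suc 0)"
    using d by linarith
  then show False
  proof cases
    case 1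
    obtain a0 a1 b0 b1 b2 b3 where "g = [:a0, a1:]" "h = [:b0, b1, b2, b3:]"
      using 1 by (metis degree_le_SucE degree_eq_zeroE le_0_eq)
    from gh[unfolded minpoly15_def this] have e: "1 = a0 * b0" "4 = a0 * b1 + a1 * b0" "-4 = a0 * b2 + a1 * b1"
      "-1 = a0 * b3 + a1 * b2" "1 = a1 * b3" by (simp_all add: algebra_simps)
    \<comment> \<open>Reduction modulo 2 turns the coefficient equations into a propositional
      contradiction.\<close>
    from e[THEN arg_cong[where f = even]] show False by (simp; argo)
  next
    case 2
    obtain a0 a1 a2 b0 b1 b2 where "g = [:a0, a1, a2:]" "h = [:b0, b1, b2:]"
      using 2 by (metis degree_le_SucE degree_eq_zeroE le_0_eq)
    from gh[unfolded minpoly15_def this] have e: "1 = a0 * b0" "4 = a0 * b1 + a1 * b0" "-4 = a0 * b2 + a1 * b1 + a2 * b0"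
      "-1 = a1 * b2 + a2 * b1" "1 = a2 * b2" by (simp_all add: algebra_simps)
    from e[THEN arg_cong[where f = even]] show False by (simp; argo)
  qed
qed

lemma irreducible_minpoly13: "irreducible minpoly13"
proof (rule monic_irreducibleI)
  show "lead_coeff minpoly13 = 1" "degree minpoly13 > 0" by (simp_all add: minpoly13_def)
  fix g h assume gh: "minpoly13 = g * h" and d: "0 < degree g" "degree g \<le> degree h" "degree g + degree h = degree minpoly13"
  have "degree minpoly13 = 6" by (simp add: minpoly13_def)
  then consider "degree g \<le> Suc 0" "degree h \<le> Suc (Suc (Suc (Suc (Suc 0))))"
    | "degree g \<le> Suc (Suc 0)" "degree h \<le> Suc (Suc (Suc (Suc 0)))"
    | "degree g \<le> Suc (Suc (Suc 0))" "degree h \<le> Suc (Suc (Suc 0))"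
    using d by linarith
  then show False
  proof cases
    case 1
    obtain a0 a1 b0 b1 b2 b3 b4 b5 where "g = [:a0, a1:]" "h = [:b0, b1, b2, b3, b4, b5:]"
      using 1 by (metis degree_le_SucE degree_eq_zeroE le_0_eq)
    from gh[unfolded minpoly13_def this] have e: "-1 = a0 * b0" "3 = a0 * b1 + a1 * b0" "6 = a0 * b2 + a1 * b1"
      "-4 = a0 * b3 + a1 * b2" "-5 = a0 * b4 + a1 * b3" "1 = a0 * b5 + a1 * b4" "1 = a1 * b5" by (simp_all add: algebra_simps)
    from e[THEN arg_cong[where f = even]] show False by (simp; argo)
  next
    case 2
    obtain a0 a1 a2 b0 b1 b2 b3 b4 where "g = [:a0, a1, a2:]" "h = [:b0, b1, b2, b3, b4:]"
      using 2 by (metis degree_le_SucE degree_eq_zeroE le_0_eq)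
    from gh[unfolded minpoly13_def this] have e: "-1 = a0 * b0" "3 = a0 * b1 + a1 * b0" "6 = a0 * b2 + a1 * b1 + a2 * b0"
      "-4 = a0 * b3 + a1 * b2 + a2 * b1" "-5 = a0 * b4 + a1 * b3 + a2 * b2" "1 = a1 * b4 + a2 * b3" "1 = a2 * b4"
      by (simp_all add: algebra_simps)
    from e[THEN arg_cong[where f = even]] show False by (simp; argo)
  next
    case 3
    obtain a0 a1 a2 a3 b0 b1 b2 b3 where "g = [:a0, a1, a2, a3:]" "h = [:b0, b1, b2, b3:]"
      using 3 by (metis degree_le_SucE degree_eq_zeroE le_0_eq)
    from gh[unfolded minpoly13_def this] have e: "-1 = a0 * b0" "3 = a0 * b1 + a1 * b0" "6 = a0 * b2 + a1 * b1 + a2 * b0"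
      "-4 = a0 * b3 + a1 * b2 + a2 * b1 + a3 * b0" "-5 = a1 * b3 + a2 * b2 + a3 * b1" "1 = a2 * b3 + a3 * b2" "1 = a3 * b3"
      by (simp_all add: algebra_simps)
    from e[THEN arg_cong[where f = even]] show False by (simp; argo)
  qed
qed

text \<open>With \<open>t = 2 cos \<alpha>\<close>, the side ratios of the triangle with \<open>\<beta> = \<pi> - 4\<alpha>\<close>, \<open>\<gamma> = 3\<alpha>\<close> are \<open>t^3 - 2t\<close> and
  \<open>t^2 - 1\<close>.\<close>

lemma no_relation_13:
  fixes x y z N :: nat and t :: real
  assumes t: "ipoly minpoly13 t = 0" and e: "(real x + real y * (t^3 - 2*t) + real z * (t^2 - 1))\<^sup>2 = N"
  shows "y = 0 \<and> z = 0"
proof -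
  define X Y Z :: int where "X = int x - int z" and "Y = int y" and "Z = int z"
  define F :: "int poly" where "F = [:X, -2*Y, Z, Y:] * [:X, -2*Y, Z, Y:] - [:int N:]"
  have G: "ipoly [:X, -2*Y, Z, Y:] t = real x + real y * (t^3 - 2*t) + real z * (t^2 - 1)"
    by (simp add: X_def Y_def Z_def algebra_simps power2_eq_square power3_eq_cube)
  have "F + [:int N:] = [:X, -2*Y, Z, Y:] * [:X, -2*Y, Z, Y:]" by (simp add: F_def)
  from arg_cong[OF this, of "\<lambda>p. ipoly p t"] have F: "ipoly F t = 0"
    unfolding ipoly_add ipoly_mult G using e by (simp add: power2_eq_square)
  \<comment> \<open>\<open>F\<close> has degree at most 6 and \<open>Y^2\<close> as coefficient of
    \<open>t^6\<close>, so this subtraction brings the degree below 6 and the remainder must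
    vanish.\<close>
  define R where "R = F - smult (Y\<^sup>2) minpoly13"
  have "R + smult (Y\<^sup>2) minpoly13 = F" by (simp add: R_def)
  from arg_cong[OF this, of "\<lambda>p. ipoly p t"] have "ipoly R t = 0"
    unfolding ipoly_add ipoly_smult F t by simp
  moreover have "degree R \<le> 5"
    unfolding R_def F_def minpoly13_def by (simp add: power2_eq_square)
  moreover have "degree minpoly13 = 6" by (simp add: minpoly13_def)
  ultimately have "R = 0" using irreducible_root_degree[OF irreducible_minpoly13 t, of R] by linarith
  then have c: "coeff R 5 = 0" "coeff R 4 = 0" by simp_all
  then have "2 * Y * Z = Y\<^sup>2" "Z\<^sup>2 - 4 * Y\<^sup>2 = - 5 * Y\<^sup>2"
    unfolding R_def F_def minpoly13_def by (simp_all add: power2_eq_square eval_nat_numeral algebra_simps)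
  then have "Y\<^sup>2 + Z\<^sup>2 = 0" by simp
  then show ?thesis by (simp add: Y_def Z_def)
qed

text \<open>The remainder modulo the quartic minimal polynomial vanishes. With
  \<open>X = x - z\<close> its cubic coefficient is \<open>2xy + 4yz + z^2 + y^2\<close>, a sum of
  nonnegative terms because \<open>x\<close>, \<open>y\<close>, \<open>z\<close> are counts.\<close>

lemma no_relation_15:
  fixes x y z N :: nat and t :: real
  assumes t: "ipoly minpoly15 t = 0" and e: "(real x + real y * (t^3 - 2*t) + real z * (t^2 - 1))\<^sup>2 = N"
  shows "y = 0 \<and> z = 0"
proof -
  define X Y Z :: int where "X = int x - int z" and "Y = int y" and "Z = int z"
  define F :: "int poly" where "F = [:X, -2*Y, Z, Y:] * [:X, -2*Y, Z, Y:] - [:int N:]"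
  have G: "ipoly [:X, -2*Y, Z, Y:] t = real x + real y * (t^3 - 2*t) + real z * (t^2 - 1)"
    by (simp add: X_def Y_def Z_def algebra_simps power2_eq_square power3_eq_cube)
  have "F + [:int N:] = [:X, -2*Y, Z, Y:] * [:X, -2*Y, Z, Y:]" by (simp add: F_def)
  from arg_cong[OF this, of "\<lambda>p. ipoly p t"] have F: "ipoly F t = 0"
    unfolding ipoly_add ipoly_mult G using e by (simp add: power2_eq_square)
  \<comment> \<open>The quotient of \<open>F\<close> by \<open>minpoly15\<close>, from long
    division.\<close>
  define q where "q = [:Z\<^sup>2 + 2 * Y * Z + Y\<^sup>2, 2 * Y * Z + Y\<^sup>2, Y\<^sup>2:]"
  define R where "R = F - q * minpoly15"
  have "R + q * minpoly15 = F" by (simp add: R_def)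
  from arg_cong[OF this, of "\<lambda>p. ipoly p t"] have "ipoly R t = 0"
    unfolding ipoly_add ipoly_mult F t by simp
  moreover have "degree R \<le> 3"
    unfolding R_def F_def q_def minpoly15_def by (simp add: power2_eq_square algebra_simps)
  moreover have "degree minpoly15 = 4" by (simp add: minpoly15_def)
  ultimately have "R = 0" using irreducible_root_degree[OF irreducible_minpoly15 t, of R] by linarith
  then have c: "coeff R 3 = 0" by simp
  then have "2 * X * Y + 6 * Y * Z + Z\<^sup>2 + Y\<^sup>2 = 0"
    unfolding R_def F_def q_def minpoly15_def by (simp add: power2_eq_square eval_nat_numeral algebra_simps)
  moreover have "2 * X * Y = 2 * int x * int y - 2 * Y * Z" by (simp add: X_def Y_def Z_def algebra_simps)
  ultimately have "2 * int x * int y + 4 * int y * int z + (int z)\<^sup>2 + (int y)\<^sup>2 = 0" by (simp add: Y_def Z_def)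
  moreover have "0 \<le> 2 * int x * int y" "0 \<le> 4 * int y * int z" "0 \<le> (int z)\<^sup>2" "0 \<le> (int y)\<^sup>2" by simp_all
  ultimately have "(int z)\<^sup>2 = 0" "(int y)\<^sup>2 = 0" by linarith+
  then show ?thesis by simp
qed

text \<open>Rescaled Chebyshev polynomials of the second kind, from
  \<open>sin (n a) = t sin ((n - 1) a) - sin ((n - 2) a)\<close>.\<close>

lemma sin_multiples:
  fixes a :: real
  defines "t \<equiv> 2 * cos a"
  shows "sin (2 * a) = sin a * t" "sin (3 * a) = sin a * (t^2 - 1)" "sin (4 * a) = sin a * (t^3 - 2 * t)"
    "sin (6 * a) = sin a * (t^5 - 4 * t^3 + 3 * t)" "sin (7 * a) = sin a * (t^6 - 5 * t^4 + 6 * t^2 - 1)"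
    "sin (8 * a) = sin a * (t^7 - 6 * t^5 + 10 * t^3 - 4 * t)"
proof -
  have add: "sin (b + a) = t * sin b - sin (b - a)" for b by (simp add: t_def sin_add sin_diff)
  have step: "sin (n * a) = t * sin ((n - 1) * a) - sin ((n - 2) * a)" for n
    using add[of "(n - 1) * a"] by (simp add: algebra_simps)
  show 2: "sin (2 * a) = sin a * t" by (simp add: sin_double t_def)
  show 3: "sin (3 * a) = sin a * (t^2 - 1)"
    using step[of 3] 2 by (simp add: algebra_simps power2_eq_square)
  show 4: "sin (4 * a) = sin a * (t^3 - 2 * t)"
    using step[of 4, simplified] unfolding 2 3 by (simp add: algebra_simps eval_nat_numeral)
  have 5: "sin (5 * a) = sin a * (t^4 - 3 * t^2 + 1)"
    using step[of 5, simplified] unfolding 3 4 by (simp add: algebra_simps eval_nat_numeral)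
  show 6: "sin (6 * a) = sin a * (t^5 - 4 * t^3 + 3 * t)"
    using step[of 6, simplified] unfolding 4 5 by (simp add: algebra_simps eval_nat_numeral)
  show 7: "sin (7 * a) = sin a * (t^6 - 5 * t^4 + 6 * t^2 - 1)"
    using step[of 7, simplified] unfolding 5 6 by (simp add: algebra_simps eval_nat_numeral)
  show "sin (8 * a) = sin a * (t^7 - 6 * t^5 + 10 * t^3 - 4 * t)"
    using step[of 8, simplified] unfolding 6 7 by (simp add: algebra_simps eval_nat_numeral)
qed

text \<open>\<open>13 a = 2\<pi>\<close> gives \<open>sin (7 a) = - sin (6 a)\<close>; dividing by
  \<open>sin a\<close> leaves the minimal polynomial.\<close>

lemma root_minpoly13:
  assumes "13 * a = 2 * pi" shows "ipoly minpoly13 (2 * cos a) = 0"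
proof -
  define t where "t = 2 * cos a"
  have e: "7 * a = 2 * pi - 6 * a" using assms by simp
  have "sin (7 * a) + sin (6 * a) = 0" unfolding e by (simp add: sin_diff)
  then have "sin a * (t^6 + t^5 - 5*t^4 - 4*t^3 + 6*t^2 + 3*t - 1) = 0"
    unfolding sin_multiples t_def[symmetric] by (simp add: algebra_simps)
  moreover have "sin a > 0" using assms by (intro sin_gt_zero) (use pi_gt_zero in linarith)+
  ultimately have "t^6 + t^5 - 5*t^4 - 4*t^3 + 6*t^2 + 3*t - 1 = 0" by simp
  then show ?thesis by (simp add: minpoly13_def flip: t_def) (simp add: algebra_simps eval_nat_numeral)
qed

text \<open>Since 15 is composite, \<open>sin (8 a) + sin (7 a)\<close> has the extra factors
  \<open>t + 1\<close> and \<open>t^2 + t - 1\<close>, belonging to the third and the fifth of a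
  full turn. They do not vanish because \<open>t > 1\<close>.\<close>

lemma root_minpoly15:
  assumes "15 * a = 2 * pi" shows "ipoly minpoly15 (2 * cos a) = 0"
proof -
  define t where "t = 2 * cos a"
  have e: "8 * a = 2 * pi - 7 * a" using assms by simp
  have "sin (8 * a) + sin (7 * a) = 0" unfolding e by (simp add: sin_diff)
  then have "sin a * ((t + 1) * (t^2 + t - 1) * (t^4 - t^3 - 4*t^2 + 4*t + 1)) = 0"
    unfolding sin_multiples t_def[symmetric] by (simp add: algebra_simps eval_nat_numeral)
  moreover have "sin a > 0" using assms by (intro sin_gt_zero) (use pi_gt_zero in linarith)+
  moreover have "t > 1"
  proof -
    have "cos (pi / 3) < cos a" using assms pi_gt_zero by (intro cos_monotone_0_pi) linarith+
    then show ?thesis by (simp add: t_def cos_60)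
  qed
  then have "t + 1 > 0" "t^2 + t - 1 > 0" using zero_le_power2[of t] by (linarith, smt (verit))
  ultimately have "t^4 - t^3 - 4*t^2 + 4*t + 1 = 0" by simp
  then show ?thesis by (simp add: minpoly15_def flip: t_def) (simp add: algebra_simps eval_nat_numeral)
qed

context labelled_tiling begin

lemma no_split:
  assumes k3: "k \<ge> 3" and C: "cnt_a C = k" "cnt_b C = 0" "cnt_c C = 0"
  shows False
proof -
  have k: "k = 3" and a: "13 * \<alpha> = 2 * pi \<or> 15 * \<alpha> = 2 * pi" using no_weight[OF assms] by auto
  have \<gamma>: "\<gamma> = 3 * \<alpha>" using corner_equation(1)[of C] C k ang_T by simp
  then have \<beta>: "\<beta> = pi - 4 * \<alpha>" using angles by simp
  obtain x y z :: nat where yz: "y + z \<ge> 1"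
    and e: "lam * dist B C = x * dist B C + y * dist A C + z * dist A B"
    using side_decomposition[OF C(2,3)] .
  define t where "t = 2 * cos \<alpha>"
  have s: "sin \<alpha> > 0" using angles by (intro sin_gt_zero) auto
  have BC0: "dist B C > 0" using BC by simp
  have "dist A C * sin \<alpha> = dist B C * (sin \<alpha> * (t^3 - 2 * t))"
    using triangle_trig(5)[OF nc] \<beta> unfolding t_def sin_multiples[symmetric] by simp
  then have b: "dist A C = dist B C * (t^3 - 2 * t)" using s by simp
  have "dist A B * sin \<alpha> = dist B C * (sin \<alpha> * (t^2 - 1))"
    using triangle_trig(6)[OF nc] \<gamma> unfolding t_def sin_multiples[symmetric] by simp
  then have c: "dist A B = dist B C * (t^2 - 1)" using s by simp
  have "dist B C * lam = dist B C * (real x + real y * (t^3 - 2*t) + real z * (t^2 - 1))"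
    using e unfolding b c by (simp add: algebra_simps)
  then have "lam = real x + real y * (t^3 - 2*t) + real z * (t^2 - 1)" using BC0 by (simp only: mult_cancel_left) simp
  then have r: "(real x + real y * (t^3 - 2*t) + real z * (t^2 - 1))\<^sup>2 = card P" using lam(2) by simp
  from a have "y = 0 \<and> z = 0"
  proof
    assume "13 * \<alpha> = 2 * pi"
    from no_relation_13[OF root_minpoly13[OF this] r[unfolded t_def]] show ?thesis .
  next
    assume "15 * \<alpha> = 2 * pi"
    from no_relation_15[OF root_minpoly15[OF this] r[unfolded t_def]] show ?thesis .
  qed
  then show False using yz by simp
qed

end

section \<open>Reptilings have at most two tiles at a vertex\<close>

lemma similarity_measure:
  assumes f: "similarity c f" "f ` t = T" and T: "is_triangle T"
  shows "measure lebesgue T = c\<^sup>2 * measure lebesgue t"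
proof -
  have c: "c > 0" using f(1) by (simp add: similarity_def)
  obtain A B C where ABC: "T = convex hull {A, B, C}" using T unfolding is_triangle_def by blast
  obtain A' B' C' where t: "t = convex hull {A', B', C'}"
    and d: "dist A B = c * dist A' B'" "dist A C = c * dist A' C'" "dist B C = c * dist B' C'"
    using similarity_preimage_triangle[OF f(1) f(2)[unfolded ABC]] by metis
  show ?thesis unfolding ABC t measure_triangle scaled_triangle(1)[OF c d] by simp
qed

lemma measure_triangle_pos: "is_triangle t \<Longrightarrow> measure lebesgue t > 0"
  unfolding is_triangle_def by (auto simp: measure_triangle collinear_iff_cross2)

text \<open>Congruent tiles have equal areas, so comparing areas makes every similarity from a tile
  onto the triangle have ratio \<open>sqrt (card P)\<close>.\<close>

lemma reptiling_labelled:
  assumes nc: "\<not> collinear {A, B, C}" and ac: "acute A B C" and rep: "reptiling (convex hull {A, B, C}) P"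
  obtains lam va vb vc where "labelled_tiling A B C P lam va vb vc"
proof -
  obtain r where "r \<ge> 2" and r: "r_reptiling r (convex hull {A, B, C}) P" using rep by (auto simp: reptiling_def)
  then have cardP: "card P \<ge> 2" and cover: "\<Union>P = convex hull {A, B, C}"
    and tri: "\<And>t. t \<in> P \<Longrightarrow> is_triangle t"
    and disj: "\<And>s t. s \<in> P \<Longrightarrow> t \<in> P \<Longrightarrow> s \<noteq> t \<Longrightarrow> interior s \<inter> interior t = {}"
    and sim: "\<And>t. t \<in> P \<Longrightarrow> similar t (convex hull {A, B, C})"
    and cong: "\<And>s t. s \<in> P \<Longrightarrow> t \<in> P \<Longrightarrow> congruent_sets s t"
    by (auto simp: r_reptiling_def)
  have fin: "finite P" using cardP by (metis card.infinite not_numeral_le_zero)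
  define T where "T = convex hull {A, B, C}"
  have T: "is_triangle T" using nc unfolding is_triangle_def T_def by blast
  define lam where "lam = sqrt (card P)"
  have lam: "lam > 0" "lam\<^sup>2 = card P" using cardP by (simp_all add: lam_def)
  have same: "measure lebesgue t = measure lebesgue s" if st: "s \<in> P" "t \<in> P" for s t
  proof -
    obtain f where f: "\<forall>x y. dist (f x) (f y) = dist x y" "f ` s = t"
      using cong[OF st] by (auto simp: congruent_sets_def)
    then have "similarity 1 f" by (simp add: similarity_def)
    from similarity_measure[OF this f(2) tri[OF st(2)]] show ?thesis by simp
  qed
  have "\<exists>a b c. t = convex hull {a, b, c} \<and> dist A B = lam * dist a b \<and> dist A C = lam * dist a c \<and> dist B C = lam * dist b c"
    if t: "t \<in> P" for t
  proof -
    obtain c f where f: "similarity c f" "f ` t = T"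
      using sim[OF t] by (auto simp: similar_def similarity_def T_def)
    have c: "c > 0" using f(1) by (simp add: similarity_def)
    have "c\<^sup>2 * measure lebesgue t = measure lebesgue T" using similarity_measure[OF f T] by simp
    also have "\<dots> = (\<Sum>s\<in>P. measure lebesgue s)"
      unfolding T_def cover[symmetric] by (rule measure_Union_tiles[OF fin tri disj])
    also have "\<dots> = (\<Sum>s\<in>P. measure lebesgue t)" by (rule sum.cong[OF refl]) (rule same[OF t])
    also have "\<dots> = card P * measure lebesgue t" by simp
    finally have "c\<^sup>2 = card P" using measure_triangle_pos[OF tri[OF t]] by simp
    then have "c = lam" using c by (simp add: lam_def real_sqrt_unique)
    then show ?thesis using similarity_preimage_triangle[OF f(1) f(2)[unfolded T_def]] by metis
  qed
  then obtain va vb vc where "\<And>t. t \<in> P \<Longrightarrow> t = convex hull {va t, vb t, vc t} \<and> dist A B = lam * dist (va t) (vb t) \<and>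
      dist A C = lam * dist (va t) (vc t) \<and> dist B C = lam * dist (vb t) (vc t)" by metis
  then have "labelled_tiling A B C P lam va vb vc"
    using nc ac fin cover disj lam by unfold_locales blast+
  then show thesis by (rule that)
qed

context labelled_tiling begin

lemma swapped: "labelled_tiling B A C P lam vb va vc"
proof
  show "\<not> collinear {B, A, C}" using nc by (simp add: insert_commute)
  show "acute B A C" using ac by (auto simp: acute_def angle_commute)
  show "\<Union>P = convex hull {B, A, C}" by (simp add: cover insert_commute)
  show "t = convex hull {vb t, va t, vc t}" if "t \<in> P" for t using hull[OF that] by (simp add: insert_commute)
  show "dist B A = lam * dist (vb t) (va t)" if "t \<in> P" for t using dists(1)[OF that] by (simp add: dist_commute)
qed (use fin disj lam dists in auto)

text \<open>A \<open>\<gamma>\<close> at \<open>C\<close> leaves no room for another tile, and one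
  \<open>\<alpha>\<close> with one \<open>\<beta>\<close> already exceeds \<open>\<gamma>\<close>.
  There remains a split into \<open>\<alpha>\<close>s only, or into \<open>\<beta>\<close>s only
  after exchanging \<open>A\<close> and \<open>B\<close>.\<close>

lemma tiles_at_C: "card {t \<in> P. C \<in> t} \<le> 2"
proof (rule ccontr)
  assume "\<not> ?thesis"
  then have k3: "cnt_a C + cnt_b C + cnt_c C \<ge> 3" using card_at_corner[of C] by simp
  have eq: "cnt_a C * \<alpha> + cnt_b C * \<beta> + cnt_c C * \<gamma> = \<gamma>" using corner_equation(1)[of C] ang_T by simp
  have ge: "x \<le> real n * x" if "n > 0" "x > 0" for n and x :: real
    using mult_right_mono[of 1 "real n" x] that by simp
  have pos: "0 \<le> cnt_a C * \<alpha>" "0 \<le> cnt_b C * \<beta>" "0 \<le> cnt_c C * \<gamma>" using angles by auto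
  have c0: "cnt_c C = 0"
  proof (rule ccontr)
    assume "cnt_c C \<noteq> 0"
    then have l: "\<gamma> \<le> cnt_c C * \<gamma>" using ge[of "cnt_c C" \<gamma>] angles by simp
    then have "cnt_a C * \<alpha> = 0" "cnt_b C * \<beta> = 0" "cnt_c C * \<gamma> = \<gamma>" using eq pos by linarith+
    then have "cnt_a C = 0" "cnt_b C = 0" "cnt_c C = 1" using angles by auto
    then show False using k3 by simp
  qed
  have "cnt_a C = 0 \<or> cnt_b C = 0"
  proof (rule ccontr)
    assume "\<not> ?thesis"
    then have "\<alpha> \<le> cnt_a C * \<alpha>" "\<beta> \<le> cnt_b C * \<beta>" using ge[of "cnt_a C" \<alpha>] ge[of "cnt_b C" \<beta>] angles by simp_all
    then show False using eq pos angles by linarith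
  qed
  then show False
  proof
    assume a0: "cnt_a C = 0"
    interpret sw: labelled_tiling B A C P lam vb va vc by (rule swapped)
    have "sw.cnt_a C = cnt_b C" "sw.cnt_b C = cnt_a C" "sw.cnt_c C = cnt_c C"
      by (simp_all add: sw.cnt_a_def sw.cnt_b_def sw.cnt_c_def cnt_a_def cnt_b_def cnt_c_def)
    then show False using sw.no_split[of "cnt_b C"] a0 c0 k3 by simp
  next
    assume "cnt_b C = 0"
    then show False using no_split[of "cnt_a C"] c0 k3 by simp
  qed
qed

text \<open>Every tile at \<open>A\<close> takes up at least \<open>\<alpha>\<close>, which is the
  whole angle there.\<close>

lemma tiles_at_smallest_angle:
  assumes "\<alpha> \<le> \<beta>" "\<alpha> \<le> \<gamma>" shows "card {t \<in> P. A \<in> t} = 1"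
proof -
  have eq: "cnt_a A * \<alpha> + cnt_b A * \<beta> + cnt_c A * \<gamma> = \<alpha>" using corner_equation(1)[of A] ang_T by simp
  have "real (cnt_a A + cnt_b A + cnt_c A) * \<alpha> = cnt_a A * \<alpha> + cnt_b A * \<alpha> + cnt_c A * \<alpha>" by (simp add: algebra_simps)
  also have "\<dots> \<le> cnt_a A * \<alpha> + cnt_b A * \<beta> + cnt_c A * \<gamma>"
    using assms by (intro add_mono mult_left_mono) auto
  finally have "real (cnt_a A + cnt_b A + cnt_c A) * \<alpha> \<le> 1 * \<alpha>" using eq by simp
  then have "real (cnt_a A + cnt_b A + cnt_c A) \<le> real 1" using angles by (simp only: mult_le_cancel_right_pos of_nat_1)
  then have "cnt_a A + cnt_b A + cnt_c A \<le> 1" by (simp only: of_nat_le_iff)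
  moreover have "cnt_a A + cnt_b A + cnt_c A \<noteq> 0"
  proof
    assume "cnt_a A + cnt_b A + cnt_c A = 0"
    then have "cnt_a A = 0" "cnt_b A = 0" "cnt_c A = 0" by auto
    then show False using eq angles(2) by simp
  qed
  moreover have "card {t \<in> P. A \<in> t} = cnt_a A + cnt_b A + cnt_c A" by (rule card_at_corner) simp
  ultimately show ?thesis by linarith
qed

end

lemma tiles_at_vertex_le_2:
  assumes "\<not> collinear {A, B, C}" "acute A B C" "reptiling (convex hull {A, B, C}) P" "v \<in> {A, B, C}"
  shows "card {t \<in> P. v \<in> t} \<le> 2"
proof -
  have *: "card {t \<in> P. Z \<in> t} \<le> 2"
    if "\<not> collinear {X, Y, Z}" "acute X Y Z" "reptiling (convex hull {X, Y, Z}) P" for X Y Z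
    using reptiling_labelled[OF that] labelled_tiling.tiles_at_C by metis
  have p: "{B, C, A} = {A, B, C}" "{A, C, B} = {A, B, C}" by auto
  have "acute B C A" "acute A C B" using assms(2) by (auto simp: acute_def angle_commute)
  then show ?thesis
    using assms(4) *[of B C A, unfolded p] *[of A C B, unfolded p] *[of A B C] assms(1-3) by auto
qed

text \<open>The affine map between the triangles scales all lengths by \<open>c\<close>, because it
  multiplies the Gram matrix of the edge vectors by \<open>c^2\<close>.\<close>

lemma similarity_exists:
  assumes nc: "\<not> collinear {A, B, C}" and c: "c > 0"
    and d: "dist A' B' = c * dist A B" "dist A' C' = c * dist A C" "dist B' C' = c * dist B C"
  obtains f where "similarity c f" "f ` (convex hull {A, B, C}) = convex hull {A', B', C'}"
proof -
  define u v u' v' where "u = B - A" and "v = C - A" and "u' = B' - A'" and "v' = C' - A'"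
  \<comment> \<open>Cramer's rule: the linear map taking \<open>u\<close> to \<open>u'\<close> and
    \<open>v\<close> to \<open>v'\<close>.\<close>
  define L where "L w = (cross2 w v / cross2 u v) *\<^sub>R u' + (cross2 u w / cross2 u v) *\<^sub>R v'" for w
  define f where "f x = A' + L (x - A)" for x
  have uv: "cross2 u v \<noteq> 0" using nc by (simp add: u_def v_def collinear_iff_cross2)
  have nu: "u' \<bullet> u' = c\<^sup>2 * (u \<bullet> u)" and nv: "v' \<bullet> v' = c\<^sup>2 * (v \<bullet> v)"
    using d by (simp_all add: u_def v_def u'_def v'_def dist_norm norm_minus_commute power_mult_distrib flip: power2_norm_eq_inner)
  have ni: "u' \<bullet> v' = c\<^sup>2 * (u \<bullet> v)"
  proof -
    have "2 * (u' \<bullet> v') = c\<^sup>2 * (2 * (u \<bullet> v))"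
      unfolding u_def v_def u'_def v'_def inner_dist d by (simp add: power_mult_distrib algebra_simps)
    then show ?thesis by simp
  qed
  have L: "norm (L w) = c * norm w" for w
  proof -
    define s t where "s = cross2 w v / cross2 u v" and "t = cross2 u w / cross2 u v"
    have e: "cross2 u v *\<^sub>R w = cross2 w v *\<^sub>R u + cross2 u w *\<^sub>R v" by (simp add: point_eq_iff cross2_def algebra_simps)
    have "w = (1 / cross2 u v) *\<^sub>R (cross2 u v *\<^sub>R w)" using uv by simp
    then have w: "w = s *\<^sub>R u + t *\<^sub>R v" unfolding e by (simp add: s_def t_def scaleR_add_right)
    have ww: "w \<bullet> w = s * s * (u \<bullet> u) + 2 * s * t * (u \<bullet> v) + t * t * (v \<bullet> v)"
      unfolding arg_cong2[OF w w, of inner] by (simp add: inner_add_left inner_add_right inner_commute algebra_simps)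
    have "(norm (L w))\<^sup>2 = s * s * (u' \<bullet> u') + 2 * s * t * (u' \<bullet> v') + t * t * (v' \<bullet> v')"
      unfolding L_def s_def[symmetric] t_def[symmetric] power2_norm_eq_inner
      by (simp add: inner_add_left inner_add_right inner_commute algebra_simps)
    also have "\<dots> = c\<^sup>2 * (norm w)\<^sup>2"
      unfolding nu nv ni power2_norm_eq_inner ww by (simp add: algebra_simps)
    finally have "(norm (L w))\<^sup>2 = (c * norm w)\<^sup>2" by (simp add: power_mult_distrib)
    then show ?thesis using c by simp
  qed
  have "similarity c f"
    unfolding similarity_def
  proof (intro conjI allI c)
    fix x y
    have "f x - f y = L (x - y)"
      by (simp add: f_def L_def cross2_def algebra_simps diff_divide_distrib add_divide_distrib)
    then show "dist (f x) (f y) = c * dist x y" by (simp add: dist_norm L)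
  qed
  moreover have "f A = A'" "f B = B'" "f C = C'"
    using uv unfolding f_def L_def by (simp_all add: u'_def v'_def flip: u_def v_def) (simp_all add: cross2_def)
  ultimately show thesis using that similarity_hull[of c f "{A, B, C}"] by auto
qed

section \<open>Lattice tilings\<close>

definition is_copy :: "real \<Rightarrow> real \<Rightarrow> real \<Rightarrow> point set \<Rightarrow> bool" where
  "is_copy a b c t \<longleftrightarrow> (\<exists>X Y Z. \<not> collinear {X, Y, Z} \<and> t = convex hull {X, Y, Z} \<and>
     dist X Y = c \<and> dist X Z = b \<and> dist Y Z = a)"

definition tiled_by :: "real \<Rightarrow> real \<Rightarrow> real \<Rightarrow> point set \<Rightarrow> point set set \<Rightarrow> bool" where
  "tiled_by a b c S P \<longleftrightarrow> finite P \<and> \<Union>P = S \<and> (\<forall>t\<in>P. is_copy a b c t) \<and>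
     (\<forall>s\<in>P. \<forall>t\<in>P. s \<noteq> t \<longrightarrow> interior s \<inter> interior t = {})"

definition tileable :: "real \<Rightarrow> real \<Rightarrow> real \<Rightarrow> point set \<Rightarrow> bool" where
  "tileable a b c S \<longleftrightarrow> (\<exists>P. tiled_by a b c S P)"

lemma is_copy_triangle: "is_copy a b c t \<Longrightarrow> is_triangle t"
  unfolding is_copy_def is_triangle_def by blast

lemma interior_Int_empty:
  assumes "s \<subseteq> S" "t \<subseteq> (T::point set)" "negligible (S \<inter> T)"
  shows "interior s \<inter> interior t = {}"
proof (rule ccontr)
  assume "\<not> ?thesis"
  then have "\<not> negligible (interior s \<inter> interior t)" by (intro open_not_negligible) auto
  moreover have "interior s \<inter> interior t \<subseteq> S \<inter> T" using assms interior_subset by blast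
  ultimately show False using assms(3) negligible_subset by blast
qed

lemma tiled_by_Un:
  assumes "tiled_by a b c S P" "tiled_by a b c T Q" "negligible (S \<inter> T)"
  shows "tiled_by a b c (S \<union> T) (P \<union> Q)"
proof -
  have "interior s \<inter> interior t = {}" if "s \<in> P" "t \<in> Q" for s t
    by (rule interior_Int_empty[OF _ _ assms(3)]) (use that assms(1,2) in \<open>auto simp: tiled_by_def\<close>)
  then have "\<forall>s\<in>P \<union> Q. \<forall>t\<in>P \<union> Q. s \<noteq> t \<longrightarrow> interior s \<inter> interior t = {}"
    using assms(1,2) unfolding tiled_by_def by blast
  then show ?thesis using assms(1,2) unfolding tiled_by_def by (auto 4 4)
qed

lemma tileable_Un:
  "tileable a b c S \<Longrightarrow> tileable a b c T \<Longrightarrow> negligible (S \<inter> T) \<Longrightarrow> tileable a b c (S \<union> T)"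
  unfolding tileable_def using tiled_by_Un by blast

lemma tileable_copy: "is_copy a b c t \<Longrightarrow> tileable a b c t"
  unfolding tileable_def tiled_by_def by (intro exI[of _ "{t}"]) simp

text \<open>Regions are given by predicates on affine coordinates, so that unions, shifts and
  overlaps become linear arithmetic.\<close>

definition reg :: "point \<Rightarrow> point \<Rightarrow> point \<Rightarrow> (real \<Rightarrow> real \<Rightarrow> bool) \<Rightarrow> point set" where
  "reg p u v K = {p + s *\<^sub>R u + t *\<^sub>R v | s t. K s t}"

lemma reg_Un: "reg p u v (\<lambda>s t. K s t \<or> L s t) = reg p u v K \<union> reg p u v L"
  by (auto simp: reg_def)

lemma reg_coords_unique:
  assumes "cross2 u v \<noteq> 0" "p + s *\<^sub>R u + t *\<^sub>R v = p + s' *\<^sub>R u + t' *\<^sub>R v"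
  shows "s = s'" "t = t'"
proof -
  have "cross2 (p + s *\<^sub>R u + t *\<^sub>R v - p) v = s * cross2 u v" "cross2 u (p + s *\<^sub>R u + t *\<^sub>R v - p) = t * cross2 u v" for s t
    by (simp_all add: cross2_def algebra_simps)
  from this(1)[of s t] this(2)[of s t] this(1)[of s' t'] this(2)[of s' t']
  show "s = s'" "t = t'" using assms by auto
qed

lemma negligible_reg_Int:
  assumes uv: "cross2 u v \<noteq> 0" and line: "\<And>s t. K s t \<Longrightarrow> L s t \<Longrightarrow> a * s + b * t = c" and ab: "a \<noteq> 0 \<or> b \<noteq> 0"
  shows "negligible (reg p u v K \<inter> reg p u v L)"
proof -
  \<comment> \<open>A normal vector of the line in the plane:
    \<open>n \<bullet> u = a * cross2 u v\<close> and
    \<open>n \<bullet> v = b * cross2 u v\<close>.\<close>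
  define n :: point where "n = vector [a * v$2 - b * u$2, b * u$1 - a * v$1]"
  have n0: "n \<noteq> 0"
  proof
    assume "n = 0"
    then have "a * v$2 = b * u$2" "b * u$1 = a * v$1" by (auto simp: n_def point_eq_iff)
    then have "a * cross2 u v = 0" "b * cross2 u v = 0" unfolding cross2_def by algebra+
    then show False using uv ab by simp
  qed
  have "reg p u v K \<inter> reg p u v L \<subseteq> {x. n \<bullet> x = n \<bullet> p + c * cross2 u v}"
  proof
    fix x assume "x \<in> reg p u v K \<inter> reg p u v L"
    then obtain s t s' t' where x: "x = p + s *\<^sub>R u + t *\<^sub>R v" "x = p + s' *\<^sub>R u + t' *\<^sub>R v" and K: "K s t" and L: "L s' t'"
      unfolding reg_def by blast
    then have "s = s'" "t = t'" using reg_coords_unique[OF uv] by metis+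
    then have c: "c = a * s + b * t" using line K L by simp
    show "x \<in> {x. n \<bullet> x = n \<bullet> p + c * cross2 u v}"
      unfolding x(1) c by (simp add: n_def inner_point cross2_def algebra_simps)
  qed
  moreover have "negligible {x. n \<bullet> x = n \<bullet> p + c * cross2 u v}" using n0 by (intro negligible_hyperplane) simp
  ultimately show ?thesis by (rule negligible_subset[rotated])
qed

lemma tileable_reg_Un:
  assumes "cross2 u v \<noteq> 0" "tileable x y z (reg p u v K)" "tileable x y z (reg p u v L)"
    and "\<And>s t. K s t \<Longrightarrow> L s t \<Longrightarrow> a * s + b * t = c" "a \<noteq> 0 \<or> b \<noteq> 0"
    and M: "\<And>s t. M s t \<longleftrightarrow> K s t \<or> L s t"
  shows "tileable x y z (reg p u v M)"
  unfolding M reg_Un by (rule tileable_Un[OF assms(2,3) negligible_reg_Int]) (use assms in auto)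

lemma reg_shift: "reg (p + i *\<^sub>R u + j *\<^sub>R v) u v K = reg p u v (\<lambda>s t. K (s - i) (t - j))"
proof (intro set_eqI iffI)
  fix x assume "x \<in> reg (p + i *\<^sub>R u + j *\<^sub>R v) u v K"
  then obtain s t where "x = p + i *\<^sub>R u + j *\<^sub>R v + s *\<^sub>R u + t *\<^sub>R v" "K s t" by (auto simp: reg_def)
  then show "x \<in> reg p u v (\<lambda>s t. K (s - i) (t - j))"
    unfolding reg_def by (intro CollectI exI[of _ "s + i"] exI[of _ "t + j"]) (simp add: algebra_simps)
next
  fix x assume "x \<in> reg p u v (\<lambda>s t. K (s - i) (t - j))"
  then obtain s t where "x = p + s *\<^sub>R u + t *\<^sub>R v" "K (s - i) (t - j)" by (auto simp: reg_def)
  then show "x \<in> reg (p + i *\<^sub>R u + j *\<^sub>R v) u v K"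
    unfolding reg_def by (intro CollectI exI[of _ "s - i"] exI[of _ "t - j"]) (simp add: algebra_simps)
qed

text \<open>Reflection in the centre of a cell, which exchanges its two tiles.\<close>

lemma reg_flip: "reg (p + u + v) (- u) (- v) K = reg p u v (\<lambda>s t. K (1 - s) (1 - t))"
proof (intro set_eqI iffI)
  fix x assume "x \<in> reg (p + u + v) (- u) (- v) K"
  then obtain s t where "x = p + u + v + s *\<^sub>R (- u) + t *\<^sub>R (- v)" "K s t" by (auto simp: reg_def)
  then show "x \<in> reg p u v (\<lambda>s t. K (1 - s) (1 - t))"
    unfolding reg_def by (intro CollectI exI[of _ "1 - s"] exI[of _ "1 - t"]) (simp add: algebra_simps)
next
  fix x assume "x \<in> reg p u v (\<lambda>s t. K (1 - s) (1 - t))"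
  then obtain s t where "x = p + s *\<^sub>R u + t *\<^sub>R v" "K (1 - s) (1 - t)" by (auto simp: reg_def)
  then show "x \<in> reg (p + u + v) (- u) (- v) K"
    unfolding reg_def by (intro CollectI exI[of _ "1 - s"] exI[of _ "1 - t"]) (simp add: algebra_simps)
qed

lemma reg_triangle:
  assumes n: "n > 0"
  shows "reg p u v (\<lambda>s t. 0 \<le> s \<and> 0 \<le> t \<and> s + t \<le> n) = convex hull {p, p + n *\<^sub>R u, p + n *\<^sub>R v}"
proof (intro set_eqI iffI)
  fix x assume "x \<in> reg p u v (\<lambda>s t. 0 \<le> s \<and> 0 \<le> t \<and> s + t \<le> n)"
  then obtain s t where st: "x = p + s *\<^sub>R u + t *\<^sub>R v" "0 \<le> s" "0 \<le> t" "s + t \<le> n" by (auto simp: reg_def)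
  have "x = (1 - s / n - t / n) *\<^sub>R p + (s / n) *\<^sub>R (p + n *\<^sub>R u) + (t / n) *\<^sub>R (p + n *\<^sub>R v)"
    using n unfolding st(1) by (simp add: algebra_simps)
  moreover have "(s + t) / n \<le> 1" using st n by simp
  then have "0 \<le> 1 - s / n - t / n" "0 \<le> s / n" "0 \<le> t / n" using st n by (simp_all add: add_divide_distrib)
  ultimately show "x \<in> convex hull {p, p + n *\<^sub>R u, p + n *\<^sub>R v}"
    unfolding convex_hull_3 mem_Collect_eq
    by (intro exI[of _ "1 - s / n - t / n"] exI[of _ "s / n"] exI[of _ "t / n"]) simp
next
  fix x assume "x \<in> convex hull {p, p + n *\<^sub>R u, p + n *\<^sub>R v}"
  then obtain a b c where abc: "0 \<le> a" "0 \<le> b" "0 \<le> c" "a + b + c = 1"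
    and x: "x = a *\<^sub>R p + b *\<^sub>R (p + n *\<^sub>R u) + c *\<^sub>R (p + n *\<^sub>R v)" by (auto simp: convex_hull_3)
  have a: "a = 1 - b - c" using abc by simp
  have "x = p + (b * n) *\<^sub>R u + (c * n) *\<^sub>R v" unfolding x a by (simp add: algebra_simps)
  moreover have "b * n + c * n \<le> n"
  proof -
    have "(b + c) * n \<le> 1 * n" using abc n by (intro mult_right_mono) auto
    then show ?thesis by (simp add: algebra_simps)
  qed
  moreover have "0 \<le> b * n" "0 \<le> c * n" using abc n by simp_all
  ultimately show "x \<in> reg p u v (\<lambda>s t. 0 \<le> s \<and> 0 \<le> t \<and> s + t \<le> n)"
    unfolding reg_def by (intro CollectI exI[of _ "b * n"] exI[of _ "c * n"]) simp
qed

text \<open>A cell spanned by \<open>u\<close> and \<open>v\<close> is cut by the diagonal from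
  \<open>u\<close> to \<open>v\<close> into a tile and its point reflection.\<close>

locale lattice =
  fixes u v :: point and a b c :: real
  assumes indep: "cross2 u v \<noteq> 0" and sides: "norm u = c" "norm v = b" "norm (u - v) = a"
begin

lemma up: "tileable a b c (reg p u v (\<lambda>s t. 0 \<le> s \<and> 0 \<le> t \<and> s + t \<le> 1))"
proof -
  have "is_copy a b c (convex hull {p, p + u, p + v})"
    unfolding is_copy_def
    by (intro exI[of _ p] exI[of _ "p + u"] exI[of _ "p + v"])
      (use indep sides in \<open>simp add: collinear_iff_cross2 dist_norm\<close>)
  then show ?thesis using reg_triangle[of 1 p u v] by (simp add: tileable_copy)
qed

lemma down: "tileable a b c (reg p u v (\<lambda>s t. s \<le> 1 \<and> t \<le> 1 \<and> 1 \<le> s + t))"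
proof -
  interpret flip: lattice "- u" "- v" a b c
    by unfold_locales (use indep sides in \<open>simp_all add: cross2_def norm_minus_commute\<close>)
  have "(\<lambda>s t :: real. 0 \<le> 1 - s \<and> 0 \<le> 1 - t \<and> (1 - s) + (1 - t) \<le> 1) = (\<lambda>s t. s \<le> 1 \<and> t \<le> 1 \<and> 1 \<le> s + t)"
    by (intro ext) linarith
  then show ?thesis using flip.up[of "p + u + v"] unfolding reg_flip by simp
qed

lemma cell: "tileable a b c (reg p u v (\<lambda>s t. 0 \<le> s \<and> s \<le> 1 \<and> 0 \<le> t \<and> t \<le> 1))"
  by (rule tileable_reg_Un[OF indep up down, where a = 1 and b = 1 and c = 1]) auto

lemma row: "tileable a b c (reg p u v (\<lambda>s t. 0 \<le> s \<and> s \<le> real (Suc m) \<and> 0 \<le> t \<and> t \<le> 1))"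
proof (induction m)
  case 0 show ?case using cell by simp
next
  case (Suc m)
  have "tileable a b c (reg p u v (\<lambda>s t. 0 \<le> s - real (Suc m) \<and> s - real (Suc m) \<le> 1 \<and> 0 \<le> t - 0 \<and> t - 0 \<le> 1))"
    using cell[of "p + real (Suc m) *\<^sub>R u + 0 *\<^sub>R v"] unfolding reg_shift .
  then show ?case
    by (rule tileable_reg_Un[OF indep Suc, where a = 1 and b = 0 and c = "real (Suc m)"]) auto
qed

lemma parallelogram:
  "tileable a b c (reg p u v (\<lambda>s t. 0 \<le> s \<and> s \<le> real (Suc m) \<and> 0 \<le> t \<and> t \<le> real (Suc n)))"
proof (induction n)
  case 0 show ?case using row by simp
next
  case (Suc n)
  have "tileable a b c (reg p u v (\<lambda>s t. 0 \<le> s - 0 \<and> s - 0 \<le> real (Suc m) \<and> 0 \<le> t - real (Suc n) \<and> t - real (Suc n) \<le> 1))"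
    using row[of "p + 0 *\<^sub>R u + real (Suc n) *\<^sub>R v"] unfolding reg_shift .
  then show ?case
    by (rule tileable_reg_Un[OF indep Suc, where a = 0 and b = 1 and c = "real (Suc n)"]) auto
qed

text \<open>Induction by strips: the bottom strip is a row of cells with one more tile at its end,
  and on it sits the next smaller triangle, shifted by \<open>v\<close>.\<close>

lemma triangle: "tileable a b c (reg p u v (\<lambda>s t. 0 \<le> s \<and> 0 \<le> t \<and> s + t \<le> real (Suc n)))"
proof (induction n arbitrary: p)
  case 0 show ?case using up by simp
next
  case (Suc n)
  have "tileable a b c (reg p u v (\<lambda>s t. 0 \<le> s - real (Suc n) \<and> 0 \<le> t - 0 \<and> (s - real (Suc n)) + (t - 0) \<le> 1))"
    using up[of "p + real (Suc n) *\<^sub>R u + 0 *\<^sub>R v"] unfolding reg_shift .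
  then have strip: "tileable a b c (reg p u v (\<lambda>s t. 0 \<le> s \<and> 0 \<le> t \<and> t \<le> 1 \<and> s + t \<le> real (Suc (Suc n))))"
    by (rule tileable_reg_Un[OF indep row[of p n], where a = 1 and b = 0 and c = "real (Suc n)"]) auto
  have "tileable a b c (reg p u v (\<lambda>s t. 0 \<le> s - 0 \<and> 0 \<le> t - 1 \<and> (s - 0) + (t - 1) \<le> real (Suc n)))"
    using Suc[of "p + 0 *\<^sub>R u + 1 *\<^sub>R v"] unfolding reg_shift .
  then show ?case
    by (rule tileable_reg_Un[OF indep strip, where a = 0 and b = 1 and c = 1]) auto
qed

end

lemma tileable_triangle:
  assumes nc: "\<not> collinear {A, B, C}" and n: "n > 0"
    and d: "dist A B = real n * c" "dist A C = real n * b" "dist B C = real n * a"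
  shows "tileable a b c (convex hull {A, B, C})"
proof -
  define u v where "u = (1 / real n) *\<^sub>R (B - A)" and "v = (1 / real n) *\<^sub>R (C - A)"
  have e: "u - v = (1 / real n) *\<^sub>R (B - C)" by (simp add: u_def v_def algebra_simps)
  interpret lattice u v a b c
  proof
    show "cross2 u v \<noteq> 0" using nc n by (simp add: u_def v_def collinear_iff_cross2 cross2_def algebra_simps flip: add_divide_distrib diff_divide_distrib)
    show "norm u = c" "norm v = b" using d(1,2) n by (simp_all add: u_def v_def dist_norm norm_minus_commute)
    show "norm (u - v) = a" unfolding e using d(3) n by (simp add: dist_norm)
  qed
  have "A + real n *\<^sub>R u = B" "A + real n *\<^sub>R v = C" using n by (simp_all add: u_def v_def)
  then show ?thesis using triangle[of A "n - 1"] n reg_triangle[of "real n" A u v] by simp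
qed

section \<open>Dissecting the triangle with sides 4, 5, 6\<close>

text \<open>Coordinates in which the \<open>4:5:6\<close> triangle, the vectors \<open>(cos i\<alpha>, sin i\<alpha>)\<close> and hence
  all vertices of the dissection are rational, \<open>\<alpha>\<close> being its smallest angle.\<close>

definition pt :: "real \<Rightarrow> real \<Rightarrow> point" where
  "pt x y = vector [x, sqrt 7 * y]"

definition rg :: "(real \<Rightarrow> real \<Rightarrow> bool) \<Rightarrow> point set" where
  "rg K = {pt s t | s t. K s t}"

lemma pt_nth [simp]: "pt x y $ 1 = x" "pt x y $ 2 = sqrt 7 * y"
  by (simp_all add: pt_def)

lemma pt_diff: "pt x y - pt x' y' = pt (x - x') (y - y')"
  by (simp add: point_eq_iff algebra_simps)

lemma cross2_pt: "cross2 (pt x y) (pt x' y') = sqrt 7 * (x * y' - y * x')"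
  by (simp add: cross2_def algebra_simps)

lemma norm_pt: "norm (pt x y) = d" if "x\<^sup>2 + 7 * y\<^sup>2 = d\<^sup>2" "d \<ge> 0"
proof -
  have "(norm (pt x y))\<^sup>2 = x\<^sup>2 + 7 * y\<^sup>2"
    unfolding power2_norm_eq_inner inner_point by (simp add: power2_eq_square)
  then have "(norm (pt x y))\<^sup>2 = d\<^sup>2" using that(1) by (rule trans)
  then show ?thesis using norm_ge_zero that(2) by (rule power2_eq_imp_eq)
qed

lemma dist_pt: "dist (pt x y) (pt x' y') = d" if "(x - x')\<^sup>2 + 7 * (y - y')\<^sup>2 = d\<^sup>2" "d \<ge> 0"
  unfolding dist_norm pt_diff using that by (rule norm_pt)

lemma rg_reg: "rg K = reg 0 (pt 1 0) (pt 0 1) K"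
proof -
  have e: "0 + s *\<^sub>R pt 1 0 + t *\<^sub>R pt 0 1 = pt s t" for s t by (simp add: point_eq_iff)
  show ?thesis by (simp only: rg_def reg_def e)
qed

lemma rg_Un: "rg (\<lambda>s t. K s t \<or> L s t) = rg K \<union> rg L"
  by (auto simp: rg_def)

lemma pt_surj: "\<exists>s t. x = pt s t"
  by (intro exI[of _ "x$1"] exI[of _ "x$2 / sqrt 7"]) (simp add: point_eq_iff)

lemma pt_inject: "pt x y = pt x' y' \<longleftrightarrow> x = x' \<and> y = y'"
  by (simp add: point_eq_iff)

lemma pt_in_rg [simp]: "pt s t \<in> rg K \<longleftrightarrow> K s t"
  by (auto simp: rg_def pt_inject)

lemma tileable_rg_Un:
  assumes "tileable x y z (rg K)" "tileable x y z (rg L)"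
    and "\<And>s t. K s t \<Longrightarrow> L s t \<Longrightarrow> a * s + b * t = c" "a \<noteq> 0 \<or> b \<noteq> 0"
    and "\<And>s t. M s t \<longleftrightarrow> K s t \<or> L s t"
  shows "tileable x y z (rg M)"
  using assms unfolding rg_reg by (intro tileable_reg_Un[of "pt 1 0" "pt 0 1" x y z 0 K L a b c M]) (auto simp: cross2_pt)

lemma negligible_rg_Int:
  assumes "\<And>s t. K s t \<Longrightarrow> L s t \<Longrightarrow> a * s + b * t = c" "a \<noteq> 0 \<or> b \<noteq> 0"
  shows "negligible (rg K \<inter> rg L)"
  unfolding rg_reg by (rule negligible_reg_Int[OF _ assms]) (auto simp: cross2_pt)

lemma tileable_rg_Un':
  assumes "tileable x y z (rg K)" "tileable x y z (rg L)" "negligible (rg K \<inter> rg L)"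
    and M: "\<And>s t. M s t \<longleftrightarrow> K s t \<or> L s t"
  shows "tileable x y z (rg M)"
  unfolding M rg_Un by (rule tileable_Un) (use assms in auto)

text \<open>\<open>K\<close> is a free predicate so that the three edge inequalities can be supplied
  with common factors cancelled.\<close>

lemma hull_pt:
  assumes "(qx - px) * (ry - py) - (qy - py) * (rx - px) > 0"
    and K: "\<And>s t. K s t \<longleftrightarrow> 0 \<le> (qx - px) * (t - py) - (qy - py) * (s - px) \<and>
      0 \<le> (rx - qx) * (t - qy) - (ry - qy) * (s - qx) \<and> 0 \<le> (px - rx) * (t - ry) - (py - ry) * (s - rx)"
  shows "convex hull {pt px py, pt qx qy, pt rx ry} = rg K"
proof (intro set_eqI)
  fix x
  obtain s t where x: "x = pt s t" using pt_surj by blast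
  have o: "cross2 (pt qx qy - pt px py) (pt rx ry - pt px py) > 0"
    using assms(1) by (simp add: pt_diff cross2_pt)
  show "x \<in> convex hull {pt px py, pt qx qy, pt rx ry} \<longleftrightarrow> x \<in> rg K"
    unfolding x in_triangle_iff[OF o] pt_diff cross2_pt pt_in_rg K by (simp add: zero_le_mult_iff)
qed

lemma tileable_pt_triangle:
  assumes o: "(qx - px) * (ry - py) - (qy - py) * (rx - px) > 0"
    and n: "n > 0" and abc: "a \<ge> 0" "b \<ge> 0" "c \<ge> 0"
    and d: "(px - qx)\<^sup>2 + 7 * (py - qy)\<^sup>2 = (real n * c)\<^sup>2" "(px - rx)\<^sup>2 + 7 * (py - ry)\<^sup>2 = (real n * b)\<^sup>2"
      "(qx - rx)\<^sup>2 + 7 * (qy - ry)\<^sup>2 = (real n * a)\<^sup>2"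
    and K: "\<And>s t. K s t \<longleftrightarrow> 0 \<le> (qx - px) * (t - py) - (qy - py) * (s - px) \<and>
      0 \<le> (rx - qx) * (t - qy) - (ry - qy) * (s - qx) \<and> 0 \<le> (px - rx) * (t - ry) - (py - ry) * (s - rx)"
  shows "tileable a b c (rg K)"
  unfolding hull_pt[OF o K, symmetric]
  by (rule tileable_triangle[OF _ n]) (use o d abc in \<open>auto simp: collinear_iff_cross2 pt_diff cross2_pt intro!: dist_pt\<close>)

text \<open>The version for clockwise labels: tiles may occur as mirror images.\<close>

lemma tileable_pt_triangle':
  assumes o: "(rx - px) * (qy - py) - (ry - py) * (qx - px) > 0"
    and n: "n > 0" and abc: "a \<ge> 0" "b \<ge> 0" "c \<ge> 0"
    and d: "(px - qx)\<^sup>2 + 7 * (py - qy)\<^sup>2 = (real n * c)\<^sup>2" "(px - rx)\<^sup>2 + 7 * (py - ry)\<^sup>2 = (real n * b)\<^sup>2"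
      "(qx - rx)\<^sup>2 + 7 * (qy - ry)\<^sup>2 = (real n * a)\<^sup>2"
    and K: "\<And>s t. K s t \<longleftrightarrow> 0 \<le> (rx - px) * (t - py) - (ry - py) * (s - px) \<and>
      0 \<le> (qx - rx) * (t - ry) - (qy - ry) * (s - rx) \<and> 0 \<le> (px - qx) * (t - qy) - (py - qy) * (s - qx)"
  shows "tileable a b c (rg K)"
proof -
  have "convex hull {pt px py, pt qx qy, pt rx ry} = rg K"
    using hull_pt[OF o K] by (simp add: insert_commute)
  moreover have "tileable a b c (convex hull {pt px py, pt qx qy, pt rx ry})"
  proof (rule tileable_triangle[OF _ n])
    show "\<not> collinear {pt px py, pt qx qy, pt rx ry}"
      using o by (simp add: collinear_iff_cross2 pt_diff cross2_pt mult.commute)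
  qed (use d abc in \<open>auto intro!: dist_pt\<close>)
  ultimately show ?thesis by simp
qed

text \<open>Cramer's rule inverts the coordinates; the bounds carry the determinant as a factor to
  avoid denominators.\<close>

lemma tileable_pt_parallelogram:
  assumes D: "ux * vy - uy * vx > 0" and abc: "a \<ge> 0" "b \<ge> 0" "c \<ge> 0"
    and d: "ux\<^sup>2 + 7 * uy\<^sup>2 = c\<^sup>2" "vx\<^sup>2 + 7 * vy\<^sup>2 = b\<^sup>2" "(ux - vx)\<^sup>2 + 7 * (uy - vy)\<^sup>2 = a\<^sup>2"
    and K: "\<And>s t. K s t \<longleftrightarrow> 0 \<le> (s - ox) * vy - (t - oy) * vx \<and>
      (s - ox) * vy - (t - oy) * vx \<le> real (Suc m) * (ux * vy - uy * vx) \<and>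
      0 \<le> ux * (t - oy) - uy * (s - ox) \<and> ux * (t - oy) - uy * (s - ox) \<le> real (Suc n) * (ux * vy - uy * vx)"
  shows "tileable a b c (rg K)"
proof -
  define D where "D = ux * vy - uy * vx"
  have D0: "D > 0" using D by (simp add: D_def)
  interpret lattice "pt ux uy" "pt vx vy" a b c
    by unfold_locales (use D abc d in \<open>auto simp: pt_diff cross2_pt intro!: norm_pt\<close>)
  have "rg K = reg (pt ox oy) (pt ux uy) (pt vx vy) (\<lambda>s t. 0 \<le> s \<and> s \<le> real (Suc m) \<and> 0 \<le> t \<and> t \<le> real (Suc n))"
    (is "_ = ?R")
  proof (intro set_eqI iffI)
    fix x assume "x \<in> rg K"
    then obtain s t where x: "x = pt s t" and k: "K s t" by (auto simp: rg_def)
    define p q where "p = ((s - ox) * vy - (t - oy) * vx) / D" and "q = (ux * (t - oy) - uy * (s - ox)) / D"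
    have pq: "D * p = (s - ox) * vy - (t - oy) * vx" "D * q = ux * (t - oy) - uy * (s - ox)"
      using D0 by (simp_all add: p_def q_def)
    have "D * (p * ux + q * vx) = D * (s - ox)" "D * (p * uy + q * vy) = D * (t - oy)"
      using pq by (simp_all add: distrib_left mult.assoc[symmetric]) (simp_all add: D_def algebra_simps)
    then have "p * ux + q * vx = s - ox" "p * uy + q * vy = t - oy" using D0 by simp_all
    then have "s = ox + p * ux + q * vx" "t = oy + p * uy + q * vy" by simp_all
    then have "x = pt ox oy + p *\<^sub>R pt ux uy + q *\<^sub>R pt vx vy"
      unfolding x by (simp add: point_eq_iff algebra_simps)
    moreover have "0 \<le> p" "p \<le> real (Suc m)" "0 \<le> q" "q \<le> real (Suc n)"
      using k[unfolded K] D0 unfolding p_def q_def D_def[symmetric] by (simp_all add: divide_le_eq)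
    ultimately show "x \<in> ?R" unfolding reg_def by blast
  next
    fix x assume "x \<in> ?R"
    then obtain p q where x: "x = pt ox oy + p *\<^sub>R pt ux uy + q *\<^sub>R pt vx vy"
      and pq: "0 \<le> p" "p \<le> real (Suc m)" "0 \<le> q" "q \<le> real (Suc n)" by (auto simp: reg_def)
    define s t where "s = ox + p * ux + q * vx" and "t = oy + p * uy + q * vy"
    have "x = pt s t" unfolding x s_def t_def by (simp add: point_eq_iff algebra_simps)
    moreover have "K s t"
    proof -
      have "(s - ox) * vy - (t - oy) * vx = p * D" "ux * (t - oy) - uy * (s - ox) = q * D"
        by (simp_all add: s_def t_def D_def algebra_simps)
      then show ?thesis unfolding K D_def[symmetric] using pq D0 by (simp add: mult_right_mono)
    qed
    ultimately show "x \<in> rg K" by simp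
  qed
  then show ?thesis using parallelogram by simp
qed

text \<open>With apex \<open>D = (225, 75)\<close>, base ends \<open>A = (0, 0)\<close>, \<open>C = (450, 0)\<close> and \<open>P = (210, 30)\<close>, the regions
  \<open>R1\<close>, \<open>R2\<close>, \<open>R3\<close>, \<open>R4\<close>, \<open>R5\<close> are the five sectors around \<open>P\<close>. The trapezoids \<open>R3\<close> and \<open>R5\<close> are each cut into
  two triangles \<open>a\<close>, \<open>b\<close> and a parallelogram \<open>c\<close>; \<open>T1\<close> is the similar triangle beyond the bisector \<open>CD\<close>.\<close>

lemma tileable_T1: "tileable (8/5) 2 (12/5) (rg (\<lambda>s t. 3 * s + t \<le> 1350 \<and> 3 * t \<le> s \<and> 450 \<le> s + 3 * t))"
  by (rule tileable_pt_triangle[where px = 450 and py = 0 and qx = 405 and qy = 135 and rx = 225 and ry = 75 and n = 150]) (auto simp: power2_eq_square)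

lemma tileable_R1: "tileable (8/5) 2 (12/5) (rg (\<lambda>s t. s + 3 * t \<le> 450 \<and> t + 600 \<le> 3 * s \<and> 30 \<le> t))"
  by (rule tileable_pt_triangle[where px = 360 and py = 30 and qx = 225 and qy = 75 and rx = 210 and ry = 30 and n = 75]) (auto simp: power2_eq_square)

lemma tileable_R2: "tileable (8/5) 2 (12/5) (rg (\<lambda>s t. 300 \<le> s + 3 * t \<and> 3 * s \<le> t + 600 \<and> 3 * t \<le> s))"
  by (rule tileable_pt_triangle'[where px = 225 and py = 75 and qx = 210 and qy = 30 and rx = 150 and ry = 50 and n = 50]) (auto simp: power2_eq_square)

lemma tileable_R4: "tileable (8/5) 2 (12/5) (rg (\<lambda>s t. 3 * s + t \<le> 660 \<and> 3 * t + 120 \<le> s \<and> 0 \<le> t))"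
  by (rule tileable_pt_triangle'[where px = 120 and py = 0 and qx = 210 and qy = 30 and rx = 220 and ry = 0 and n = 50]) (auto simp: power2_eq_square)

text \<open>The cut at height 14 gives this triangle sides 96, 120, 144: side 96 is the longest side
  of the neighbour with sides 64, 80, 96, and side 120 borders the parallelogram below. The same
  pair of triangles occurs in \<open>R5\<close>.\<close>

lemma tileable_R3a: "tileable (8/5) 2 (12/5) (rg (\<lambda>s t. 3 * s + t \<le> 500 \<and> 3 * t \<le> s \<and> 14 \<le> t))"
  by (rule tileable_pt_triangle'[where px = 42 and py = 14 and qx = 150 and qy = 50 and rx = 162 and ry = 14 and n = 60]) (auto simp: power2_eq_square)

lemma tileable_R3b: "tileable (8/5) 2 (12/5) (rg (\<lambda>s t. 500 \<le> 3 * s + t \<and> s \<le> 3 * t + 120 \<and> s + 3 * t \<le> 300))"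
  by (rule tileable_pt_triangle[where px = 150 and py = 50 and qx = 162 and qy = 14 and rx = 210 and ry = 30 and n = 40]) (auto simp: power2_eq_square)

lemma tileable_R5a: "tileable (8/5) 2 (12/5) (rg (\<lambda>s t. 9 * t + 1100 \<le> 5 * s \<and> 0 \<le> t \<and> s + 3 * t \<le> 364))"
  by (rule tileable_pt_triangle'[where px = 364 and py = 0 and qx = 220 and qy = 0 and rx = 274 and ry = 30 and n = 60]) (auto simp: power2_eq_square)

lemma tileable_R5b: "tileable (8/5) 2 (12/5) (rg (\<lambda>s t. 5 * s \<le> 9 * t + 1100 \<and> t \<le> 30 \<and> 660 \<le> 3 * s + t))"
  by (rule tileable_pt_triangle[where px = 220 and py = 0 and qx = 274 and qy = 30 and rx = 210 and ry = 30 and n = 40]) (auto simp: power2_eq_square)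

text \<open>The sides are \<open>120 = 50 * 12/5\<close> and \<open>56 = 28 * 2\<close>; the other
  parallelogram has sides 120 and \<open>86 = 43 * 2\<close>. This is the origin of the tile: 2 is
  the greatest common divisor of 56 and 86, and scaling 4, 5, 6 by 2/5 gives the middle side length
  2. \<open>m\<close> and \<open>n\<close> are one less than the numbers of cells.\<close>

lemma tileable_R3c: "tileable (8/5) 2 (12/5) (rg (\<lambda>s t. 0 \<le> t \<and> s \<le> 3 * t + 120 \<and> t \<le> 14 \<and> 3 * t \<le> s))"
  by (rule tileable_pt_parallelogram[where ux = "12/5" and uy = 0 and vx = "3/2" and vy = "1/2" and ox = 0 and oy = 0 and m = 49 and n = 27]) (auto simp: power2_eq_square field_simps)

lemma tileable_R5c: "tileable (8/5) 2 (12/5) (rg (\<lambda>s t. s + 3 * t \<le> 450 \<and> t \<le> 30 \<and> 364 \<le> s + 3 * t \<and> 0 \<le> t))"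
  by (rule tileable_pt_parallelogram[where ux = "-9/5" and uy = "3/5" and vx = "-2" and vy = 0 and ox = 450 and oy = 0 and m = 49 and n = 42]) (auto simp: power2_eq_square field_simps)

lemma tileable_R3ab: "tileable (8/5) 2 (12/5) (rg (\<lambda>s t. 14 \<le> t \<and> s \<le> 3 * t + 120 \<and> s + 3 * t \<le> 300 \<and> 3 * t \<le> s))"
  by (rule tileable_rg_Un[OF tileable_R3a tileable_R3b, where a = "-3" and b = "-1" and c = "-500"]) argo+

lemma tileable_R3: "tileable (8/5) 2 (12/5) (rg (\<lambda>s t. 0 \<le> t \<and> s \<le> 3 * t + 120 \<and> s + 3 * t \<le> 300 \<and> 3 * t \<le> s))"
  by (rule tileable_rg_Un[OF tileable_R3ab tileable_R3c, where a = "0" and b = "-1" and c = "-14"]) argo+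

lemma tileable_R5ab: "tileable (8/5) 2 (12/5) (rg (\<lambda>s t. 0 \<le> t \<and> s + 3 * t \<le> 364 \<and> t \<le> 30 \<and> 660 \<le> 3 * s + t))"
  by (rule tileable_rg_Un[OF tileable_R5a tileable_R5b, where a = "5" and b = "-9" and c = "1100"]) argo+

lemma tileable_R5: "tileable (8/5) 2 (12/5) (rg (\<lambda>s t. 0 \<le> t \<and> s + 3 * t \<le> 450 \<and> t \<le> 30 \<and> 660 \<le> 3 * s + t))"
  by (rule tileable_rg_Un[OF tileable_R5ab tileable_R5c, where a = "1" and b = "3" and c = "364"]) argo+

lemma tileable_R23: "tileable (8/5) 2 (12/5) (rg (\<lambda>s t. (300 \<le> s + 3 * t \<and> 3 * s \<le> t + 600 \<and> 3 * t \<le> s) \<or> (0 \<le> t \<and> s \<le> 3 * t + 120 \<and> s + 3 * t \<le> 300 \<and> 3 * t \<le> s)))"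
  by (rule tileable_rg_Un[OF tileable_R2 tileable_R3, where a = "1" and b = "3" and c = "300"]) argo+

lemma tileable_R123: "tileable (8/5) 2 (12/5) (rg (\<lambda>s t. (s + 3 * t \<le> 450 \<and> t + 600 \<le> 3 * s \<and> 30 \<le> t) \<or> (300 \<le> s + 3 * t \<and> 3 * s \<le> t + 600 \<and> 3 * t \<le> s) \<or> (0 \<le> t \<and> s \<le> 3 * t + 120 \<and> s + 3 * t \<le> 300 \<and> 3 * t \<le> s)))"
  by (rule tileable_rg_Un[OF tileable_R1 tileable_R23, where a = "-3" and b = "1" and c = "-600"]) argo+

lemma tileable_R45: "tileable (8/5) 2 (12/5) (rg (\<lambda>s t. 0 \<le> t \<and> s + 3 * t \<le> 450 \<and> t \<le> 30 \<and> 3 * t + 120 \<le> s))"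
  by (rule tileable_rg_Un[OF tileable_R4 tileable_R5, where a = "-3" and b = "-1" and c = "-660"]) argo+

text \<open>The part above meets the part below in a bent line through \<open>P\<close>, running
  along \<open>t = 30\<close> and \<open>s = 3 * t + 120\<close>, so the overlap is handled on each
  line separately.\<close>

lemma tileable_isosceles: "tileable (8/5) 2 (12/5) (rg (\<lambda>s t. 0 \<le> t \<and> s + 3 * t \<le> 450 \<and> 3 * t \<le> s))"
proof -
  have "negligible (rg (\<lambda>s t. (s + 3 * t \<le> 450 \<and> t + 600 \<le> 3 * s \<and> 30 \<le> t) \<or> (300 \<le> s + 3 * t \<and> 3 * s \<le> t + 600 \<and> 3 * t \<le> s)) \<inter> rg (\<lambda>s t. 0 \<le> t \<and> s + 3 * t \<le> 450 \<and> t \<le> 30 \<and> 3 * t + 120 \<le> s))"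
    by (rule negligible_rg_Int[where a = 0 and b = 1 and c = 30]) argo+
  moreover have "negligible (rg (\<lambda>s t. 0 \<le> t \<and> s \<le> 3 * t + 120 \<and> s + 3 * t \<le> 300 \<and> 3 * t \<le> s) \<inter> rg (\<lambda>s t. 0 \<le> t \<and> s + 3 * t \<le> 450 \<and> t \<le> 30 \<and> 3 * t + 120 \<le> s))"
    by (rule negligible_rg_Int[where a = "-1" and b = "3" and c = "-120"]) argo+
  ultimately have n: "negligible (rg (\<lambda>s t. (s + 3 * t \<le> 450 \<and> t + 600 \<le> 3 * s \<and> 30 \<le> t) \<or> (300 \<le> s + 3 * t \<and> 3 * s \<le> t + 600 \<and> 3 * t \<le> s) \<or> (0 \<le> t \<and> s \<le> 3 * t + 120 \<and> s + 3 * t \<le> 300 \<and> 3 * t \<le> s)) \<inter> rg (\<lambda>s t. 0 \<le> t \<and> s + 3 * t \<le> 450 \<and> t \<le> 30 \<and> 3 * t + 120 \<le> s))"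
    unfolding rg_Un Int_Un_distrib2 by simp
  show ?thesis
    by (rule tileable_rg_Un'[OF tileable_R123 tileable_R45 n]) argo
qed

section \<open>The triangle with sides 360, 450, 540 and its reptiling\<close>

abbreviation "pA \<equiv> pt 0 0"
abbreviation "pB \<equiv> pt 405 135"
abbreviation "pC \<equiv> pt 450 0"

lemma big_dists: "dist pA pB = 540" "dist pA pC = 450" "dist pB pC = 360"
  by (rule dist_pt; simp add: power2_eq_square)+

text \<open>The identity \<open>1/8 = 2 * (3/4)^2 - 1\<close> is the relation
  \<open>\<gamma> = 2\<alpha>\<close>.\<close>

lemma big_angles: "angle pB pA pC = arccos (3/4)" "angle pA pB pC = arccos (9/16)" "angle pA pC pB = arccos (1/8)"
  unfolding angle_dist dist_commute[of pB pA] dist_commute[of pC pA] dist_commute[of pC pB] big_dists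
  by (simp_all add: power2_eq_square)

lemma big_noncollinear: "\<not> collinear {pA, pB, pC}"
  by (simp add: collinear_iff_cross2 pt_diff cross2_pt)

lemma arccos_acute: "0 < x \<Longrightarrow> x \<le> 1 \<Longrightarrow> arccos x < pi / 2"
  using arccos_less_arccos[of 0 x] by simp

lemma big_acute: "acute pA pB pC"
  unfolding acute_def big_angles by (intro conjI arccos_acute) simp_all

lemma big_hull: "convex hull {pA, pB, pC} = rg (\<lambda>s t. 0 \<le> t \<and> 3 * s + t \<le> 1350 \<and> 3 * t \<le> s)"
proof -
  have "convex hull {pA, pC, pB} = rg (\<lambda>s t. 0 \<le> t \<and> 3 * s + t \<le> 1350 \<and> 3 * t \<le> s)"
    by (rule hull_pt) auto
  then show ?thesis by (simp add: insert_commute)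
qed

lemma tiled_by_reptiling:
  assumes P: "tiled_by a b c (convex hull {A, B, C}) P" and two: "card P \<ge> 2"
    and nc: "\<not> collinear {A, B, C}" and m: "m > 0"
    and d: "dist A B = m * c" "dist A C = m * b" "dist B C = m * a"
  shows "reptiling (convex hull {A, B, C}) P"
proof -
  have copy: "\<exists>X Y Z. \<not> collinear {X, Y, Z} \<and> t = convex hull {X, Y, Z} \<and> dist X Y = c \<and> dist X Z = b \<and> dist Y Z = a"
    if "t \<in> P" for t using P that by (auto simp: tiled_by_def is_copy_def)
  have sim: "similar t (convex hull {A, B, C})" if t: "t \<in> P" for t
  proof -
    obtain X Y Z where "\<not> collinear {X, Y, Z}" "t = convex hull {X, Y, Z}" "dist X Y = c" "dist X Z = b" "dist Y Z = a"
      using copy[OF t] by blast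
    then obtain f where "similarity m f" "f ` t = convex hull {A, B, C}"
      using similarity_exists[of X Y Z m A B C] m d by metis
    then show ?thesis unfolding similar_def similarity_def by blast
  qed
  have cong: "congruent_sets s t" if st: "s \<in> P" "t \<in> P" for s t
  proof -
    obtain X Y Z where 1: "\<not> collinear {X, Y, Z}" "s = convex hull {X, Y, Z}" "dist X Y = c" "dist X Z = b" "dist Y Z = a"
      using copy[OF st(1)] by blast
    obtain X' Y' Z' where 2: "t = convex hull {X', Y', Z'}" "dist X' Y' = c" "dist X' Z' = b" "dist Y' Z' = a"
      using copy[OF st(2)] by blast
    obtain f where f: "similarity 1 f" "f ` s = t"
      by (rule similarity_exists[OF 1(1), of 1 X' Y' Z']) (use 1 2 in auto)
    have "dist (f x) (f y) = dist x y" for x y using similarity_dist[OF f(1), of x y] by simp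
    then show ?thesis unfolding congruent_sets_def using f(2) by blast
  qed
  have "\<Union>P = convex hull {A, B, C}" and "\<forall>s\<in>P. \<forall>t\<in>P. s \<noteq> t \<longrightarrow> interior s \<inter> interior t = {}"
    and "\<forall>t\<in>P. is_copy a b c t"
    using P by (simp_all add: tiled_by_def)
  moreover from this(3) have "\<forall>t\<in>P. is_triangle t" using is_copy_triangle by blast
  ultimately have "r_reptiling (card P) (convex hull {A, B, C}) P"
    unfolding r_reptiling_def using two sim cong by simp
  then show ?thesis unfolding reptiling_def using two by blast
qed

lemma card_ge_2: "finite S \<Longrightarrow> x \<in> S \<Longrightarrow> y \<in> S \<Longrightarrow> x \<noteq> y \<Longrightarrow> card S \<ge> 2"
  using card_mono[of S "{x, y}"] by simp

text \<open>\<open>pC\<close> lies in both pieces, hence in a tile of each. The two tiles differ, as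
  a common one would lie in the negligible overlap.\<close>

lemma split_reptiling:
  obtains P where "reptiling (convex hull {pA, pB, pC}) P" "card {t \<in> P. pC \<in> t} \<ge> 2"
proof -
  let ?L = "rg (\<lambda>s t. 3 * s + t \<le> 1350 \<and> 3 * t \<le> s \<and> 450 \<le> s + 3 * t)"
  let ?R = "rg (\<lambda>s t. 0 \<le> t \<and> s + 3 * t \<le> 450 \<and> 3 * t \<le> s)"
  obtain P Q where P: "tiled_by (8/5) 2 (12/5) ?L P" and Q: "tiled_by (8/5) 2 (12/5) ?R Q"
    using tileable_T1 tileable_isosceles unfolding tileable_def by blast
  have neg: "negligible (?L \<inter> ?R)"
    by (rule negligible_rg_Int[where a = 1 and b = 3 and c = 450]) auto
  have "?L \<union> ?R = convex hull {pA, pB, pC}"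
    unfolding big_hull rg_Un[symmetric] by (rule arg_cong[of _ _ rg]) (intro ext; argo)
  then have PQ: "tiled_by (8/5) 2 (12/5) (convex hull {pA, pB, pC}) (P \<union> Q)"
    using tiled_by_Un[OF P Q neg] by simp
  have "pC \<in> \<Union>P" "pC \<in> \<Union>Q" using P Q by (simp_all add: tiled_by_def)
  then obtain s t where st: "s \<in> P" "pC \<in> s" "t \<in> Q" "pC \<in> t" by blast
  have "s \<noteq> t"
  proof
    assume "s = t"
    then have "s \<subseteq> ?L \<inter> ?R" using st P Q by (auto simp: tiled_by_def)
    then have "negligible s" using neg negligible_subset by blast
    moreover have "is_triangle s" using st P is_copy_triangle by (auto simp: tiled_by_def)
    ultimately show False using measure_triangle_pos[of s] negligible_imp_measure0[of s] by simp
  qed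
  moreover have fin: "finite (P \<union> Q)" using P Q by (simp add: tiled_by_def)
  ultimately have two: "card {u \<in> P \<union> Q. pC \<in> u} \<ge> 2" using st by (intro card_ge_2[of _ s t]) auto
  also have "card {u \<in> P \<union> Q. pC \<in> u} \<le> card (P \<union> Q)" by (rule card_mono[OF fin]) auto
  \<comment> \<open>The ratio 225 is 540 divided by the tile side 12/5.\<close>
  finally have "reptiling (convex hull {pA, pB, pC}) (P \<union> Q)"
    by (rule tiled_by_reptiling[OF PQ _ big_noncollinear, of 225]) (simp_all add: big_dists)
  then show thesis using that two by blast
qed

theorem theorem2:
  fixes k :: nat
  assumes "k > 0"
  shows "(\<exists>A B C :: point. \<not> collinear {A, B, C} \<and> acute A B C \<and>
            (\<exists>P. reptiling (convex hull {A, B, C}) P \<and>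
                 (\<exists>v\<in>{A, B, C}. card {t \<in> P. v \<in> t} = k)))
         \<longleftrightarrow> k = 1 \<or> k = 2"
proof
  assume "\<exists>A B C :: point. \<not> collinear {A, B, C} \<and> acute A B C \<and>
            (\<exists>P. reptiling (convex hull {A, B, C}) P \<and> (\<exists>v\<in>{A, B, C}. card {t \<in> P. v \<in> t} = k))"
  then obtain A B C :: point and P v where nc: "\<not> collinear {A, B, C}" and ac: "acute A B C"
    and rep: "reptiling (convex hull {A, B, C}) P" and v: "v \<in> {A, B, C}" and k: "card {t \<in> P. v \<in> t} = k"
    by blast
  have "k \<le> 2" using tiles_at_vertex_le_2[OF nc ac rep v] k by simp
  then show "k = 1 \<or> k = 2" using assms by linarith
next
  assume k: "k = 1 \<or> k = 2"
  obtain P where rep: "reptiling (convex hull {pA, pB, pC}) P" and two: "card {t \<in> P. pC \<in> t} \<ge> 2"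
    by (rule split_reptiling)
  obtain lam va vb vc where "labelled_tiling pA pB pC P lam va vb vc"
    using reptiling_labelled[OF big_noncollinear big_acute rep] .
  then interpret labelled_tiling pA pB pC P lam va vb vc .
  \<comment> \<open>One reptiling serves both values of \<open>k\<close>: the smallest angle is at
    \<open>pA\<close>, and at \<open>pC\<close> the lower bound 2 meets the general upper
    bound.\<close>
  have "card {t \<in> P. pA \<in> t} = 1"
    by (rule tiles_at_smallest_angle) (simp_all add: big_angles arccos_le_arccos)
  moreover have "card {t \<in> P. pC \<in> t} = 2" using two tiles_at_C by simp
  ultimately have "\<exists>v\<in>{pA, pB, pC}. card {t \<in> P. v \<in> t} = k" using k by auto
  then show "\<exists>A B C :: point. \<not> collinear {A, B, C} \<and> acute A B C \<and>
            (\<exists>P. reptiling (convex hull {A, B, C}) P \<and> (\<exists>v\<in>{A, B, C}. card {t \<in> P. v \<in> t} = k))"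
    using big_noncollinear big_acute rep by blast
qed

end
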